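(* Let $n\ge2$ and $\chi=\chi(t),\zeta=\zeta(\tau)\in C_0^2(\mathbb{R})$. There is a sufficiently large number $\beta_2$ depending on $n$ such that for all $w=w(t,\tau,x)\in C^1(\mathbb{R}^2;C^\infty(\mathbb{R}^n))$ with $\operatorname{supp}w\subset\mathbb{R}\times(0,\infty)\times\{x\in\mathbb{R}^n:|x|<e\}$ and all $\beta\ge\beta_2$ with $\beta\in\mathbb{N}+\frac14$, $$\begin{aligned}&\iiint\varphi_\beta^2(1+\psi'')\chi^2\zeta^2\left(|x|^{-n+2}|\nabla w|^2+\beta^2|x|^{-n}|w|^2\right)dx\,d\tau\,dt\\&\lesssim\iiint\varphi_\beta^2|x|^{-n+4}\chi^2\zeta^2(\Delta w-\partial_tw-\partial_\tau w)^2\,dx\,d\tau\,dt\\&\quad+\iiint\varphi_\beta^2|x|^{-n+4}|\chi'\zeta w|^2\,dx\,d\tau\,dt+\iiint\varphi_\beta^2|x|^{-n+4}|\chi\zeta'w|^2\,dx\,d\tau\,dt.\end{aligned}$$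
   Context: $\varphi_\beta(x)=\exp(\psi(y))$ with $y=-\log|x|$ and $\psi(y)=\beta y+\frac1{16}\beta e^{-y/2}$; in the integrals $\psi''=\psi''(-\log|x|)$. $\nabla,\Delta$ act in $x\in\mathbb{R}^n$. $A\lesssim B$ means $A\le CB$ with a constant $C>0$ independent of $\beta$ and $w$.
   Formalization: The left-hand integral is additionally assumed finite: otherwise the claim fails, e.g. for w equal near x=0 to a(t,τ) times a harmonic homogeneous polynomial of degree β−1/4, where the left side is infinite and the right side finite. It is automatic if w vanishes near x=0. *)

theory Defs
  imports "HOL-Analysis.Analysis"
begin

definition tsupport :: "('a::topological_space \<Rightarrow> real) \<Rightarrow> 'a set" where
  "tsupport f = closure {x. f x \<noteq> 0}"

text \<open>The space \<open>C\<^sub>0\<^sup>2(\<real>)\<close>; the subscript means compact support.\<close>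

definition C2_compact_support :: "(real \<Rightarrow> real) \<Rightarrow> bool" where
  "C2_compact_support f \<longleftrightarrow>
     f differentiable_on UNIV \<and> deriv f differentiable_on UNIV \<and>
     continuous_on UNIV (deriv (deriv f)) \<and> compact (tsupport f)"

definition partial :: "'n \<Rightarrow> (real ^ 'n::finite \<Rightarrow> real) \<Rightarrow> real ^ 'n \<Rightarrow> real" where
  "partial i f x = deriv (\<lambda>h. f (x + h *\<^sub>R axis i 1)) 0"

fun partials :: "'n list \<Rightarrow> (real ^ 'n::finite \<Rightarrow> real) \<Rightarrow> real ^ 'n \<Rightarrow> real" where
  "partials [] f = f"
| "partials (i # is) f = partial i (partials is f)"

definition gradient :: "(real ^ 'n::finite \<Rightarrow> real) \<Rightarrow> real ^ 'n \<Rightarrow> real ^ 'n" where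
  "gradient f x = (\<chi> i. partial i f x)"

definition laplacian :: "(real ^ 'n::finite \<Rightarrow> real) \<Rightarrow> real ^ 'n \<Rightarrow> real" where
  "laplacian f x = (\<Sum>i\<in>UNIV. partial i (partial i f) x)"

definition smooth :: "(real ^ 'n::finite \<Rightarrow> real) \<Rightarrow> bool" where
  "smooth f \<longleftrightarrow> (\<forall>is. partials is f differentiable_on UNIV)"

text \<open>Convergence in the Frechet space \<open>C\<^sup>\<infinity>(\<real>\<^sup>n)\<close>: every partial derivative converges
  uniformly on every compact set.\<close>

definition smooth_tendsto ::
    "('p \<Rightarrow> real ^ 'n::finite \<Rightarrow> real) \<Rightarrow> (real ^ 'n \<Rightarrow> real) \<Rightarrow> 'p filter \<Rightarrow> bool" where
  "smooth_tendsto W f F \<longleftrightarrow>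
     (\<forall>is K. compact K \<longrightarrow> uniform_limit K (\<lambda>p. partials is (W p)) (partials is f) F)"

text \<open>The space \<open>C\<^sup>1(\<real>\<^sup>2; C\<^sup>\<infinity>(\<real>\<^sup>n))\<close>: the two first-order partial derivatives \<open>u\<close>, \<open>v\<close> of
  the map \<open>(t, \<tau>) \<mapsto> w t \<tau>\<close> exist as limits of difference quotients in the Frechet topology,
  and they are continuous maps into \<open>C\<^sup>\<infinity>(\<real>\<^sup>n)\<close>.\<close>

definition C1_smooth :: "(real \<Rightarrow> real \<Rightarrow> real ^ 'n::finite \<Rightarrow> real) \<Rightarrow> bool" where
  "C1_smooth w \<longleftrightarrow>
     (\<forall>t \<tau>. smooth (w t \<tau>)) \<and>
     (\<exists>u v. \<forall>t \<tau>. smooth (u t \<tau>) \<and> smooth (v t \<tau>) \<and>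
        smooth_tendsto (\<lambda>h x. (w (t + h) \<tau> x - w t \<tau> x) / h) (u t \<tau>) (at 0) \<and>
        smooth_tendsto (\<lambda>h x. (w t (\<tau> + h) x - w t \<tau> x) / h) (v t \<tau>) (at 0) \<and>
        smooth_tendsto (\<lambda>(s, \<sigma>). u s \<sigma>) (u t \<tau>) (at (t, \<tau>)) \<and>
        smooth_tendsto (\<lambda>(s, \<sigma>). v s \<sigma>) (v t \<tau>) (at (t, \<tau>)))"

definition psi :: "real \<Rightarrow> real \<Rightarrow> real" where
  "psi \<beta> y = \<beta> * y + 1 / 16 * \<beta> * exp (- y / 2)"

text \<open>The values at \<open>x = 0\<close> of the weights below (where \<open>ln 0 = 0\<close>) are immaterial: they only
  occur under integrals.\<close>

definition phi :: "real \<Rightarrow> real ^ 'n::finite \<Rightarrow> real" where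
  "phi \<beta> x = exp (psi \<beta> (- ln (norm x)))"

definition psi'' :: "real \<Rightarrow> real ^ 'n::finite \<Rightarrow> real" where
  "psi'' \<beta> x = deriv (deriv (psi \<beta>)) (- ln (norm x))"

text \<open>Integrals over \<open>\<real> \<times> \<real> \<times> \<real>\<^sup>n\<close> of nonnegative functions, with values in \<open>[0, \<infinity>]\<close>.\<close>

definition iiint :: "(real \<Rightarrow> real \<Rightarrow> real ^ 'n::finite \<Rightarrow> real) \<Rightarrow> ennreal" where
  "iiint F = (\<integral>\<^sup>+ t. \<integral>\<^sup>+ \<tau>. \<integral>\<^sup>+ x. ennreal (F t \<tau> x) \<partial>lborel \<partial>lborel \<partial>lborel)"

text \<open>The left-hand side may be infinite while the right-hand side is finite if \<open>w\<close> does not vanish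
  to sufficiently high order at \<open>x = 0\<close>, because \<open>phi \<beta> x\<close> blows up there like \<open>|x|\<close> to the power
  \<open>-\<beta>\<close>; an inequality between the two presupposes that the left-hand side is finite. This is
  automatic if \<open>w\<close> is supported away from \<open>x = 0\<close>.\<close>

definition carleman_lhs ::
  "real \<Rightarrow> (real \<Rightarrow> real) \<Rightarrow> (real \<Rightarrow> real) \<Rightarrow> (real \<Rightarrow> real \<Rightarrow> real ^ 'n::finite \<Rightarrow> real) \<Rightarrow> ennreal"
where
  "carleman_lhs \<beta> chi zeta w =
     iiint (\<lambda>t \<tau> x. (phi \<beta> x)\<^sup>2 * (1 + psi'' \<beta> x) * (chi t)\<^sup>2 * (zeta \<tau>)\<^sup>2 *
       (norm x powr (- real CARD('n) + 2) * (norm (gradient (w t \<tau>) x))\<^sup>2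
        + \<beta>\<^sup>2 * norm x powr (- real CARD('n)) * \<bar>w t \<tau> x\<bar>\<^sup>2))"

definition carleman_rhs ::
  "real \<Rightarrow> (real \<Rightarrow> real) \<Rightarrow> (real \<Rightarrow> real) \<Rightarrow> (real \<Rightarrow> real \<Rightarrow> real ^ 'n::finite \<Rightarrow> real) \<Rightarrow> ennreal"
where
  "carleman_rhs \<beta> chi zeta w =
     iiint (\<lambda>t \<tau> x. (phi \<beta> x)\<^sup>2 * norm x powr (- real CARD('n) + 4) * (chi t)\<^sup>2 * (zeta \<tau>)\<^sup>2 *
       (laplacian (w t \<tau>) x - deriv (\<lambda>s. w s \<tau> x) t - deriv (\<lambda>\<sigma>. w t \<sigma> x) \<tau>)\<^sup>2)
     + iiint (\<lambda>t \<tau> x. (phi \<beta> x)\<^sup>2 * norm x powr (- real CARD('n) + 4) *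
         \<bar>deriv chi t * zeta \<tau> * w t \<tau> x\<bar>\<^sup>2)
     + iiint (\<lambda>t \<tau> x. (phi \<beta> x)\<^sup>2 * norm x powr (- real CARD('n) + 4) *
         \<bar>chi t * deriv zeta \<tau> * w t \<tau> x\<bar>\<^sup>2)"

end

theory Submission
  imports Defs
begin

text \<open>
  In polar coordinates \<open>x = e\<^sup>-\<^sup>y \<omega>\<close> the weight \<open>|x|\<^sup>-\<^sup>n dx\<close> becomes \<open>dy d\<omega>\<close>, and
  \<open>|x|\<^sup>2 \<Delta> = \<partial>\<^sub>y\<^sup>2 - (n - 2) \<partial>\<^sub>y + \<Delta>\<^sub>S\<close>. Along the lines \<open>(t, \<tau>) = (c + s, s)\<close> the two time
  derivatives become \<open>\<partial>\<^sub>s\<close>, and expanding in spherical harmonics of degree \<open>k\<close> replaces \<open>-\<Delta>\<^sub>S\<close> by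
  \<open>k (k + n - 2)\<close>. With \<open>v = e\<^sup>\<psi> w\<close>, \<open>p = \<psi>' + (n - 2) / 2\<close>, \<open>\<kappa> = k + (n - 2) / 2\<close>, each mode satisfies
  \<open>f = S v + A v\<close> with the symmetric part \<open>S v = v\<^sub>y\<^sub>y + (p\<^sup>2 - \<kappa>\<^sup>2) v\<close> and the antisymmetric part
  \<open>A v = - (2 p v\<^sub>y + p' v) - e\<^sup>-\<^sup>2\<^sup>y v\<^sub>s\<close>. The dangerous commutator term \<open>- 4 e\<^sup>-\<^sup>2\<^sup>y v\<^sub>y v\<^sub>s\<close> equals
  \<open>4 v\<^sub>y (A v + 2 p v\<^sub>y + p' v)\<close> and is therefore harmless. This gives
  \<open>\<integral>f\<^sup>2 = \<integral>(S v)\<^sup>2 + (A v + 2 v\<^sub>y)\<^sup>2 + (8 p - 4 + 4 p') v\<^sub>y\<^sup>2 + (4 p\<^sup>2 + 3/4) p' v\<^sup>2\<close>. The terms with \<open>p' = \<psi>''\<close> are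
  the weighted part of the claim; the unweighted part follows by pairing \<open>S v\<close> with \<open>\<plusminus>v\<close>, because
  \<open>\<beta> \<in> \<nat> + 1/4\<close> stays at distance \<open>1/4\<close> from every degree \<open>k\<close>. Finiteness of the left-hand side
  makes the error of a cutoff near \<open>x = 0\<close> vanish in the limit.\<close>

subsection \<open>One spherical mode: the pointwise estimate\<close>

text \<open>The obstacle is that \<open>p\<close> varies with y while the angular gap concerns a
  constant: \<open>p\<close> may cross \<kappa> along a ray, so \<open>p^2 - \<kappa>^2\<close> is
  neither signed nor bounded away from 0. Its limit \<open>B = \<beta> + (n - 2) / 2\<close> for y
  tending to infinity is safe, because \<open>B - \<kappa> = \<beta> - k\<close> in every dimension,
  and freezing \<open>p\<close> at \<open>B\<close> costs only \<open>B^2 - p^2 = O(B p')\<close>,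
  which the term \<open>4 p^2 p' v^2\<close> pays for. The factor 1/16 in \<psi> keeps
  \<open>p\<close> comparable to \<open>B\<close> on all of \<open>y \<ge> -1\<close>. The gap
  yields \<open>|B^2 - \<kappa>^2| \<ge> (B + \<kappa>) / 4\<close>, linear in
  \<open>B + \<kappa>\<close>, while the claim needs the square; hence \<open>S v\<close> is paired
  with a multiple of \<open>(B + \<kappa>) v\<close>, and the resulting \<open>v_y^2\<close> is
  covered by the term in \<open>p v_y^2\<close> as long as \<open>\<kappa> \<le> 2 B\<close>. Beyond
  that \<open>S\<close> is coercive by itself. Constants: 70 for a compactly supported mode, 140
  after the cutoff is removed, 420 after the conjugation is undone, 1260 after the derivatives of
  \<open>chi\<close> and \<open>zeta\<close> are split off.\<close>

lemma conj_square_identity: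
  fixes v v1 v2 vs vs1 p p1 E \<kappa> :: real
  defines "S \<equiv> v2 + (p\<^sup>2 - \<kappa>\<^sup>2) * v"
  defines "f \<equiv> v2 - 2 * p * v1 + (p\<^sup>2 - p1 - \<kappa>\<^sup>2) * v - E * vs"
  defines "dG \<equiv> - 4 * p1 * v1\<^sup>2 - 4 * p * v1 * v2 - 2 * p1 * v * v2 + p1 / 4 * v\<^sup>2
     + 4 * E * v1 * vs - 2 * E * v2 * vs - 2 * E * v1 * vs1
     - (2 * p1 * (p\<^sup>2 - \<kappa>\<^sup>2) + 4 * p\<^sup>2 * p1) * v\<^sup>2 - 4 * p * (p\<^sup>2 - \<kappa>\<^sup>2) * v * v1
     - p1 * v\<^sup>2 + 4 * p1 * v * v1"
  defines "dH \<equiv> 2 * E * v1 * vs1 - 2 * (p\<^sup>2 - \<kappa>\<^sup>2) * E * v * vs"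
  shows "f\<^sup>2 = S\<^sup>2 + (f - S + 2 * v1)\<^sup>2 + (8 * p - 4 + 4 * p1) * v1\<^sup>2 + (4 * p\<^sup>2 * p1 + 3 / 4 * p1) * v\<^sup>2 + dG + dH"
  \<comment> \<open>\<open>f - S\<close> is the antisymmetric part \<open>A\<close>. The cross term
    \<open>2 S A\<close> is integrated by parts with \<open>p1' = - p1 / 2\<close> and
    \<open>E' = - 2 E\<close> already inserted, so \<open>dG\<close> is a y-derivative and
    \<open>dH\<close> an s-derivative of quadratic expressions. After
    \<open>- 4 E v1 vs = 4 v1 (A + 2 p v1 + p1 v)\<close> the term \<open>4 v1 A\<close> completes
    \<open>A^2\<close> to \<open>(A + 2 v1)^2\<close> at the price of \<open>- 4 v1^2\<close>. The
    coefficient 3/4 is \<open>1 - 1/4\<close>: the term \<open>4 p1 v v1\<close> contributes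
    \<open>p1 v^2\<close>, and \<open>2 p1' v v1\<close> takes \<open>p1 / 4\<close> of it
    away.\<close>
  unfolding S_def f_def dG_def dH_def
  by (simp add: power2_eq_square field_simps)

text \<open>Pairs \<open>S\<close> with a constant multiple of \<open>v\<close>: as \<open>c\<close>
  does not depend on y, \<open>c * (v1^2 + v * v2)\<close> is the y-derivative of
  \<open>c v v1\<close> and disappears on integration. The sign of \<open>c\<close> is dictated by
  \<open>B - \<kappa>\<close>, not by \<open>p - \<kappa>\<close>, which may change along the ray.
  For \<open>2 * B < \<kappa>\<close> coercivity takes the place of the gap.\<close>

lemma angular_gap_bound:
  fixes v v1 v2 p p1 \<kappa> \<beta> B :: real
  assumes \<beta>: "1 \<le> \<beta>" "\<beta> \<le> B" "B \<le> 8/5 * p" "p \<le> B" "B - p = 2 * p1" "0 \<le> p1"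
    and \<kappa>: "0 \<le> \<kappa>" "1/4 \<le> \<bar>B - \<kappa>\<bar>"
  defines "S \<equiv> v2 + (p\<^sup>2 - \<kappa>\<^sup>2) * v"
  defines "Z \<equiv> S\<^sup>2 + 4 * p * v1\<^sup>2 + 4 * p1 * v1\<^sup>2 + 4 * p\<^sup>2 * p1 * v\<^sup>2"
  defines "c \<equiv> if 2 * B < \<kappa> then 4 else if \<kappa> < B then - 8 * (B + \<kappa>) else 8 * (B + \<kappa>)"
  shows "(\<kappa>\<^sup>2 + \<beta>\<^sup>2) * v\<^sup>2 \<le> 64 * Z + c * (v1\<^sup>2 + v * v2)"
proof (cases "2 * B < \<kappa>")
  case True
  have k2: "2 \<le> \<kappa>" using True \<beta> by linarith
  have pk: "p\<^sup>2 \<le> \<kappa>\<^sup>2 / 4"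
    using power_mono[of p "\<kappa>/2" 2] True \<beta> by (simp add: power2_eq_square field_simps)
  have b: "\<beta>\<^sup>2 \<le> \<kappa>\<^sup>2" using power_mono[of \<beta> \<kappa> 2] True \<beta> by simp
  have "- v * S = - v * v2 + (\<kappa>\<^sup>2 - p\<^sup>2) * v\<^sup>2" unfolding S_def by algebra
  moreover have "(\<kappa>\<^sup>2 - p\<^sup>2) * v\<^sup>2 \<ge> 3/4 * \<kappa>\<^sup>2 * v\<^sup>2"
    by (rule mult_right_mono) (use pk in auto)
  \<comment> \<open>Young's inequality with weights such that the loss \<open>v^2\<close> is at most
    a quarter of \<open>\<kappa>^2 v^2\<close>; this leaves 3/4 - 1/4 = 1/2 of it.\<close>
  moreover have "- v * S \<le> v\<^sup>2 + S\<^sup>2 / 4"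
    using zero_le_power2[of "v + S/2"] by (simp add: power2_eq_square algebra_simps)
  moreover have "v\<^sup>2 * 4 \<le> \<kappa>\<^sup>2 * v\<^sup>2"
    using mult_right_mono[of 4 "\<kappa>\<^sup>2" "v\<^sup>2"] power_mono[of 2 \<kappa> 2] k2 by simp
  ultimately have "1/2 * (\<kappa>\<^sup>2 * v\<^sup>2) \<le> S\<^sup>2 / 4 + v * v2" by linarith
  moreover have "\<beta>\<^sup>2 * v\<^sup>2 \<le> \<kappa>\<^sup>2 * v\<^sup>2" using b by (simp add: mult_right_mono)
  moreover have "S\<^sup>2 \<le> Z" using \<beta> unfolding Z_def by (simp add: mult_nonneg_nonneg)
  moreover have "0 \<le> S\<^sup>2" "0 \<le> v1\<^sup>2" by auto
  moreover have "\<kappa>\<^sup>2 * v\<^sup>2 + \<beta>\<^sup>2 * v\<^sup>2 \<le> 64 * Z + 4 * (v1\<^sup>2 + x)"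
    if "1/2 * (\<kappa>\<^sup>2 * v\<^sup>2) \<le> S\<^sup>2 / 4 + x" "\<beta>\<^sup>2 * v\<^sup>2 \<le> \<kappa>\<^sup>2 * v\<^sup>2" "S\<^sup>2 \<le> Z"
      "0 \<le> S\<^sup>2" "0 \<le> v1\<^sup>2" for x
    unfolding distrib_left using that by linarith
  ultimately have "\<kappa>\<^sup>2 * v\<^sup>2 + \<beta>\<^sup>2 * v\<^sup>2 \<le> 64 * Z + 4 * (v1\<^sup>2 + v * v2)" by blast
  thus ?thesis unfolding c_def using True by (simp add: algebra_simps)
next
  case False
  define T where "T = B + \<kappa>"
  define sg :: real where "sg = (if \<kappa> < B then 1 else -1)"
  have T: "T \<le> 3 * B" "0 < T" using False \<beta> \<kappa> unfolding T_def by auto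
  have sg2: "\<bar>sg\<bar> = 1" unfolding sg_def by auto
  have c: "c = - 8 * sg * T" using False unfolding c_def sg_def T_def by auto
  \<comment> \<open>\<open>B^2 - \<kappa>^2 = (B - \<kappa>) * T\<close>, so the distance 1/4
    produces only the first power of \<open>T\<close>.\<close>
  have gap: "1/4 * T \<le> sg * (B\<^sup>2 - \<kappa>\<^sup>2)"
  proof -
    have "sg * (B\<^sup>2 - \<kappa>\<^sup>2) = (sg * (B - \<kappa>)) * T" unfolding T_def by (simp add: power2_eq_square algebra_simps)
    also have "\<dots> \<ge> 1/4 * T" using \<kappa> T by (intro mult_right_mono) (auto simp: sg_def abs_if split: if_splits)
    finally show ?thesis .
  qed
  \<comment> \<open>\<open>B - p = 2 * p1\<close> turns the error of freezing \<open>p\<close> at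
    \<open>B\<close> into a multiple of \<open>p1\<close>, hence into something that
    \<open>Z\<close> controls.\<close>
  have Bp: "\<bar>B\<^sup>2 - p\<^sup>2\<bar> \<le> 4 * B * p1"
  proof -
    have e: "B\<^sup>2 - p\<^sup>2 = 2 * p1 * (B + p)"
      unfolding assms(5)[symmetric] by (simp add: power2_eq_square algebra_simps)
    have p0: "0 \<le> p" using \<beta> by linarith
    have "0 \<le> 2 * p1 * (B + p)" using \<beta> p0 by simp
    moreover have "2 * p1 * (B + p) \<le> 2 * p1 * (2 * B)" by (rule mult_left_mono) (use \<beta> in auto)
    ultimately show ?thesis unfolding e by (simp add: algebra_simps)
  qed
  have id: "sg * (B\<^sup>2 - \<kappa>\<^sup>2) * v\<^sup>2 = sg * (v * S) - sg * (v * v2 + v1\<^sup>2) + sg * v1\<^sup>2 + sg * (B\<^sup>2 - p\<^sup>2) * v\<^sup>2"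
    unfolding S_def by algebra
  have "sg * (v * S) \<le> \<bar>v * S\<bar>" "sg * v1\<^sup>2 \<le> v1\<^sup>2" unfolding sg_def by auto
  moreover have "sg * (B\<^sup>2 - p\<^sup>2) * v\<^sup>2 \<le> 4 * B * p1 * v\<^sup>2"
    by (rule mult_right_mono) (use Bp in \<open>auto simp: sg_def\<close>)
  moreover have "1/4 * T * v\<^sup>2 \<le> sg * (B\<^sup>2 - \<kappa>\<^sup>2) * v\<^sup>2"
    by (rule mult_right_mono[OF gap]) auto
  ultimately have "1/4 * T * v\<^sup>2 \<le> \<bar>v * S\<bar> + v1\<^sup>2 + 4 * B * p1 * v\<^sup>2 - sg * (v * v2 + v1\<^sup>2)"
    using id by linarith
  \<comment> \<open>The extra factor \<open>T\<close> upgrades the linear gap to \<open>T^2\<close>;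
    since \<open>T \<le> 3 * B\<close>, the new coefficients stay below multiples of
    \<open>p\<close> and \<open>p^2\<close>.\<close>
  from mult_left_mono[OF this, of T] T
  have 1: "1/4 * (T\<^sup>2 * v\<^sup>2) \<le> T * \<bar>v * S\<bar> + T * v1\<^sup>2 + T * (4 * B * p1 * v\<^sup>2) - sg * T * (v * v2 + v1\<^sup>2)"
    by (simp add: power2_eq_square algebra_simps)
  have 2: "T * \<bar>v * S\<bar> \<le> 1/8 * (T\<^sup>2 * v\<^sup>2) + 2 * S\<^sup>2"
  proof -
    have "0 \<le> (1/4 * (T * \<bar>v\<bar>) - \<bar>S\<bar>)\<^sup>2" by simp
    also have "\<dots> = 1/16 * (T\<^sup>2 * v\<^sup>2) - 1/2 * (T * \<bar>v * S\<bar>) + S\<^sup>2"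
      by (simp add: power2_diff power_mult_distrib abs_mult algebra_simps power2_eq_square)
    finally show ?thesis by linarith
  qed
  have 3: "T * v1\<^sup>2 \<le> 8 * p * v1\<^sup>2"
    by (rule mult_right_mono) (use T \<beta> in auto)
  have 4: "T * (4 * B * p1 * v\<^sup>2) \<le> 32 * p\<^sup>2 * p1 * v\<^sup>2"
  proof -
    have "T * (4 * B) \<le> (3 * B) * (4 * B)" by (rule mult_right_mono) (use T \<beta> in auto)
    also have "\<dots> = 12 * B\<^sup>2" by (simp add: power2_eq_square)
    also have "\<dots> \<le> 12 * (8/5 * p)\<^sup>2" using power_mono[of B "8/5 * p" 2] \<beta> by simp
    also have "\<dots> \<le> 32 * p\<^sup>2" by (simp add: power_mult_distrib power2_eq_square)
    finally have "T * (4 * B) * (p1 * v\<^sup>2) \<le> 32 * p\<^sup>2 * (p1 * v\<^sup>2)" by (rule mult_right_mono) (use \<beta> in auto)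
    thus ?thesis by (simp add: algebra_simps)
  qed
  have "1/8 * (T\<^sup>2 * v\<^sup>2) \<le> 2 * S\<^sup>2 + 8 * p * v1\<^sup>2 + 32 * p\<^sup>2 * p1 * v\<^sup>2 - sg * T * (v * v2 + v1\<^sup>2)"
    using 1 2 3 4 by linarith
  also have "\<dots> \<le> 8 * Z - sg * T * (v * v2 + v1\<^sup>2)"
  proof -
    have "0 \<le> S\<^sup>2" "0 \<le> p * v1\<^sup>2" "0 \<le> p1 * v1\<^sup>2" using \<beta> by auto
    thus ?thesis unfolding Z_def by (simp add: algebra_simps)
  qed
  finally have "T\<^sup>2 * v\<^sup>2 \<le> 64 * Z + c * (v1\<^sup>2 + v * v2)" unfolding c by (simp add: algebra_simps)
  moreover have "(\<kappa>\<^sup>2 + \<beta>\<^sup>2) * v\<^sup>2 \<le> T\<^sup>2 * v\<^sup>2"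
  proof (rule mult_right_mono)
    have "\<beta>\<^sup>2 \<le> B\<^sup>2" using power_mono[of \<beta> B 2] \<beta> by simp
    moreover have "0 \<le> B * \<kappa>" using \<beta> \<kappa> by simp
    ultimately show "\<kappa>\<^sup>2 + \<beta>\<^sup>2 \<le> T\<^sup>2" unfolding T_def power2_sum by (simp add: algebra_simps)
  qed auto
  ultimately show ?thesis by linarith
qed

text \<open>Pairs \<open>S\<close> with \<open>p1 v\<close> instead of \<open>v\<close>. The bracket
  on the right is the y-derivative of \<open>p1 v v1 + p1 / 4 v^2\<close> once
  \<open>p1' = - p1 / 2\<close>. Because \<open>Z\<close> contains \<open>p^2 p1 v^2\<close>,
  solving \<open>S\<close> for \<open>\<kappa>^2 v\<close> leaves only terms below \<open>Z\<close>,
  whatever the position of \<kappa>.\<close>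

lemma weighted_angular_bound:
  fixes v v1 v2 p p1 \<kappa> \<beta> :: real
  assumes "1 \<le> \<beta>" "\<beta> \<le> 8/5 * p" "0 \<le> p1" "p1 \<le> p\<^sup>2" "1 \<le> p"
  defines "S \<equiv> v2 + (p\<^sup>2 - \<kappa>\<^sup>2) * v"
  defines "Z \<equiv> S\<^sup>2 + 4 * p * v1\<^sup>2 + 4 * p1 * v1\<^sup>2 + 4 * p\<^sup>2 * p1 * v\<^sup>2"
  shows "p1 * (\<kappa>\<^sup>2 + \<beta>\<^sup>2) * v\<^sup>2 \<le> 3 * Z + (p1 * v1\<^sup>2 + p1 * v * v2 - p1 / 8 * v\<^sup>2)"
proof -
  have p1p: "p1 \<le> p\<^sup>2 * p1" using assms mult_right_mono[of 1 "p\<^sup>2" p1] one_le_power[of p 2] by simp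
  have id: "p1 * \<kappa>\<^sup>2 * v\<^sup>2 = (p1 * v1\<^sup>2 + p1 * v * v2 - p1 / 8 * v\<^sup>2) - p1 * v1\<^sup>2 + p1 / 8 * v\<^sup>2 + p1 * p\<^sup>2 * v\<^sup>2 - p1 * v * S"
    unfolding S_def by (simp add: power2_eq_square field_simps)
  have a: "p1 * v\<^sup>2 \<le> p\<^sup>2 * p1 * v\<^sup>2" using p1p by (simp add: mult_right_mono)
  have b: "- (p1 * v * S) \<le> 1/2 * S\<^sup>2 + 1/2 * (p1\<^sup>2 * v\<^sup>2)"
    using zero_le_power2[of "p1 * v + S"] by (simp add: power2_sum power_mult_distrib algebra_simps)
  have "p1\<^sup>2 \<le> p\<^sup>2 * p1" using assms mult_right_mono[of p1 "p\<^sup>2" p1] by (simp add: power2_eq_square)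
  hence c: "p1\<^sup>2 * v\<^sup>2 \<le> p\<^sup>2 * p1 * v\<^sup>2" by (simp add: mult_right_mono)
  have d: "p1 * \<beta>\<^sup>2 * v\<^sup>2 \<le> 4 * (p\<^sup>2 * p1 * v\<^sup>2)"
  proof -
    have "\<beta>\<^sup>2 \<le> (8/5*p)\<^sup>2" using assms by (intro power_mono) auto
    also have "\<dots> \<le> 4 * p\<^sup>2" by (simp add: power_mult_distrib power2_eq_square)
    finally have "\<beta>\<^sup>2 * (p1 * v\<^sup>2) \<le> 4 * p\<^sup>2 * (p1 * v\<^sup>2)" using assms by (intro mult_right_mono) auto
    thus ?thesis by (simp add: algebra_simps)
  qed
  have e: "0 \<le> p1 * v1\<^sup>2" "0 \<le> p * v1\<^sup>2" "0 \<le> S\<^sup>2" "0 \<le> p\<^sup>2 * p1 * v\<^sup>2" using assms by auto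
  have f: "p1 * (\<kappa>\<^sup>2 + \<beta>\<^sup>2) * v\<^sup>2 = p1 * \<kappa>\<^sup>2 * v\<^sup>2 + p1 * \<beta>\<^sup>2 * v\<^sup>2" by (simp add: algebra_simps)
  have g: "p1 * p\<^sup>2 * v\<^sup>2 = p\<^sup>2 * p1 * v\<^sup>2" by (simp add: algebra_simps)
  have k: "p1 / 8 * v\<^sup>2 = (p1 * v\<^sup>2) / 8" by simp
  have h: "Z = S\<^sup>2 + 4 * (p * v1\<^sup>2) + 4 * (p1 * v1\<^sup>2) + 4 * (p\<^sup>2 * p1 * v\<^sup>2)" unfolding Z_def by (simp add: algebra_simps)
  \<comment> \<open>Every product becomes a variable here, so that only linear arithmetic
    remains.\<close>
  have arith: "D - Y + W / 8 + X - R + Q \<le> 3 * (T + 4 * P + 4 * Y + 4 * X) + D"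
    if "W \<le> X" "- R \<le> 1/2 * T + 1/2 * U" "U \<le> X" "Q \<le> 4 * X" "0 \<le> Y" "0 \<le> P" "0 \<le> T" "0 \<le> X"
    for D Y W X R Q T P U :: real using that by argo
  show ?thesis unfolding f id h g using arith[OF a b c d e] by (simp only: k)
qed

text \<open>The multiples of \<open>Z\<close> for the angular, the weighted angular and the radial
  part are 64, 3 and 1, rounded up to 70. The exact derivatives stay explicit, those in y inside the
  bracket and \<open>dH\<close> alone in s, so that integration removes each group
  separately.\<close>

lemma conj_pointwise_estimate:
  fixes v v1 v2 vs vs1 p p1 E \<kappa> \<beta> B :: real
  assumes \<beta>: "1 \<le> \<beta>" "\<beta> \<le> B" "B \<le> 8/5 * p" "p \<le> B" "B - p = 2 * p1" "0 \<le> p1" "p1 \<le> p\<^sup>2" "1 \<le> p"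
    and \<kappa>: "0 \<le> \<kappa>" "1/4 \<le> \<bar>B - \<kappa>\<bar>"
  defines "f \<equiv> v2 - 2 * p * v1 + (p\<^sup>2 - p1 - \<kappa>\<^sup>2) * v - E * vs"
  defines "dG \<equiv> - 4 * p1 * v1\<^sup>2 - 4 * p * v1 * v2 - 2 * p1 * v * v2 + p1 / 4 * v\<^sup>2
     + 4 * E * v1 * vs - 2 * E * v2 * vs - 2 * E * v1 * vs1
     - (2 * p1 * (p\<^sup>2 - \<kappa>\<^sup>2) + 4 * p\<^sup>2 * p1) * v\<^sup>2 - 4 * p * (p\<^sup>2 - \<kappa>\<^sup>2) * v * v1
     - p1 * v\<^sup>2 + 4 * p1 * v * v1"
  defines "dH \<equiv> 2 * E * v1 * vs1 - 2 * (p\<^sup>2 - \<kappa>\<^sup>2) * E * v * vs"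
  defines "c \<equiv> if 2 * B < \<kappa> then 4 else if \<kappa> < B then - 8 * (B + \<kappa>) else 8 * (B + \<kappa>)"
  shows "(1 + p1) * (v1\<^sup>2 + (\<kappa>\<^sup>2 + \<beta>\<^sup>2) * v\<^sup>2) \<le> 70 * f\<^sup>2
    + (c * (v1\<^sup>2 + v * v2) + (p1 * v1\<^sup>2 + p1 * v * v2 - p1 / 8 * v\<^sup>2) - 70 * dG) + (- 70) * dH"
proof -
  define S where "S = v2 + (p\<^sup>2 - \<kappa>\<^sup>2) * v"
  define Z where "Z = S\<^sup>2 + 4 * p * v1\<^sup>2 + 4 * p1 * v1\<^sup>2 + 4 * p\<^sup>2 * p1 * v\<^sup>2"
  have 1: "(\<kappa>\<^sup>2 + \<beta>\<^sup>2) * v\<^sup>2 \<le> 64 * Z + c * (v1\<^sup>2 + v * v2)"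
    unfolding Z_def S_def c_def by (rule angular_gap_bound) (use assms in auto)
  have 2: "p1 * (\<kappa>\<^sup>2 + \<beta>\<^sup>2) * v\<^sup>2 \<le> 3 * Z + (p1 * v1\<^sup>2 + p1 * v * v2 - p1 / 8 * v\<^sup>2)"
    unfolding Z_def S_def by (rule weighted_angular_bound) (use assms in auto)
  have id: "f\<^sup>2 = S\<^sup>2 + (f - S + 2 * v1)\<^sup>2 + (8 * p - 4 + 4 * p1) * v1\<^sup>2 + (4 * p\<^sup>2 * p1 + 3 / 4 * p1) * v\<^sup>2 + dG + dH"
    unfolding f_def dG_def dH_def S_def by (rule conj_square_identity)
  have "(8 * p - 4 + 4 * p1) * v1\<^sup>2 \<ge> (4 * p + 4 * p1) * v1\<^sup>2" using \<beta> by (intro mult_right_mono) auto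
  moreover have "(4 * p\<^sup>2 * p1 + 3 / 4 * p1) * v\<^sup>2 \<ge> 4 * p\<^sup>2 * p1 * v\<^sup>2" using \<beta> by (intro mult_right_mono) auto
  moreover have "0 \<le> (f - S + 2 * v1)\<^sup>2" by simp
  moreover have "Z = S\<^sup>2 + (4 * p + 4 * p1) * v1\<^sup>2 + 4 * p\<^sup>2 * p1 * v\<^sup>2" unfolding Z_def by (simp add: algebra_simps)
  ultimately have 3: "Z \<le> f\<^sup>2 - dG - dH" using id by linarith
  have "(1 + p1) * v1\<^sup>2 \<le> (4 * p + 4 * p1) * v1\<^sup>2" using \<beta> by (intro mult_right_mono) auto
  also have "\<dots> \<le> Z" using \<beta> unfolding Z_def by (simp add: algebra_simps)
  finally have 4: "(1 + p1) * v1\<^sup>2 \<le> Z" .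
  have "0 \<le> Z" using \<beta> unfolding Z_def by simp
  have "(1 + p1) * (v1\<^sup>2 + (\<kappa>\<^sup>2 + \<beta>\<^sup>2) * v\<^sup>2) = (1 + p1) * v1\<^sup>2 + (\<kappa>\<^sup>2 + \<beta>\<^sup>2) * v\<^sup>2 + p1 * (\<kappa>\<^sup>2 + \<beta>\<^sup>2) * v\<^sup>2"
    by (simp add: algebra_simps)
  also have "\<dots> \<le> 70 * Z + c * (v1\<^sup>2 + v * v2) + (p1 * v1\<^sup>2 + p1 * v * v2 - p1 / 8 * v\<^sup>2)"
    using 1 2 4 \<open>0 \<le> Z\<close> by linarith
  also have "\<dots> \<le> 70 * f\<^sup>2
    + (c * (v1\<^sup>2 + v * v2) + (p1 * v1\<^sup>2 + p1 * v * v2 - p1 / 8 * v\<^sup>2) - 70 * dG) + (- 70) * dH"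
    using 3 by linarith
  finally show ?thesis .
qed

subsection \<open>One spherical mode: integration\<close>

lemma deriv_zero_on_open:
  fixes f :: "real \<Rightarrow> real"
  assumes "open U" "x \<in> U" "\<And>z. z \<in> U \<Longrightarrow> f z = 0" "(f has_real_derivative D) (at x)"
  shows "D = 0"
proof -
  have "((\<lambda>_. 0) has_real_derivative D) (at x)"
    by (rule has_field_derivative_transform_within_open[OF assms(4,1,2)]) (use assms in auto)
  thus ?thesis using DERIV_const DERIV_unique by blast
qed

lemma deriv_vanishes_outside:
  fixes f :: "real \<Rightarrow> real \<Rightarrow> real"
  assumes f: "\<And>s y. y < a \<or> b < y \<or> c < \<bar>s\<bar> \<Longrightarrow> f s y = 0" and out: "y < a \<or> b < y \<or> c < \<bar>s\<bar>"
  shows "(f s has_real_derivative D) (at y) \<Longrightarrow> D = 0"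
    and "((\<lambda>s. f s y) has_real_derivative D) (at s) \<Longrightarrow> D = 0"
proof -
  have op: "open {s::real. c < \<bar>s\<bar>}" by (intro open_Collect_less continuous_intros)
  consider "y < a" | "b < y" | "c < \<bar>s\<bar>" using out by blast
  note cases = this
  show "D = 0" if "(f s has_real_derivative D) (at y)"
  proof (cases rule: cases)
    case 1 show ?thesis by (rule deriv_zero_on_open[OF _ _ _ that, of "{..<a}"]) (use 1 f in auto)
  next
    case 2 show ?thesis by (rule deriv_zero_on_open[OF _ _ _ that, of "{b<..}"]) (use 2 f in auto)
  next
    case 3 show ?thesis by (rule deriv_zero_on_open[OF _ _ _ that, of UNIV]) (use 3 f in auto)
  qed
  show "D = 0" if "((\<lambda>s. f s y) has_real_derivative D) (at s)"
  proof (cases "y < a \<or> b < y")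
    case True thus ?thesis by (intro deriv_zero_on_open[OF _ _ _ that, of UNIV]) (use f in auto)
  next
    case False thus ?thesis by (intro deriv_zero_on_open[OF op _ _ that]) (use out f in auto)
  qed
qed

lemma integral_cbox_snd_derivative:
  fixes G g :: "real \<Rightarrow> real \<Rightarrow> real"
  assumes "a \<le> b" "continuous_on UNIV (\<lambda>(s, y). g s y)"
    "\<And>s y. (G s has_real_derivative g s y) (at y)" "\<And>s. G s a = 0" "\<And>s. G s b = 0"
  shows "integral (cbox (c, a) (d, b)) (\<lambda>(s, y). g s y) = 0"
proof -
  have "integral (cbox (c, a) (d, b)) (\<lambda>(s, y). g s y) = integral (cbox c d) (\<lambda>s. integral (cbox a b) (g s))"
    by (subst integral_prod_continuous) (use assms(2) continuous_on_subset in auto)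
  also have "\<dots> = integral (cbox c d) (\<lambda>s. 0)"
  proof (rule integral_cong)
    fix s
    have "(g s has_integral (G s b - G s a)) {a..b}"
      by (rule fundamental_theorem_of_calculus[OF assms(1)])
         (use assms(3) has_real_derivative_iff_has_vector_derivative has_vector_derivative_at_within in blast)
    thus "integral (cbox a b) (g s) = 0" using assms(4,5) by (auto simp: integral_unique)
  qed
  finally show ?thesis by simp
qed

lemma integral_cbox_fst_derivative:
  fixes H h :: "real \<Rightarrow> real \<Rightarrow> real"
  assumes "c \<le> d" "continuous_on UNIV (\<lambda>(s, y). h s y)"
    "\<And>s y. ((\<lambda>s. H s y) has_real_derivative h s y) (at s)" "\<And>y. H c y = 0" "\<And>y. H d y = 0"
  shows "integral (cbox (c, a) (d, b)) (\<lambda>(s, y). h s y) = 0"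
proof -
  have co: "continuous_on (cbox (c, a) (d, b)) (\<lambda>(s, y). h s y)"
    using assms(2) continuous_on_subset by blast
  have "integral (cbox (c, a) (d, b)) (\<lambda>(s, y). h s y) = integral (cbox c d) (\<lambda>s. integral (cbox a b) (h s))"
    by (subst integral_prod_continuous) (use co in auto)
  also have "\<dots> = integral (cbox a b) (\<lambda>y. integral (cbox c d) (\<lambda>s. h s y))"
    by (rule integral_swap_continuous[OF co])
  also have "\<dots> = integral (cbox a b) (\<lambda>s. 0)"
  proof (rule integral_cong)
    fix y
    have "((\<lambda>s. h s y) has_integral (H d y - H c y)) {c..d}"
      by (rule fundamental_theorem_of_calculus[OF assms(1)])
         (use assms(3) has_real_derivative_iff_has_vector_derivative has_vector_derivative_at_within in blast)
    thus "integral (cbox c d) (\<lambda>s. h s y) = 0" using assms(4,5) by (auto simp: integral_unique)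
  qed
  finally show ?thesis by simp
qed

lemma nn_integral_eq_integral_cbox:
  fixes g :: "'a::euclidean_space \<Rightarrow> real"
  assumes "continuous_on UNIV g" "\<And>z. 0 \<le> g z" "\<And>z. z \<notin> cbox a b \<Longrightarrow> g z = 0"
  shows "(\<integral>\<^sup>+ z. ennreal (g z) \<partial>lborel) = ennreal (integral (cbox a b) g)"
proof (rule nn_integral_has_integral_lborel)
  show "g \<in> borel_measurable borel" using assms(1) by (rule borel_measurable_continuous_onI)
  have "(g has_integral integral (cbox a b) g) (cbox a b)"
    using assms(1) continuous_on_subset integrable_continuous by blast
  thus "(g has_integral integral (cbox a b) g) UNIV"
    by (rule has_integral_on_superset) (use assms(3) in auto)
qed (use assms in auto)

text \<open>This is the function \<open>p\<close>. \<open>B\<close> is kept apart from \<beta>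
  because it carries the dimensional shift: \<open>B = \<beta> + (n - 2) / 2\<close> in the
  conjugated operator, while \<open>B = \<beta>\<close> gives \<psi>' itself.\<close>

definition conj_slope :: "real \<Rightarrow> real \<Rightarrow> real \<Rightarrow> real" where
  "conj_slope B \<beta> y = B - \<beta> / 32 * exp (- y / 2)"

definition conj_convexity :: "real \<Rightarrow> real \<Rightarrow> real" where
  "conj_convexity \<beta> y = \<beta> / 64 * exp (- y / 2)"

definition conj_op :: "real \<Rightarrow> real \<Rightarrow> real \<Rightarrow> real \<Rightarrow> real \<Rightarrow> real \<Rightarrow> real \<Rightarrow> real \<Rightarrow> real" where
  "conj_op B \<beta> \<kappa> y v v1 v2 vs = v2 - 2 * conj_slope B \<beta> y * v1
     + ((conj_slope B \<beta> y)\<^sup>2 - conj_convexity \<beta> y - \<kappa>\<^sup>2) * v - exp (- 2 * y) * vs"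

definition conj_energy :: "real \<Rightarrow> real \<Rightarrow> real \<Rightarrow> real \<Rightarrow> real \<Rightarrow> real" where
  "conj_energy \<beta> \<kappa> y v v1 = (1 + conj_convexity \<beta> y) * (v1\<^sup>2 + (\<kappa>\<^sup>2 + \<beta>\<^sup>2) * v\<^sup>2)"

lemma DERIV_conj_slope: "(conj_slope B \<beta> has_real_derivative conj_convexity \<beta> y) (at y)"
  unfolding conj_slope_def[abs_def] conj_convexity_def by (auto intro!: derivative_eq_intros)

lemma DERIV_conj_convexity: "(conj_convexity \<beta> has_real_derivative - (conj_convexity \<beta> y / 2)) (at y)"
  unfolding conj_convexity_def[abs_def] by (auto intro!: derivative_eq_intros)

text \<open>On \<open>y \<ge> -1\<close>, that is \<open>|x| \<le> e\<close>, the exponential is at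
  most 2 and shifts the slope by at most \<open>B / 16\<close>. Everything follows from
  \<open>15/16 * B \<le> p\<close>; the ratio 8/5 is a generous rounding.\<close>

lemma conj_weights_bounds:
  assumes "1 \<le> \<beta>" "\<beta> \<le> B" "-1 \<le> y" "2 \<le> B"
  shows "B \<le> 8/5 * conj_slope B \<beta> y" "conj_slope B \<beta> y \<le> B"
    "B - conj_slope B \<beta> y = 2 * conj_convexity \<beta> y" "0 \<le> conj_convexity \<beta> y"
    "conj_convexity \<beta> y \<le> (conj_slope B \<beta> y)\<^sup>2" "1 \<le> conj_slope B \<beta> y"
proof -
  define e where "e = exp (- y / 2)"
  \<comment> \<open>From \<open>exp 1 \<le> 3 < 4\<close>.\<close>
  have "exp (1/2::real) ^ 2 \<le> 2 ^ 2"
    using exp_le by (simp flip: exp_of_nat_mult)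
  hence "exp (1/2::real) \<le> 2" using power2_le_imp_le by (metis zero_le_numeral)
  moreover have "e \<le> exp (1/2)" unfolding e_def using assms by simp
  moreover have "0 \<le> e" unfolding e_def by simp
  ultimately have e: "0 \<le> e" "e \<le> 2" by linarith+
  have be: "0 \<le> \<beta> * e" "\<beta> * e \<le> 2 * B"
    using e assms mult_mono[of \<beta> B e 2] by auto
  show "conj_slope B \<beta> y \<le> B" "B - conj_slope B \<beta> y = 2 * conj_convexity \<beta> y" "0 \<le> conj_convexity \<beta> y"
    using be assms unfolding conj_slope_def conj_convexity_def e_def by auto
  have s: "15/16 * B \<le> conj_slope B \<beta> y" using be unfolding conj_slope_def e_def by (auto simp: field_simps)
  show "B \<le> 8/5 * conj_slope B \<beta> y" "1 \<le> conj_slope B \<beta> y" using s assms by auto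
  have "conj_convexity \<beta> y \<le> conj_slope B \<beta> y" using be s assms unfolding conj_convexity_def e_def by (auto simp: field_simps)
  also have "\<dots> \<le> (conj_slope B \<beta> y)\<^sup>2" using \<open>1 \<le> conj_slope B \<beta> y\<close> by (simp add: power2_eq_square)
  finally show "conj_convexity \<beta> y \<le> (conj_slope B \<beta> y)\<^sup>2" .
qed

text \<open>Integrates the pointwise estimate over a rectangle: \<open>g\<close> is a y-derivative
  and \<open>h\<close> an s-derivative of expressions that vanish on its sides, so only the energy
  and the square of the operator survive.\<close>

lemma conj_estimate_compact:
  fixes v v1 v2 vs vs1 :: "real \<Rightarrow> real \<Rightarrow> real"
  assumes cont: "continuous_on UNIV (\<lambda>(s, y). v s y)" "continuous_on UNIV (\<lambda>(s, y). v1 s y)"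
      "continuous_on UNIV (\<lambda>(s, y). v2 s y)" "continuous_on UNIV (\<lambda>(s, y). vs s y)"
      "continuous_on UNIV (\<lambda>(s, y). vs1 s y)"
    and der: "\<And>s y. (v s has_real_derivative v1 s y) (at y)" "\<And>s y. (v1 s has_real_derivative v2 s y) (at y)"
      "\<And>s y. ((\<lambda>s. v s y) has_real_derivative vs s y) (at s)" "\<And>s y. ((\<lambda>s. v1 s y) has_real_derivative vs1 s y) (at s)"
      "\<And>s y. (vs s has_real_derivative vs1 s y) (at y)"
    and supp: "\<And>s y. y < -1 \<or> R < y \<or> R < \<bar>s\<bar> \<Longrightarrow> v s y = 0"
    and par: "1 \<le> \<beta>" "\<beta> \<le> B" "2 \<le> B" "0 \<le> \<kappa>" "1/4 \<le> \<bar>B - \<kappa>\<bar>"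
  shows "(\<integral>\<^sup>+ (s, y). ennreal (conj_energy \<beta> \<kappa> y (v s y) (v1 s y)) \<partial>lborel)
    \<le> 70 * (\<integral>\<^sup>+ (s, y). ennreal ((conj_op B \<beta> \<kappa> y (v s y) (v1 s y) (v2 s y) (vs s y))\<^sup>2) \<partial>lborel)"
proof -
  let ?p = "conj_slope B \<beta>" and ?p1 = "conj_convexity \<beta>" and ?E = "\<lambda>y::real. exp (- 2 * y)"
  have zv: "v s y = 0 \<and> v1 s y = 0 \<and> v2 s y = 0 \<and> vs s y = 0 \<and> vs1 s y = 0"
    if "y < -1 \<or> R < y \<or> R < \<bar>s\<bar>" for s y
  proof -
    have z1: "v1 s y = 0" if "y < -1 \<or> R < y \<or> R < \<bar>s\<bar>" for s y
      by (rule deriv_vanishes_outside(1)[OF supp that der(1)])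
    have z2: "v2 s y = 0" if "y < -1 \<or> R < y \<or> R < \<bar>s\<bar>" for s y
      by (rule deriv_vanishes_outside(1)[OF z1 that der(2)])
    have z3: "vs s y = 0" if "y < -1 \<or> R < y \<or> R < \<bar>s\<bar>" for s y
      by (rule deriv_vanishes_outside(2)[OF supp that der(3)])
    have z4: "vs1 s y = 0" if "y < -1 \<or> R < y \<or> R < \<bar>s\<bar>" for s y
      by (rule deriv_vanishes_outside(2)[OF z1 that der(4)])
    show ?thesis using supp[OF that] z1[OF that] z2[OF that] z3[OF that] z4[OF that] by auto
  qed
  \<comment> \<open>One unit beyond \<open>R\<close>, and -2 instead of -1 at the lower end, because
    the support hypothesis has strict inequalities: on the sides of \<open>Q\<close> the function
    vanishes together with its derivatives.\<close>
  define T where "T = \<bar>R\<bar> + 1"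
  define Q where "Q = cbox (-T, -2) (T, T)"
  have outQ: "v s y = 0 \<and> v1 s y = 0 \<and> v2 s y = 0 \<and> vs s y = 0 \<and> vs1 s y = 0" if "(s, y) \<notin> Q" for s y
    by (rule zv) (use that in \<open>auto simp: Q_def T_def\<close>)
  define F where "F s y = (v2 s y - 2 * ?p y * v1 s y + ((?p y)\<^sup>2 - ?p1 y - \<kappa>\<^sup>2) * v s y - ?E y * vs s y)\<^sup>2" for s y
  define L where "L s y = (1 + ?p1 y) * ((v1 s y)\<^sup>2 + (\<kappa>\<^sup>2 + \<beta>\<^sup>2) * (v s y)\<^sup>2)" for s y
  define c where "c = (if 2 * B < \<kappa> then 4 else if \<kappa> < B then - 8 * (B + \<kappa>) else 8 * (B + \<kappa>))"
  define dG where "dG s y = - 4 * ?p1 y * (v1 s y)\<^sup>2 - 4 * ?p y * v1 s y * v2 s y - 2 * ?p1 y * v s y * v2 s y + ?p1 y / 4 * (v s y)\<^sup>2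
     + 4 * ?E y * v1 s y * vs s y - 2 * ?E y * v2 s y * vs s y - 2 * ?E y * v1 s y * vs1 s y
     - (2 * ?p1 y * ((?p y)\<^sup>2 - \<kappa>\<^sup>2) + 4 * (?p y)\<^sup>2 * ?p1 y) * (v s y)\<^sup>2 - 4 * ?p y * ((?p y)\<^sup>2 - \<kappa>\<^sup>2) * v s y * v1 s y
     - ?p1 y * (v s y)\<^sup>2 + 4 * ?p1 y * v s y * v1 s y" for s y
  define g where "g s y = c * ((v1 s y)\<^sup>2 + v s y * v2 s y) + (?p1 y * (v1 s y)\<^sup>2 + ?p1 y * v s y * v2 s y - ?p1 y / 8 * (v s y)\<^sup>2) - 70 * dG s y" for s y
  \<comment> \<open>A primitive of \<open>g\<close> in y. Its term \<open>- 2 E v1 vs\<close> is the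
    reason why \<open>vs1\<close> has to be both the y-derivative of \<open>vs\<close> and the
    s-derivative of \<open>v1\<close>: one property is used for \<open>G\<close>, the other for
    \<open>H\<close>.\<close>
  define G where "G s y = c * (v s y * v1 s y) + (?p1 y * v s y * v1 s y + ?p1 y / 4 * (v s y)\<^sup>2)
     - 70 * (- 2 * ?p y * (v1 s y)\<^sup>2 - 2 * ?p1 y * v s y * v1 s y - ?p1 y / 2 * (v s y)\<^sup>2 - 2 * ?E y * v1 s y * vs s y
       - 2 * ?p y * ((?p y)\<^sup>2 - \<kappa>\<^sup>2) * (v s y)\<^sup>2 + 2 * ?p1 y * (v s y)\<^sup>2)" for s y
  define h where "h s y = 2 * ?E y * v1 s y * vs1 s y - 2 * ((?p y)\<^sup>2 - \<kappa>\<^sup>2) * ?E y * v s y * vs s y" for s y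
  define H where "H s y = ?E y * (v1 s y)\<^sup>2 - ((?p y)\<^sup>2 - \<kappa>\<^sup>2) * ?E y * (v s y)\<^sup>2" for s y
  note [continuous_intros] = cont[unfolded case_prod_unfold]
  have cp [continuous_intros]: "continuous_on UNIV (\<lambda>z::real\<times>real. ?p (snd z))" "continuous_on UNIV (\<lambda>z::real\<times>real. ?p1 (snd z))"
    unfolding conj_slope_def conj_convexity_def by (auto intro!: continuous_intros)
  have cF: "continuous_on UNIV (\<lambda>(s, y). F s y)" and cL: "continuous_on UNIV (\<lambda>(s, y). L s y)"
    and cg: "continuous_on UNIV (\<lambda>(s, y). g s y)" and ch: "continuous_on UNIV (\<lambda>(s, y). h s y)"
    unfolding F_def L_def g_def h_def dG_def case_prod_unfold by (auto intro!: continuous_intros)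
  have dg: "(G s has_real_derivative g s y) (at y)" for s y
    unfolding G_def[abs_def] g_def dG_def
    by (auto intro!: derivative_eq_intros der DERIV_conj_slope DERIV_conj_convexity simp: power2_eq_square field_simps)
  have dh: "((\<lambda>s. H s y) has_real_derivative h s y) (at s)" for s y
    unfolding H_def h_def
    by (auto intro!: derivative_eq_intros der simp: power2_eq_square field_simps)
  have T: "R < T" "0 < T" unfolding T_def by auto
  have zT: "v s T = 0 \<and> v1 s T = 0" "v s (-2) = 0 \<and> v1 s (-2) = 0"
    "v T y = 0 \<and> v1 T y = 0" "v (-T) y = 0 \<and> v1 (-T) y = 0" for s y
    using zv[of T s] zv[of "-2" s] zv[of y T] zv[of y "-T"] T by auto
  have "integral Q (\<lambda>(s, y). g s y) = 0"
    unfolding Q_def using dg cg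
    by (intro integral_cbox_snd_derivative[of _ _ _ G]) (use T in \<open>auto simp: G_def zT\<close>)
  moreover have "integral Q (\<lambda>(s, y). h s y) = 0"
    unfolding Q_def using dh ch
    by (intro integral_cbox_fst_derivative[of _ _ _ H]) (use T in \<open>auto simp: H_def zT\<close>)
  moreover have "integral Q (\<lambda>(s, y). L s y) \<le> integral Q (\<lambda>z. 70 * (\<lambda>(s, y). F s y) z + (\<lambda>(s, y). g s y) z + (-70) * (\<lambda>(s, y). h s y) z)"
  proof (rule integral_le)
    show "(\<lambda>(s, y). L s y) integrable_on Q"
      unfolding Q_def using cL continuous_on_subset integrable_continuous by blast
    have "continuous_on UNIV (\<lambda>z. 70 * (\<lambda>(s, y). F s y) z + (\<lambda>(s, y). g s y) z + (-70) * (\<lambda>(s, y). h s y) z)"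
      by (intro continuous_intros cF cg ch)
    thus "(\<lambda>z. 70 * (\<lambda>(s, y). F s y) z + (\<lambda>(s, y). g s y) z + (-70) * (\<lambda>(s, y). h s y) z) integrable_on Q"
      unfolding Q_def using continuous_on_subset integrable_continuous by blast
  next
    fix z assume "z \<in> Q"
    obtain s y where z: "z = (s, y)" by (cases z)
    show "(\<lambda>(s, y). L s y) z \<le> 70 * (\<lambda>(s, y). F s y) z + (\<lambda>(s, y). g s y) z + (-70) * (\<lambda>(s, y). h s y) z"
    \<comment> \<open>The weight bounds are available only from -1 upwards; below, all functions
      vanish.\<close>
    proof (cases "y < -1")
      case True
      with zv[of y s] show ?thesis unfolding z by (simp add: L_def F_def g_def h_def dG_def)
    next
      case False
      hence y: "-1 \<le> y" by simp
      note b = conj_weights_bounds[OF par(1,2) y par(3)]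
      show ?thesis
        using conj_pointwise_estimate[OF par(1,2) b par(4,5), of "v1 s y" "v s y" "v2 s y" "?E y" "vs s y" "vs1 s y"]
        unfolding z prod.case L_def F_def g_def h_def dG_def c_def .
    qed
  qed
  moreover have "integral Q (\<lambda>z. 70 * (\<lambda>(s, y). F s y) z + (\<lambda>(s, y). g s y) z + (-70) * (\<lambda>(s, y). h s y) z)
      = 70 * integral Q (\<lambda>(s, y). F s y) + integral Q (\<lambda>(s, y). g s y) + (-70) * integral Q (\<lambda>(s, y). h s y)"
  proof -
    have i: "(\<lambda>(s, y). F s y) integrable_on Q" "(\<lambda>(s, y). g s y) integrable_on Q" "(\<lambda>(s, y). h s y) integrable_on Q"
      unfolding Q_def using cF cg ch continuous_on_subset integrable_continuous by blast+
    show ?thesis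
      by (simp only: integral_add integral_mult_right integrable_add integrable_on_mult_right i)
  qed
  ultimately have main: "integral Q (\<lambda>(s, y). L s y) \<le> 70 * integral Q (\<lambda>(s, y). F s y)" by simp
  have nL: "0 \<le> L s y" for s y
  proof (cases "y < -1")
    case True
    with zv[of y s] show ?thesis by (simp add: L_def)
  next
    case False
    thus ?thesis using conj_weights_bounds(4)[OF par(1,2) _ par(3), of y] unfolding L_def by simp
  qed
  have "(\<integral>\<^sup>+ z. ennreal ((\<lambda>(s, y). L s y) z) \<partial>lborel) = ennreal (integral Q (\<lambda>(s, y). L s y))"
    unfolding Q_def
  proof (rule nn_integral_eq_integral_cbox[OF cL])
    fix z :: "real \<times> real" assume "z \<notin> cbox (-T, -2) (T, T)"
    thus "(\<lambda>(s, y). L s y) z = 0" using outQ[of "fst z" "snd z"] by (auto simp: Q_def L_def split_beta)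
  qed (auto simp: nL)
  moreover have "(\<integral>\<^sup>+ z. ennreal ((\<lambda>(s, y). F s y) z) \<partial>lborel) = ennreal (integral Q (\<lambda>(s, y). F s y))"
    unfolding Q_def
  proof (rule nn_integral_eq_integral_cbox[OF cF])
    fix z :: "real \<times> real" assume "z \<notin> cbox (-T, -2) (T, T)"
    thus "(\<lambda>(s, y). F s y) z = 0" using outQ[of "fst z" "snd z"] by (auto simp: Q_def F_def split_beta)
  qed (auto simp: F_def)
  moreover have "ennreal (integral Q (\<lambda>(s, y). L s y)) \<le> 70 * ennreal (integral Q (\<lambda>(s, y). F s y))"
    using main ennreal_leI[OF main] integral_nonneg by (simp add: ennreal_mult' ennreal_mult'')
  ultimately show ?thesis unfolding L_def F_def conj_op_def conj_energy_def by (simp add: case_prod_unfold)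
qed

text \<open>An explicit cutoff of class C^2, the regularity that a second-order operator asks for:
  the cube of a positive part is twice continuously differentiable, and this is a composition of two
  such cubes, equal to 1 for y \<le> 0 and to 0 for y \<ge> 1.\<close>

definition cut :: "real \<Rightarrow> real" where "cut y = (max 0 (1 - (max 0 y) ^ 3)) ^ 3"
definition cut' :: "real \<Rightarrow> real" where
  "cut' y = - 9 * (max 0 (1 - (max 0 y) ^ 3))\<^sup>2 * (max 0 y)\<^sup>2"
definition cut'' :: "real \<Rightarrow> real" where
  "cut'' y = 54 * max 0 (1 - (max 0 y) ^ 3) * (max 0 y) ^ 4 - 18 * (max 0 (1 - (max 0 y) ^ 3))\<^sup>2 * max 0 y"

lemma DERIV_max_0_power:
  fixes y :: real
  assumes "0 < k"
  shows "((\<lambda>y. (max 0 y) ^ Suc k) has_real_derivative real (Suc k) * (max 0 y) ^ k) (at y)"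
proof (cases y "0::real" rule: linorder_cases)
  case less
  have "((\<lambda>_. 0) has_real_derivative 0) (at y)" by simp
  hence "((\<lambda>y. (max 0 y) ^ Suc k) has_real_derivative 0) (at y)"
    by (rule has_field_derivative_transform_within_open[of _ _ _ "{..<0}"]) (use less in auto)
  thus ?thesis using less assms by (simp add: zero_power del: power_Suc)
next
  case greater
  have "((\<lambda>y. y ^ Suc k) has_real_derivative real (Suc k) * y ^ k) (at y)"
    using DERIV_pow[of "Suc k" y] by (simp del: power_Suc)
  hence "((\<lambda>y. (max 0 y) ^ Suc k) has_real_derivative real (Suc k) * y ^ k) (at y)"
    by (rule has_field_derivative_transform_within_open[of _ _ _ "{0<..}"]) (use greater in auto)
  thus ?thesis using greater by (simp del: power_Suc)
next
  case equal
  \<comment> \<open>At the kink the difference quotient is bounded by \<open>|h|^k\<close>, which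
    tends to 0 because \<open>0 < k\<close>.\<close>
  have "((\<lambda>h::real. (max 0 h) ^ Suc k / h) \<longlongrightarrow> 0) (at 0)"
  proof (rule Lim_null_comparison)
    show "\<forall>\<^sub>F h in at 0. norm ((max 0 h) ^ Suc k / h) \<le> \<bar>h\<bar> ^ k"
      by (rule always_eventually) (auto simp: max_def abs_if)
    have "((\<lambda>h::real. \<bar>h\<bar> ^ k) \<longlongrightarrow> \<bar>0\<bar> ^ k) (at 0)" by (intro tendsto_intros)
    thus "((\<lambda>h::real. \<bar>h\<bar> ^ k) \<longlongrightarrow> 0) (at 0)" using assms by (simp only: abs_zero zero_power)
  qed
  thus ?thesis unfolding equal DERIV_def using assms by (simp add: zero_power del: power_Suc)
qed

lemma DERIV_cut: "(cut has_real_derivative cut' y) (at y)"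
proof -
  have 1: "((\<lambda>y. 1 - (max 0 y) ^ 3) has_real_derivative - (3 * (max 0 y)\<^sup>2)) (at y)"
    using DERIV_diff[OF DERIV_const DERIV_max_0_power[of 2 y], of 1] by (simp add: numeral_3_eq_3)
  have "((\<lambda>y. (max 0 (1 - (max 0 y) ^ 3)) ^ 3) has_real_derivative
      (3 * (max 0 (1 - (max 0 y) ^ 3))\<^sup>2) * - (3 * (max 0 y)\<^sup>2)) (at y)"
    using DERIV_chain2[OF DERIV_max_0_power[of 2 "1 - (max 0 y) ^ 3"] 1] by (simp add: numeral_3_eq_3)
  thus ?thesis unfolding cut_def[abs_def] cut'_def by (simp add: algebra_simps)
qed

lemma DERIV_cut': "(cut' has_real_derivative cut'' y) (at y)"
proof -
  have 1: "((\<lambda>y. 1 - (max 0 y) ^ 3) has_real_derivative - (3 * (max 0 y)\<^sup>2)) (at y)"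
    using DERIV_diff[OF DERIV_const DERIV_max_0_power[of 2 y], of 1] by (simp add: numeral_3_eq_3)
  have 2: "((\<lambda>y. (max 0 (1 - (max 0 y) ^ 3))\<^sup>2) has_real_derivative
      (2 * max 0 (1 - (max 0 y) ^ 3)) * - (3 * (max 0 y)\<^sup>2)) (at y)"
    using DERIV_chain2[OF DERIV_max_0_power[of 1 "1 - (max 0 y) ^ 3"] 1] by (simp add: numeral_2_eq_2)
  have 3: "((\<lambda>y::real. (max 0 y)\<^sup>2) has_real_derivative 2 * max 0 y) (at y)"
    using DERIV_max_0_power[of 1 y] by (simp add: numeral_2_eq_2)
  show ?thesis unfolding cut'_def[abs_def] cut''_def
    by (rule DERIV_cong[OF DERIV_mult[OF DERIV_cmult[OF 2] 3]]) (simp add: power2_eq_square power4_eq_xxxx algebra_simps)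
qed

lemma cut_eq_1: "y \<le> 0 \<Longrightarrow> cut y = 1"
  by (simp add: cut_def)

lemma cut_eq_0: "1 \<le> y \<Longrightarrow> cut y = 0"
  by (simp add: cut_def)

lemma cut_range: "0 \<le> cut y" "cut y \<le> 1"
  unfolding cut_def by (auto simp: power_le_one_iff)

lemma cut'_eq_0: "y \<notin> {0..1} \<Longrightarrow> cut' y = 0" and cut''_eq_0: "y \<notin> {0..1} \<Longrightarrow> cut'' y = 0"
proof -
  assume "y \<notin> {0..1}"
  then consider "y < 0" | "1 \<le> y" by fastforce
  hence "max 0 y = 0 \<or> max 0 (1 - (max 0 y) ^ 3) = 0"
  proof cases
    case 2
    thus ?thesis using one_le_power[of y 3] by simp
  qed simp
  thus "cut' y = 0" "cut'' y = 0" unfolding cut'_def cut''_def by auto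
qed

lemma continuous_on_cut [continuous_intros]:
  assumes "continuous_on S f"
  shows "continuous_on S (\<lambda>x. cut (f x))" "continuous_on S (\<lambda>x. cut' (f x))" "continuous_on S (\<lambda>x. cut'' (f x))"
  unfolding cut_def cut'_def cut''_def by (intro continuous_intros assms)+

text \<open>72 = 54 + 18. Only boundedness matters, as these constants multiply an error that tends
  to zero.\<close>

lemma cut_bounds: "\<bar>cut' y\<bar> \<le> 72" "\<bar>cut'' y\<bar> \<le> 72"
proof -
  define q where "q = max 0 y"
  define r where "r = max 0 (1 - q ^ 3)"
  have "\<bar>cut' y\<bar> \<le> 72 \<and> \<bar>cut'' y\<bar> \<le> 72"
  proof (cases "y \<in> {0..1}")
    case True
    hence q: "0 \<le> q" "q \<le> 1" unfolding q_def by auto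
    hence r: "0 \<le> r" "r \<le> 1" unfolding r_def by auto
    have rr: "0 \<le> r\<^sup>2" "r\<^sup>2 \<le> 1" "0 \<le> q\<^sup>2" "q\<^sup>2 \<le> 1" "0 \<le> q ^ 4" "q ^ 4 \<le> 1"
      using q r by (auto simp: power_le_one)
    have "r\<^sup>2 * q\<^sup>2 \<le> 1" "0 \<le> r\<^sup>2 * q\<^sup>2" "r * q ^ 4 \<le> 1" "0 \<le> r * q ^ 4" "r\<^sup>2 * q \<le> 1" "0 \<le> r\<^sup>2 * q"
      using q r rr by (auto intro: mult_le_one)
    moreover have "cut' y = - 9 * (r\<^sup>2 * q\<^sup>2)" "cut'' y = 54 * (r * q ^ 4) - 18 * (r\<^sup>2 * q)"
      unfolding cut'_def cut''_def q_def[symmetric] r_def[symmetric] by auto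
    ultimately show ?thesis by linarith
  qed (use cut'_eq_0 cut''_eq_0 in auto)
  thus "\<bar>cut' y\<bar> \<le> 72" "\<bar>cut'' y\<bar> \<le> 72" by auto
qed

lemma sum_square_le: "(a + b)\<^sup>2 \<le> 2 * a\<^sup>2 + 2 * (b::real)\<^sup>2"
  using zero_le_power2[of "a - b"] by (simp add: power2_eq_square algebra_simps)

text \<open>Trades compact support in y for square integrability of \<open>v\<close> and
  \<open>v1\<close>. Cutting off at height N leaves commutator terms in the strip
  \<open>N \<le> y \<le> N + 1\<close> with coefficients bounded independently of N; their integral
  is a strip of a convergent integral and tends to 0. The inequality
  \<open>(a + b)^2 \<le> 2 a^2 + 2 b^2\<close> doubles the constant 70.\<close>

lemma conj_estimate:
  fixes v v1 v2 vs vs1 :: "real \<Rightarrow> real \<Rightarrow> real"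
  assumes cont: "continuous_on UNIV (\<lambda>(s, y). v s y)" "continuous_on UNIV (\<lambda>(s, y). v1 s y)"
      "continuous_on UNIV (\<lambda>(s, y). v2 s y)" "continuous_on UNIV (\<lambda>(s, y). vs s y)"
      "continuous_on UNIV (\<lambda>(s, y). vs1 s y)"
    and der: "\<And>s y. (v s has_real_derivative v1 s y) (at y)" "\<And>s y. (v1 s has_real_derivative v2 s y) (at y)"
      "\<And>s y. ((\<lambda>s. v s y) has_real_derivative vs s y) (at s)" "\<And>s y. ((\<lambda>s. v1 s y) has_real_derivative vs1 s y) (at s)"
      "\<And>s y. (vs s has_real_derivative vs1 s y) (at y)"
    and supp: "\<And>s y. y < -1 \<or> R < \<bar>s\<bar> \<Longrightarrow> v s y = 0"
    and par: "1 \<le> \<beta>" "\<beta> \<le> B" "2 \<le> B" "0 \<le> \<kappa>" "1/4 \<le> \<bar>B - \<kappa>\<bar>"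
    and fin: "(\<integral>\<^sup>+ (s, y). ennreal ((v s y)\<^sup>2 + (v1 s y)\<^sup>2) \<partial>lborel) < \<infinity>"
  shows "(\<integral>\<^sup>+ (s, y). ennreal (conj_energy \<beta> \<kappa> y (v s y) (v1 s y)) \<partial>lborel)
    \<le> 140 * (\<integral>\<^sup>+ (s, y). ennreal ((conj_op B \<beta> \<kappa> y (v s y) (v1 s y) (v2 s y) (vs s y))\<^sup>2) \<partial>lborel)"
proof -
  let ?p = "conj_slope B \<beta>" and ?p1 = "conj_convexity \<beta>"
  define f where "f s y = conj_op B \<beta> \<kappa> y (v s y) (v1 s y) (v2 s y) (vs s y)" for s y
  define L where "L s y = conj_energy \<beta> \<kappa> y (v s y) (v1 s y)" for s y
  define W where "W s y = (v s y)\<^sup>2 + (v1 s y)\<^sup>2" for s y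
  \<comment> \<open>72 bounds the derivatives of the cutoff, \<open>B\<close> bounds the slope, and
    the outer 2 comes from squaring \<open>|v| + |v1|\<close>. Its dependence on \<open>B\<close> is
    harmless, since its factor vanishes in the limit.\<close>
  define K where "K = 2 * (72 * (2 + 2 * B))\<^sup>2"
  note [continuous_intros] = cont[unfolded case_prod_unfold]
  have cp [continuous_intros]: "continuous_on UNIV (\<lambda>z::real\<times>real. ?p (snd z))" "continuous_on UNIV (\<lambda>z::real\<times>real. ?p1 (snd z))"
    unfolding conj_slope_def conj_convexity_def by (auto intro!: continuous_intros)
  have cf: "continuous_on UNIV (\<lambda>z. f (fst z) (snd z))" and cL: "continuous_on UNIV (\<lambda>z. L (fst z) (snd z))"
    and cW: "continuous_on UNIV (\<lambda>z. W (fst z) (snd z))"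
    unfolding f_def L_def W_def conj_op_def conj_energy_def by (auto intro!: continuous_intros)
  have [measurable]: "(\<lambda>z. f (fst z) (snd z)) \<in> borel_measurable borel" "(\<lambda>z. L (fst z) (snd z)) \<in> borel_measurable borel"
    "(\<lambda>z. W (fst z) (snd z)) \<in> borel_measurable borel"
    by (rule borel_measurable_continuous_onI; fact)+
  define S where "S N = {z::real\<times>real. real N \<le> snd z \<and> snd z \<le> real N + 1}" for N
  define I where "I N = {z::real\<times>real. snd z \<le> real N}" for N
  have [measurable]: "S N \<in> sets borel" "I N \<in> sets borel" for N
    unfolding S_def I_def by (intro borel_closed closed_Collect_conj closed_Collect_le continuous_intros)+
  have step: "(\<integral>\<^sup>+ z. ennreal (L (fst z) (snd z)) * indicator (I N) z \<partial>lborel)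
      \<le> 140 * (\<integral>\<^sup>+ z. ennreal ((f (fst z) (snd z))\<^sup>2) \<partial>lborel)
        + ennreal (140 * K) * (\<integral>\<^sup>+ z. ennreal (W (fst z) (snd z)) * indicator (S N) z \<partial>lborel)" for N
  proof -
    define e where "e y = cut (y - real N)" for y
    define e1 where "e1 y = cut' (y - real N)" for y
    define e2 where "e2 y = cut'' (y - real N)" for y
    have de: "(e has_real_derivative e1 y) (at y)" "(e1 has_real_derivative e2 y) (at y)" for y
    proof -
      have g: "((\<lambda>y. y - real N) has_real_derivative 1) (at y)" by (auto intro!: derivative_eq_intros)
      show "(e has_real_derivative e1 y) (at y)" "(e1 has_real_derivative e2 y) (at y)"
        unfolding e_def[abs_def] e1_def[abs_def] e2_def
      using DERIV_chain2[where f = cut and g = "\<lambda>y. y - real N", OF DERIV_cut g]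
        DERIV_chain2[where f = cut' and g = "\<lambda>y. y - real N", OF DERIV_cut' g]
        by simp_all
    qed
    define V where "V s y = e y * v s y" for s y
    define V1 where "V1 s y = e1 y * v s y + e y * v1 s y" for s y
    define V2 where "V2 s y = e2 y * v s y + 2 * e1 y * v1 s y + e y * v2 s y" for s y
    define Vs where "Vs s y = e y * vs s y" for s y
    define Vs1 where "Vs1 s y = e1 y * vs s y + e y * vs1 s y" for s y
    define F where "F s y = conj_op B \<beta> \<kappa> y (V s y) (V1 s y) (V2 s y) (Vs s y)" for s y
    let ?LV = "\<integral>\<^sup>+ (s, y). ennreal (conj_energy \<beta> \<kappa> y (V s y) (V1 s y)) \<partial>lborel"
    let ?f = "\<integral>\<^sup>+ z. ennreal ((f (fst z) (snd z))\<^sup>2) \<partial>lborel"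
    let ?w = "\<integral>\<^sup>+ z. ennreal (W (fst z) (snd z)) * indicator (S N) z \<partial>lborel"
    have ce [continuous_intros]: "continuous_on UNIV (\<lambda>z::real\<times>real. e (snd z))" "continuous_on UNIV (\<lambda>z::real\<times>real. e1 (snd z))"
       "continuous_on UNIV (\<lambda>z::real\<times>real. e2 (snd z))"
      unfolding e_def e1_def e2_def by (auto intro!: continuous_intros)
    have A1: "?LV
      \<le> 70 * (\<integral>\<^sup>+ (s, y). ennreal ((F s y)\<^sup>2) \<partial>lborel)"
      unfolding F_def
    proof (rule conj_estimate_compact[where R = "max R (real N + 1)" and ?vs1.0 = Vs1])
      show "continuous_on UNIV (\<lambda>(s, y). V s y)" "continuous_on UNIV (\<lambda>(s, y). V1 s y)"
        "continuous_on UNIV (\<lambda>(s, y). V2 s y)" "continuous_on UNIV (\<lambda>(s, y). Vs s y)"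
        "continuous_on UNIV (\<lambda>(s, y). Vs1 s y)"
        unfolding V_def V1_def V2_def Vs_def Vs1_def case_prod_unfold by (auto intro!: continuous_intros)
      show "(V s has_real_derivative V1 s y) (at y)" "(V1 s has_real_derivative V2 s y) (at y)"
        "((\<lambda>s. V s y) has_real_derivative Vs s y) (at s)" "((\<lambda>s. V1 s y) has_real_derivative Vs1 s y) (at s)"
        "(Vs s has_real_derivative Vs1 s y) (at y)" for s y
        unfolding V_def[abs_def] V1_def[abs_def] V2_def Vs_def[abs_def] Vs1_def
        by (auto intro!: derivative_eq_intros de der)
      show "V s y = 0" if "y < - 1 \<or> max R (real N + 1) < y \<or> max R (real N + 1) < \<bar>s\<bar>" for s y
        using that supp[of y s] cut_eq_0[of "y - real N"] unfolding V_def e_def by auto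
    qed (use par in auto)
    have "(\<integral>\<^sup>+ (s, y). ennreal ((F s y)\<^sup>2) \<partial>lborel)
      \<le> (\<integral>\<^sup>+ z. (2 * ennreal ((f (fst z) (snd z))\<^sup>2)
         + ennreal (2 * K) * (ennreal (W (fst z) (snd z)) * indicator (S N) z)) \<partial>lborel)"
    proof (rule nn_integral_mono, clarsimp simp only: prod.case fst_conv snd_conv)
      fix s y :: real
      \<comment> \<open>The commutator of the operator with multiplication by \<open>e\<close>; the
        zeroth-order and the time term commute with it.\<close>
      define r where "r = e2 y * v s y + 2 * e1 y * v1 s y - 2 * ?p y * e1 y * v s y"
      have F: "F s y = e y * f s y + r"
        unfolding F_def V2_def V1_def V_def Vs_def f_def r_def conj_op_def by (simp add: algebra_simps)
      have "(e y * f s y)\<^sup>2 \<le> (f s y)\<^sup>2"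
        using cut_range[of "y - real N"] unfolding power_mult_distrib e_def
        by (intro mult_left_le_one_le) (auto simp: power_le_one)
      moreover have "r\<^sup>2 \<le> K * (W s y * indicator (S N) (s, y))"
      proof (cases "real N \<le> y \<and> y \<le> real N + 1")
        case False
        hence "y - real N \<notin> {0..1}" by auto
        hence "e1 y = 0" "e2 y = 0" unfolding e1_def e2_def using cut'_eq_0 cut''_eq_0 by auto
        thus ?thesis unfolding r_def K_def W_def by simp
      next
        case True
        have "0 \<le> \<beta> * exp (- y / 2)" using par by simp
        moreover have "-1 \<le> y" using True by (smt (verit) of_nat_0_le_iff)
        note conj_weights_bounds[OF par(1,2) this par(3)]
        ultimately have p: "\<bar>?p y\<bar> \<le> B" by auto
        have tri: "\<bar>a + b - c\<bar> \<le> \<bar>a\<bar> + \<bar>b\<bar> + \<bar>c\<bar>" for a b c :: real by linarith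
        have "\<bar>r\<bar> \<le> \<bar>e2 y\<bar> * \<bar>v s y\<bar> + 2 * \<bar>e1 y\<bar> * \<bar>v1 s y\<bar> + 2 * \<bar>?p y\<bar> * \<bar>e1 y\<bar> * \<bar>v s y\<bar>"
          unfolding r_def using tri[of "e2 y * v s y" "2 * e1 y * v1 s y" "2 * ?p y * e1 y * v s y"]
          by (simp add: abs_mult)
        also have "\<dots> \<le> 72 * \<bar>v s y\<bar> + 2 * 72 * \<bar>v1 s y\<bar> + 2 * B * 72 * \<bar>v s y\<bar>"
          using cut_bounds[of "y - real N"] p unfolding e1_def e2_def
          by (intro add_mono mult_mono) (auto intro!: mult_nonneg_nonneg)
        also have "\<dots> \<le> 72 * (2 + 2 * B) * (\<bar>v s y\<bar> + \<bar>v1 s y\<bar>)"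
          using par by (simp add: algebra_simps)
        finally have "\<bar>r\<bar> \<le> 72 * (2 + 2 * B) * (\<bar>v s y\<bar> + \<bar>v1 s y\<bar>)" .
        hence "\<bar>r\<bar>\<^sup>2 \<le> (72 * (2 + 2 * B) * (\<bar>v s y\<bar> + \<bar>v1 s y\<bar>))\<^sup>2" by (rule power_mono) simp
        also have "\<dots> = (72 * (2 + 2 * B))\<^sup>2 * (\<bar>v s y\<bar> + \<bar>v1 s y\<bar>)\<^sup>2" by (simp add: power_mult_distrib)
        also have "\<dots> \<le> (72 * (2 + 2 * B))\<^sup>2 * (2 * W s y)"
          by (rule mult_left_mono) (use sum_square_le[of "\<bar>v s y\<bar>" "\<bar>v1 s y\<bar>"] in \<open>auto simp: W_def\<close>)
        also have "\<dots> \<le> K * W s y"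
          unfolding K_def by simp
        finally show ?thesis using True by (simp add: S_def)
      qed
      ultimately have "(e y * f s y + r)\<^sup>2 \<le> 2 * (f s y)\<^sup>2 + 2 * K * (W s y * indicator (S N) (s, y))"
        using sum_square_le[of "e y * f s y" r] by simp
      hence "ennreal ((e y * f s y + r)\<^sup>2) \<le> ennreal (2 * (f s y)\<^sup>2 + 2 * K * (W s y * indicator (S N) (s, y)))"
        by (rule ennreal_leI)
      also have "\<dots> = 2 * ennreal ((f s y)\<^sup>2) + ennreal (2 * K) * (ennreal (W s y) * indicator (S N) (s, y))"
        unfolding K_def W_def by (auto simp: ennreal_plus ennreal_mult indicator_def split: if_splits)
      finally show "ennreal ((F s y)\<^sup>2)
         \<le> 2 * ennreal ((f s y)\<^sup>2) + ennreal (2 * K) * (ennreal (W s y) * indicator (S N) (s, y))"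
        unfolding F .
    qed
    also have "\<dots> = 2 * ?f
        + ennreal (2 * K) * ?w"
      by (simp add: nn_integral_add nn_integral_cmult)
    finally have B1: "(\<integral>\<^sup>+ (s, y). ennreal ((F s y)\<^sup>2) \<partial>lborel)
      \<le> 2 * ?f
        + ennreal (2 * K) * ?w" .
    have eq: "70 * (2 * a + ennreal (2 * K) * b) = 140 * a + ennreal (140 * K) * b" for a b :: ennreal
    proof -
      have "ennreal (140 * K) = ennreal 70 * ennreal (2 * K)"
        unfolding K_def by (subst ennreal_mult[symmetric]) auto
      thus ?thesis by (simp add: distrib_left mult.assoc[symmetric])
    qed
    have A: "?LV
      \<le> 140 * ?f
        + ennreal (140 * K) * ?w"
      using order_trans[OF A1 mult_left_mono[OF B1]] unfolding eq by simp
    have "(\<integral>\<^sup>+ z. ennreal (L (fst z) (snd z)) * indicator (I N) z \<partial>lborel)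
      \<le> ?LV"
    proof (rule nn_integral_mono, clarsimp simp only: prod.case fst_conv snd_conv)
      fix s y
      show "ennreal (L s y) * indicator (I N) (s, y) \<le> ennreal (conj_energy \<beta> \<kappa> y (V s y) (V1 s y))"
      proof (cases "y \<le> real N")
        case True
        hence "e y = 1" "e1 y = 0"
          using cut_eq_1[of "y - real N"] cut'_eq_0[of "y - real N"] unfolding e_def e1_def
          by (auto simp: cut'_def)
        thus ?thesis using True by (simp add: L_def V_def V1_def I_def)
      qed (simp add: I_def)
    qed
    with A show ?thesis by simp
  qed
  have Wfin: "(\<integral>\<^sup>+ z. ennreal (W (fst z) (snd z)) \<partial>lborel) < \<infinity>"
    using fin unfolding W_def by (simp add: case_prod_unfold)
  \<comment> \<open>Every point lies above only finitely many levels N, so the integrands vanish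
    eventually, and \<open>W\<close> dominates them.\<close>
  have lim0: "(\<lambda>N. \<integral>\<^sup>+ z. ennreal (W (fst z) (snd z)) * indicator (S N) z \<partial>lborel) \<longlonglongrightarrow> (integral\<^sup>N lborel (\<lambda>_::real\<times>real. 0))"
  proof (rule nn_integral_dominated_convergence[where w = "\<lambda>z. ennreal (W (fst z) (snd z))"])
    show "AE z in lborel. (\<lambda>N. ennreal (W (fst z) (snd z)) * indicator (S N) z) \<longlonglongrightarrow> 0"
    proof (rule AE_I2)
      fix z :: "real \<times> real"
      obtain M :: nat where M: "snd z < real M" using reals_Archimedean2 by blast
      have "\<forall>\<^sub>F N in sequentially. ennreal (W (fst z) (snd z)) * indicator (S N) z = 0"
        using eventually_ge_at_top[of M]
      proof eventually_elim
        case (elim N)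
        hence "snd z < real N" using M by (smt (verit) of_nat_mono)
        thus ?case by (simp add: S_def)
      qed
      thus "(\<lambda>N. ennreal (W (fst z) (snd z)) * indicator (S N) z) \<longlonglongrightarrow> 0" by (rule tendsto_eventually)
    qed
    show "AE z in lborel. ennreal (W (fst z) (snd z)) * indicator (S N) z \<le> ennreal (W (fst z) (snd z))" for N
      by (auto simp: indicator_def)
  qed (use Wfin in auto)
  have limL: "(\<lambda>N. \<integral>\<^sup>+ z. ennreal (L (fst z) (snd z)) * indicator (I N) z \<partial>lborel) \<longlonglongrightarrow> (\<integral>\<^sup>+ z. ennreal (L (fst z) (snd z)) \<partial>lborel)"
  proof (rule nn_integral_LIMSEQ)
    show "incseq (\<lambda>N z. ennreal (L (fst z) (snd z)) * indicator (I N) z)"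
      by (auto simp: incseq_def le_fun_def indicator_def I_def)
    fix z :: "real \<times> real"
    obtain M :: nat where M: "snd z < real M" using reals_Archimedean2 by blast
    have "\<forall>\<^sub>F N in sequentially. ennreal (L (fst z) (snd z)) * indicator (I N) z = ennreal (L (fst z) (snd z))"
      using eventually_ge_at_top[of M]
    proof eventually_elim
      case (elim N)
      hence "snd z < real N" using M by (smt (verit) of_nat_mono)
      thus ?case by (simp add: I_def)
    qed
    thus "(\<lambda>N. ennreal (L (fst z) (snd z)) * indicator (I N) z) \<longlonglongrightarrow> ennreal (L (fst z) (snd z))" by (rule tendsto_eventually)
  qed auto
  have "(\<lambda>N. 140 * (\<integral>\<^sup>+ z. ennreal ((f (fst z) (snd z))\<^sup>2) \<partial>lborel)
        + ennreal (140 * K) * (\<integral>\<^sup>+ z. ennreal (W (fst z) (snd z)) * indicator (S N) z \<partial>lborel))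
      \<longlonglongrightarrow> 140 * (\<integral>\<^sup>+ z. ennreal ((f (fst z) (snd z))\<^sup>2) \<partial>lborel) + ennreal (140 * K) * (integral\<^sup>N lborel (\<lambda>_::real\<times>real. 0))"
    by (intro tendsto_add tendsto_const ennreal_tendsto_cmult lim0) auto
  from LIMSEQ_le[OF limL this] step
  have "(\<integral>\<^sup>+ z. ennreal (L (fst z) (snd z)) \<partial>lborel) \<le> 140 * (\<integral>\<^sup>+ z. ennreal ((f (fst z) (snd z))\<^sup>2) \<partial>lborel)" by auto
  thus ?thesis unfolding L_def f_def by (simp add: case_prod_unfold)
qed

section \<open>Undoing the conjugation by the Carleman weight\<close>

lemma DERIV_psi: "(psi \<beta> has_real_derivative conj_slope \<beta> \<beta> y) (at y)"
  unfolding psi_def[abs_def] conj_slope_def by (auto intro!: derivative_eq_intros)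

lemma psi''_eq: "psi'' \<beta> x = conj_convexity \<beta> (- ln (norm x))"
proof -
  have "deriv (psi \<beta>) = conj_slope \<beta> \<beta>" by (rule ext, rule DERIV_imp_deriv, rule DERIV_psi)
  moreover have "deriv (conj_slope \<beta> \<beta>) y = conj_convexity \<beta> y" for y
    by (rule DERIV_imp_deriv, rule DERIV_conj_slope)
  ultimately show ?thesis unfolding psi''_def by simp
qed

text \<open>\<open>b\<close> plays the role of a spherical-harmonic coefficient and \<open>m\<close>
  that of \<open>n - 2\<close>. Conjugation by \<open>exp (psi \<beta> y)\<close> combines with the
  drift \<open>- m * b1\<close> to the first-order coefficient \<open>- 2 (\<psi>' + m / 2)\<close>,
  and completing squares turns \<open>k (k + m)\<close> into \<open>(k + m / 2)^2\<close>. Slope and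
  angular frequency thus receive the same shift \<open>m / 2\<close>.\<close>

lemma mode_estimate:
  fixes b b1 b2 bs bs1 :: "real \<Rightarrow> real \<Rightarrow> real" and k j :: nat
  assumes cont: "continuous_on UNIV (\<lambda>(s, y). b s y)" "continuous_on UNIV (\<lambda>(s, y). b1 s y)"
      "continuous_on UNIV (\<lambda>(s, y). b2 s y)" "continuous_on UNIV (\<lambda>(s, y). bs s y)"
      "continuous_on UNIV (\<lambda>(s, y). bs1 s y)"
    and der: "\<And>s y. (b s has_real_derivative b1 s y) (at y)" "\<And>s y. (b1 s has_real_derivative b2 s y) (at y)"
      "\<And>s y. ((\<lambda>s. b s y) has_real_derivative bs s y) (at s)" "\<And>s y. ((\<lambda>s. b1 s y) has_real_derivative bs1 s y) (at s)"
      "\<And>s y. (bs s has_real_derivative bs1 s y) (at y)"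
    and supp: "\<And>s y. y < -1 \<or> R < \<bar>s\<bar> \<Longrightarrow> b s y = 0"
    and par: "0 \<le> m" "\<beta> = real j + 1/4" "2 \<le> \<beta>"
    and fin: "(\<integral>\<^sup>+ (s, y). ennreal ((exp (psi \<beta> y))\<^sup>2 * ((b s y)\<^sup>2 + (b1 s y)\<^sup>2)) \<partial>lborel) < \<infinity>"
  shows "(\<integral>\<^sup>+ (s, y). ennreal ((exp (psi \<beta> y))\<^sup>2 * (1 + conj_convexity \<beta> y) *
        ((b1 s y)\<^sup>2 + (real k * (real k + m) + \<beta>\<^sup>2) * (b s y)\<^sup>2)) \<partial>lborel)
    \<le> 420 * (\<integral>\<^sup>+ (s, y). ennreal ((exp (psi \<beta> y))\<^sup>2 *
        (b2 s y - m * b1 s y - real k * (real k + m) * b s y - exp (- 2 * y) * bs s y)\<^sup>2) \<partial>lborel)"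
proof -
  define B where "B = \<beta> + m / 2"
  define \<kappa> where "\<kappa> = real k + m / 2"
  define q where "q = conj_slope \<beta> \<beta>"
  let ?p1 = "conj_convexity \<beta>"
  define e where "e y = exp (psi \<beta> y)" for y
  have p: "conj_slope B \<beta> y = q y + m / 2" for y unfolding B_def q_def conj_slope_def by simp
  have de: "(e has_real_derivative e y * q y) (at y)" for y
    unfolding e_def[abs_def] q_def by (auto intro!: derivative_eq_intros DERIV_psi)
  have dq: "(q has_real_derivative ?p1 y) (at y)" for y
    unfolding q_def by (rule DERIV_conj_slope)
  define v where "v s y = e y * b s y" for s y
  define v1 where "v1 s y = e y * (b1 s y + q y * b s y)" for s y
  define v2 where "v2 s y = e y * (b2 s y + 2 * q y * b1 s y + ((q y)\<^sup>2 + ?p1 y) * b s y)" for s y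
  define vs where "vs s y = e y * bs s y" for s y
  define vs1 where "vs1 s y = e y * (bs1 s y + q y * bs s y)" for s y
  note [continuous_intros] = cont[unfolded case_prod_unfold]
  have [continuous_intros]: "continuous_on UNIV (\<lambda>z::real\<times>real. q (snd z))" "continuous_on UNIV (\<lambda>z::real\<times>real. ?p1 (snd z))"
    "continuous_on UNIV (\<lambda>z::real\<times>real. e (snd z))"
    unfolding conj_slope_def conj_convexity_def q_def e_def psi_def by (auto intro!: continuous_intros)
  have cvs: "continuous_on UNIV (\<lambda>(s, y). v s y)" "continuous_on UNIV (\<lambda>(s, y). v1 s y)"
      "continuous_on UNIV (\<lambda>(s, y). v2 s y)" "continuous_on UNIV (\<lambda>(s, y). vs s y)"
      "continuous_on UNIV (\<lambda>(s, y). vs1 s y)"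
    unfolding v_def v1_def v2_def vs_def vs1_def case_prod_unfold by (auto intro!: continuous_intros)
  have b1_0: "b1 s y = 0" if "y < -1" for s y
    by (rule deriv_zero_on_open[OF _ _ _ der(1), of "{..<-1}"]) (use that supp in auto)
  have qb: "0 \<le> q y" "q y \<le> \<beta>" "0 \<le> ?p1 y" if "-1 \<le> y" for y
    using conj_weights_bounds[of \<beta> \<beta> y] that par unfolding q_def by auto
  \<comment> \<open>The shift \<open>m / 2\<close> cancels, and \<open>j - k + 1/4\<close> with an
    integer \<open>j - k\<close> is at least 1/4 or at most -3/4.\<close>
  have gap: "1/4 \<le> \<bar>B - \<kappa>\<bar>"
  proof -
    have "B - \<kappa> = real_of_int (int j - int k) + 1/4" unfolding B_def \<kappa>_def par by simp
    moreover have "int j - int k \<ge> 0 \<or> int j - int k \<le> -1" by linarith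
    hence "real_of_int (int j - int k) \<ge> 0 \<or> real_of_int (int j - int k) \<le> -1" by linarith
    ultimately show ?thesis by linarith
  qed
  have est: "(\<integral>\<^sup>+ (s, y). ennreal (conj_energy \<beta> \<kappa> y (v s y) (v1 s y)) \<partial>lborel)
    \<le> 140 * (\<integral>\<^sup>+ (s, y). ennreal ((conj_op B \<beta> \<kappa> y (v s y) (v1 s y) (v2 s y) (vs s y))\<^sup>2) \<partial>lborel)"
  proof (rule conj_estimate[OF cvs, where R = R])
    show "(v s has_real_derivative v1 s y) (at y)" "(v1 s has_real_derivative v2 s y) (at y)"
        "((\<lambda>s. v s y) has_real_derivative vs s y) (at s)" "((\<lambda>s. v1 s y) has_real_derivative vs1 s y) (at s)"
        "(vs s has_real_derivative vs1 s y) (at y)" for s y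
      unfolding v_def[abs_def] v1_def[abs_def] v2_def vs_def[abs_def] vs1_def
      by (auto intro!: derivative_eq_intros de der dq simp: algebra_simps power2_eq_square)
    show "v s y = 0" if "y < - 1 \<or> R < \<bar>s\<bar>" for s y using supp[OF that] by (simp add: v_def)
    have "(\<integral>\<^sup>+ (s, y). ennreal ((v s y)\<^sup>2 + (v1 s y)\<^sup>2) \<partial>lborel)
      \<le> (\<integral>\<^sup>+ (s, y). ennreal (2 + 2 * \<beta>\<^sup>2) * ennreal ((exp (psi \<beta> y))\<^sup>2 * ((b s y)\<^sup>2 + (b1 s y)\<^sup>2)) \<partial>lborel)"
    proof (rule nn_integral_mono, clarsimp simp only: prod.case)
      fix s y
      have "(v s y)\<^sup>2 + (v1 s y)\<^sup>2 \<le> (2 + 2 * \<beta>\<^sup>2) * ((e y)\<^sup>2 * ((b s y)\<^sup>2 + (b1 s y)\<^sup>2))"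
      proof (cases "y < -1")
        case True
        thus ?thesis using supp[of y s] b1_0[of y s] by (simp add: v_def v1_def)
      next
        case False
        \<comment> \<open>With the slope \<open>q\<close> between 0 and \<beta>, the derivative
          \<open>v1 = e (b1 + q b)\<close> is controlled by \<open>b\<close> and \<open>b1\<close>,
          so finiteness passes from \<open>b\<close> to \<open>v\<close>.\<close>
        hence q2: "(q y)\<^sup>2 \<le> \<beta>\<^sup>2" using qb[of y] by (intro power_mono) auto
        have "(b1 s y + q y * b s y)\<^sup>2 \<le> 2 * (b1 s y)\<^sup>2 + 2 * ((q y)\<^sup>2 * (b s y)\<^sup>2)"
          using sum_square_le[of "b1 s y" "q y * b s y"] by (simp add: power_mult_distrib)
        moreover have "(q y)\<^sup>2 * (b s y)\<^sup>2 \<le> \<beta>\<^sup>2 * (b s y)\<^sup>2" by (rule mult_right_mono[OF q2]) simp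
        moreover have "0 \<le> \<beta>\<^sup>2 * (b1 s y)\<^sup>2" "0 \<le> (b s y)\<^sup>2" by auto
        ultimately have "(b s y)\<^sup>2 + (b1 s y + q y * b s y)\<^sup>2 \<le> (2 + 2 * \<beta>\<^sup>2) * ((b s y)\<^sup>2 + (b1 s y)\<^sup>2)"
          unfolding distrib_left distrib_right mult.assoc by linarith
        from mult_left_mono[OF this, of "(e y)\<^sup>2"] show ?thesis
          unfolding v_def v1_def power_mult_distrib[of "e y"] distrib_left[symmetric] by (simp add: mult_ac)
      qed
      thus "ennreal ((v s y)\<^sup>2 + (v1 s y)\<^sup>2) \<le> ennreal (2 + 2 * \<beta>\<^sup>2) * ennreal ((exp (psi \<beta> y))\<^sup>2 * ((b s y)\<^sup>2 + (b1 s y)\<^sup>2))"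
        by (subst ennreal_mult[symmetric]) (auto simp: e_def intro!: ennreal_leI simp del: ennreal_plus)
    qed
    also have "\<dots> = ennreal (2 + 2 * \<beta>\<^sup>2) * (\<integral>\<^sup>+ (s, y). ennreal ((exp (psi \<beta> y))\<^sup>2 * ((b s y)\<^sup>2 + (b1 s y)\<^sup>2)) \<partial>lborel)"
      unfolding case_prod_unfold
    proof (rule nn_integral_cmult)
      have "continuous_on UNIV (\<lambda>z. (e (snd z))\<^sup>2 * ((b (fst z) (snd z))\<^sup>2 + (b1 (fst z) (snd z))\<^sup>2))"
        by (intro continuous_intros)
      from borel_measurable_continuous_onI[OF this]
      show "(\<lambda>x. ennreal ((exp (psi \<beta> (snd x)))\<^sup>2 * ((b (fst x) (snd x))\<^sup>2 + (b1 (fst x) (snd x))\<^sup>2))) \<in> borel_measurable lborel"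
        unfolding e_def by simp
    qed
    also have "\<dots> < \<infinity>" using fin by (simp add: ennreal_mult_less_top)
    finally show "(\<integral>\<^sup>+ (s, y). ennreal ((v s y)\<^sup>2 + (v1 s y)\<^sup>2) \<partial>lborel) < \<infinity>" .
  qed (use par gap in \<open>auto simp: B_def \<kappa>_def\<close>)
  have f: "conj_op B \<beta> \<kappa> y (v s y) (v1 s y) (v2 s y) (vs s y)
    = e y * (b2 s y - m * b1 s y - real k * (real k + m) * b s y - exp (- 2 * y) * bs s y)" for s y
    unfolding conj_op_def p v_def v1_def v2_def vs_def \<kappa>_def by (simp add: power2_eq_square field_simps)
  have "(\<integral>\<^sup>+ (s, y). ennreal ((exp (psi \<beta> y))\<^sup>2 * (1 + ?p1 y) *
        ((b1 s y)\<^sup>2 + (real k * (real k + m) + \<beta>\<^sup>2) * (b s y)\<^sup>2)) \<partial>lborel)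
    \<le> (\<integral>\<^sup>+ (s, y). 3 * ennreal (conj_energy \<beta> \<kappa> y (v s y) (v1 s y)) \<partial>lborel)"
  proof (rule nn_integral_mono, clarsimp simp only: prod.case)
    fix s y
    have "(e y)\<^sup>2 * (1 + ?p1 y) * ((b1 s y)\<^sup>2 + (real k * (real k + m) + \<beta>\<^sup>2) * (b s y)\<^sup>2)
      \<le> 3 * conj_energy \<beta> \<kappa> y (v s y) (v1 s y)"
    proof (cases "y < -1")
      case True
      thus ?thesis using supp[of y s] b1_0[of y s] by (simp add: v_def v1_def conj_energy_def)
    next
      case False
      hence q2: "(q y)\<^sup>2 \<le> \<beta>\<^sup>2" using qb[of y] by (intro power_mono) auto
      have k2: "real k * (real k + m) \<le> \<kappa>\<^sup>2" unfolding \<kappa>_def by (simp add: power2_eq_square algebra_simps)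
      \<comment> \<open>Origin of the factor 3: \<open>e b1 = v1 - q v\<close> costs
        \<open>2 v1^2 + 2 \<beta>^2 v^2\<close>, the term \<beta>^2 of the claim adds one more, and
        \<open>k (k + m) \<le> \<kappa>^2\<close>.\<close>
      have "e y * b1 s y = v1 s y + (- q y) * v s y" unfolding v1_def v_def by (simp add: algebra_simps)
      hence "(e y * b1 s y)\<^sup>2 \<le> 2 * (v1 s y)\<^sup>2 + 2 * ((q y)\<^sup>2 * (v s y)\<^sup>2)"
        using sum_square_le[of "v1 s y" "(- q y) * v s y"] by (simp add: power_mult_distrib)
      moreover have "(q y)\<^sup>2 * (v s y)\<^sup>2 \<le> \<beta>\<^sup>2 * (v s y)\<^sup>2" by (rule mult_right_mono[OF q2]) simp
      moreover have "real k * (real k + m) * (v s y)\<^sup>2 \<le> \<kappa>\<^sup>2 * (v s y)\<^sup>2" by (rule mult_right_mono[OF k2]) simp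
      moreover have "0 \<le> (v1 s y)\<^sup>2" "0 \<le> \<kappa>\<^sup>2 * (v s y)\<^sup>2" by auto
      ultimately have "(e y * b1 s y)\<^sup>2 + (real k * (real k + m) + \<beta>\<^sup>2) * (v s y)\<^sup>2 \<le> 3 * ((v1 s y)\<^sup>2 + (\<kappa>\<^sup>2 + \<beta>\<^sup>2) * (v s y)\<^sup>2)"
        unfolding distrib_right distrib_left by linarith
      from mult_left_mono[OF this, of "1 + ?p1 y"] show ?thesis
        using qb[of y] False unfolding v_def conj_energy_def by (simp add: power_mult_distrib algebra_simps)
    qed
    hence "ennreal ((e y)\<^sup>2 * (1 + ?p1 y) * ((b1 s y)\<^sup>2 + (real k * (real k + m) + \<beta>\<^sup>2) * (b s y)\<^sup>2))
      \<le> ennreal (3 * conj_energy \<beta> \<kappa> y (v s y) (v1 s y))" by (rule ennreal_leI)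
    also have "\<dots> = 3 * ennreal (conj_energy \<beta> \<kappa> y (v s y) (v1 s y))"
      by (subst ennreal_mult') auto
    finally show "ennreal ((exp (psi \<beta> y))\<^sup>2 * (1 + ?p1 y) * ((b1 s y)\<^sup>2 + (real k * (real k + m) + \<beta>\<^sup>2) * (b s y)\<^sup>2))
      \<le> 3 * ennreal (conj_energy \<beta> \<kappa> y (v s y) (v1 s y))" unfolding e_def .
  qed
  also have "\<dots> = 3 * (\<integral>\<^sup>+ (s, y). ennreal (conj_energy \<beta> \<kappa> y (v s y) (v1 s y)) \<partial>lborel)"
    unfolding case_prod_unfold
  proof (rule nn_integral_cmult)
    note [continuous_intros] = cvs[unfolded case_prod_unfold]
    have "continuous_on UNIV (\<lambda>z. conj_energy \<beta> \<kappa> (snd z) (v (fst z) (snd z)) (v1 (fst z) (snd z)))"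
      unfolding conj_energy_def by (intro continuous_intros)
    from borel_measurable_continuous_onI[OF this]
    show "(\<lambda>z. ennreal (conj_energy \<beta> \<kappa> (snd z) (v (fst z) (snd z)) (v1 (fst z) (snd z)))) \<in> borel_measurable lborel"
      by simp
  qed
  also have "\<dots> \<le> 3 * (140 * (\<integral>\<^sup>+ (s, y). ennreal ((conj_op B \<beta> \<kappa> y (v s y) (v1 s y) (v2 s y) (vs s y))\<^sup>2) \<partial>lborel))"
    by (rule mult_left_mono[OF est]) simp
  finally show ?thesis unfolding f e_def by (simp add: mult.assoc[symmetric] power_mult_distrib)
qed

subsection \<open>Polar coordinates and rotations\<close>

definition annulus_weight :: "'a::euclidean_space \<Rightarrow> real" where
  "annulus_weight x = (if 1 < norm x \<and> norm x < exp 1 then 1 / norm x ^ DIM('a) else 0)"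

definition sphere_measure :: "'a::euclidean_space measure" where
  "sphere_measure = distr (density lborel (\<lambda>x. ennreal (annulus_weight x))) borel (\<lambda>x. x /\<^sub>R norm x)"

lemma sets_sphere_measure [simp, measurable_cong]: "sets sphere_measure = sets borel"
  and space_sphere_measure [simp]: "space sphere_measure = UNIV"
  unfolding sphere_measure_def by auto

lemma annulus_weight_measurable [measurable]: "annulus_weight \<in> borel_measurable borel"
  unfolding annulus_weight_def[abs_def] by measurable

lemma nn_integral_sphere_measure:
  assumes [measurable]: "h \<in> borel_measurable borel"
  shows "(\<integral>\<^sup>+ x. h x \<partial>sphere_measure) = (\<integral>\<^sup>+ x. ennreal (annulus_weight x) * h (x /\<^sub>R norm x) \<partial>lborel)"
  unfolding sphere_measure_def by (simp add: nn_integral_distr nn_integral_density)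

lemma finite_measure_sphere_measure: "finite_measure (sphere_measure :: 'a::euclidean_space measure)"
proof
  have "emeasure (sphere_measure :: 'a measure) UNIV = (\<integral>\<^sup>+ x. 1 \<partial>(sphere_measure :: 'a measure))" by simp
  also have "\<dots> = integral\<^sup>N lborel (\<lambda>x::'a. ennreal (annulus_weight x) * 1)"
    by (subst nn_integral_sphere_measure) auto
  also have "\<dots> \<le> integral\<^sup>N lborel (\<lambda>x::'a. indicator (ball 0 (exp 1)) x)"
    by (rule nn_integral_mono) (auto simp: annulus_weight_def indicator_def dist_norm one_le_power divide_le_eq_1)
  also have "\<dots> = emeasure lborel (ball (0::'a) (exp 1))" by simp
  also have "\<dots> < \<infinity>" using emeasure_lborel_ball_finite by (simp add: less_top)
  finally show "emeasure (sphere_measure :: 'a measure) (space sphere_measure) \<noteq> \<infinity>" by simp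
qed

interpretation sphere_measure: finite_measure "sphere_measure :: 'a::euclidean_space measure"
  by (rule finite_measure_sphere_measure)

lemma AE_sphere_measure: "AE x in sphere_measure. norm (x::'a::euclidean_space) = 1"
  unfolding sphere_measure_def
  by (subst AE_distr_iff) (auto simp: AE_density annulus_weight_def intro!: AE_I2 left_inverse)

lemma nn_integral_lborel_scale:
  fixes F :: "'a::euclidean_space \<Rightarrow> ennreal"
  assumes [measurable]: "F \<in> borel_measurable borel" and "c > 0"
  shows "(\<integral>\<^sup>+ x. F x \<partial>lborel) = (\<integral>\<^sup>+ x. ennreal (c ^ DIM('a)) * F (c *\<^sub>R x) \<partial>lborel)"
  using assms(2)
  by (subst lborel_affine[of c 0]) (auto simp: nn_integral_density nn_integral_distr)

lemma nn_integral_lborel_translate: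
  fixes F :: "'a::euclidean_space \<Rightarrow> ennreal"
  assumes [measurable]: "F \<in> borel_measurable borel"
  shows "(\<integral>\<^sup>+ x. F (t + x) \<partial>lborel) = (\<integral>\<^sup>+ x. F x \<partial>lborel)"
  by (subst (2) lborel_affine[of 1 t]) (auto simp: nn_integral_density nn_integral_distr)

text \<open>Instead of a surface measure, \<open>sphere_measure\<close> is the pushforward of a weighted annulus;
  the weight \<open>|x|\<^sup>-\<^sup>n\<close> on \<open>1 < |x| < e\<close> is the one for which dilating over all scales gives total
  mass one on each ray.\<close>

lemma nn_integral_polar:
  fixes H :: "'a::euclidean_space \<Rightarrow> ennreal"
  assumes [measurable]: "H \<in> borel_measurable borel"
  shows "(\<integral>\<^sup>+ x. ennreal (1 / norm x ^ DIM('a)) * H x \<partial>lborel)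
    = (\<integral>\<^sup>+ y. \<integral>\<^sup>+ x. H (exp (- y) *\<^sub>R x) \<partial>sphere_measure \<partial>lborel)"
proof -
  let ?w = "\<lambda>x::'a. ennreal (annulus_weight x)"
  have "(\<integral>\<^sup>+ y. \<integral>\<^sup>+ x. H (exp (- y) *\<^sub>R x) \<partial>sphere_measure \<partial>lborel)
    = (\<integral>\<^sup>+ y. \<integral>\<^sup>+ x. ?w x * H (exp (- y) *\<^sub>R (x /\<^sub>R norm x)) \<partial>lborel \<partial>lborel)"
    by (subst nn_integral_sphere_measure) auto
  also have "\<dots> = (\<integral>\<^sup>+ x. \<integral>\<^sup>+ y. ?w x * H (exp (- y) *\<^sub>R (x /\<^sub>R norm x)) \<partial>lborel \<partial>lborel)"
    by (rule lborel_pair.Fubini') measurable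
  \<comment> \<open>For fixed x a translation of y by \<open>ln (norm x)\<close> absorbs the
    normalisation \<open>x / |x|\<close>.\<close>
  also have "\<dots> = (\<integral>\<^sup>+ x. \<integral>\<^sup>+ y. ?w x * H (exp (- y) *\<^sub>R x) \<partial>lborel \<partial>lborel)"
  proof (rule nn_integral_cong)
    fix x :: 'a
    show "(\<integral>\<^sup>+ y. ?w x * H (exp (- y) *\<^sub>R (x /\<^sub>R norm x)) \<partial>lborel) = (\<integral>\<^sup>+ y. ?w x * H (exp (- y) *\<^sub>R x) \<partial>lborel)"
    proof (cases "1 < norm x")
      case True
      have eq: "exp (- y) *\<^sub>R (x /\<^sub>R norm x) = exp (- (ln (norm x) + y)) *\<^sub>R x" for y
      proof -
        have "0 < norm x" using True by linarith
        hence "exp (ln (norm x)) = norm x" by simp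
        thus ?thesis by (simp add: exp_diff exp_minus divide_inverse exp_add ac_simps)
      qed
      thus ?thesis
        unfolding eq using nn_integral_lborel_translate[of "\<lambda>y. ?w x * H (exp (- y) *\<^sub>R x)" "ln (norm x)"] by simp
    qed (simp add: annulus_weight_def)
  qed
  also have "\<dots> = (\<integral>\<^sup>+ y. \<integral>\<^sup>+ x. ?w x * H (exp (- y) *\<^sub>R x) \<partial>lborel \<partial>lborel)"
    by (rule lborel_pair.Fubini') measurable
  \<comment> \<open>Rescaling x by \<open>exp y\<close> moves the dilation from \<open>H\<close> to
    the annulus weight, after which the y-integral involves the weight alone.\<close>
  also have "\<dots> = (\<integral>\<^sup>+ y. \<integral>\<^sup>+ x. ennreal (exp y ^ DIM('a)) * (?w (exp y *\<^sub>R x) * H x) \<partial>lborel \<partial>lborel)"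
  proof (rule nn_integral_cong)
    fix y :: real
    show "(\<integral>\<^sup>+ x. ?w x * H (exp (- y) *\<^sub>R x) \<partial>lborel)
        = (\<integral>\<^sup>+ x. ennreal (exp y ^ DIM('a)) * (?w (exp y *\<^sub>R x) * H x) \<partial>lborel)"
      by (subst nn_integral_lborel_scale[of _ "exp y"]) (auto simp flip: exp_add)
  qed
  also have "\<dots> = (\<integral>\<^sup>+ x. \<integral>\<^sup>+ y. ennreal (exp y ^ DIM('a)) * (?w (exp y *\<^sub>R x) * H x) \<partial>lborel \<partial>lborel)"
    by (rule lborel_pair.Fubini') measurable
  also have "\<dots> = (\<integral>\<^sup>+ x. ennreal (1 / norm x ^ DIM('a)) * H x \<partial>lborel)"
  proof (rule nn_integral_cong_AE)
    have "AE x::'a in lborel. x \<noteq> 0" by (rule AE_lborel_singleton)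
    thus "AE x::'a in lborel. (\<integral>\<^sup>+ y. ennreal (exp y ^ DIM('a)) * (?w (exp y *\<^sub>R x) * H x) \<partial>lborel)
      = ennreal (1 / norm x ^ DIM('a)) * H x"
    proof eventually_elim
      case (elim x)
      have "ennreal (exp y ^ DIM('a)) * (?w (exp y *\<^sub>R x) * H x)
        = (ennreal (1 / norm x ^ DIM('a)) * H x) * indicator {- ln (norm x)<..<1 - ln (norm x)} y" for y
      proof -
        have "(1 < exp y * norm x \<and> exp y * norm x < exp 1) \<longleftrightarrow> y \<in> {- ln (norm x)<..<1 - ln (norm x)}"
          using elim ln_less_cancel_iff[of 1 "exp y * norm x"] ln_less_cancel_iff[of "exp y * norm x" "exp 1"]
          by (auto simp: ln_mult)
        thus ?thesis using elim
          by (auto simp: annulus_weight_def indicator_def power_mult_distrib mult.assoc[symmetric] simp flip: ennreal_mult)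
      qed
      thus ?case by (simp add: nn_integral_cmult)
    qed
  qed
  finally show ?thesis by simp
qed

text \<open>Averaging over translations \<open>t \<in> [0,1]\<close> along \<open>b\<close> absorbs the shift \<open>c x\<close> into the average.\<close>

lemma nn_integral_lborel_shear:
  fixes F :: "'a::euclidean_space \<Rightarrow> ennreal"
  assumes [measurable]: "F \<in> borel_measurable borel" "c \<in> borel_measurable borel"
    and c: "\<And>x t. c (x + t *\<^sub>R b) = (c x :: real)"
  shows "(\<integral>\<^sup>+ x. F (x + c x *\<^sub>R b) \<partial>lborel) = (\<integral>\<^sup>+ x. F x \<partial>lborel)"
proof -
  define g :: "real \<Rightarrow> ennreal" where "g = indicator {0..1}"
  have [measurable]: "g \<in> borel_measurable borel" unfolding g_def by measurable
  have g1: "(\<integral>\<^sup>+ t. g t \<partial>lborel) = 1" unfolding g_def by simp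
  have gt: "(\<integral>\<^sup>+ t. g (t - a) \<partial>lborel) = 1" for a
    using nn_integral_lborel_translate[of g "-a"] g1 by simp
  have tr: "(\<integral>\<^sup>+ x. G (x + t *\<^sub>R b) \<partial>lborel) = (\<integral>\<^sup>+ x. G x \<partial>lborel)" if [measurable]: "G \<in> borel_measurable borel" for G :: "'a \<Rightarrow> ennreal" and t
    using nn_integral_lborel_translate[of G "t *\<^sub>R b"] by (simp add: add.commute)
  have "(\<integral>\<^sup>+ x. F (x + c x *\<^sub>R b) \<partial>lborel) = (\<integral>\<^sup>+ t. g t * (\<integral>\<^sup>+ x. F (x + c x *\<^sub>R b) \<partial>lborel) \<partial>lborel)"
    by (simp add: nn_integral_multc g1)
  also have "\<dots> = (\<integral>\<^sup>+ t. g t * (\<integral>\<^sup>+ x. F (x + t *\<^sub>R b + c x *\<^sub>R b) \<partial>lborel) \<partial>lborel)"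
  proof -
    have "(\<integral>\<^sup>+ x. F (x + c x *\<^sub>R b) \<partial>lborel) = (\<integral>\<^sup>+ x. F (x + t *\<^sub>R b + c x *\<^sub>R b) \<partial>lborel)" for t
      using tr[of "\<lambda>x. F (x + c x *\<^sub>R b)" t] by (simp add: c)
    thus ?thesis by simp
  qed
  also have "\<dots> = (\<integral>\<^sup>+ t. \<integral>\<^sup>+ x. g t * F (x + (t + c x) *\<^sub>R b) \<partial>lborel \<partial>lborel)"
    by (simp add: nn_integral_cmult scaleR_add_left add.assoc)
  also have "\<dots> = (\<integral>\<^sup>+ x. \<integral>\<^sup>+ t. g t * F (x + (t + c x) *\<^sub>R b) \<partial>lborel \<partial>lborel)"
    by (rule lborel_pair.Fubini') measurable
  also have "\<dots> = (\<integral>\<^sup>+ x. \<integral>\<^sup>+ t. g (t - c x) * F (x + t *\<^sub>R b) \<partial>lborel \<partial>lborel)"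
  proof (rule nn_integral_cong)
    fix x
    show "(\<integral>\<^sup>+ t. g t * F (x + (t + c x) *\<^sub>R b) \<partial>lborel) = (\<integral>\<^sup>+ t. g (t - c x) * F (x + t *\<^sub>R b) \<partial>lborel)"
      using nn_integral_lborel_translate[of "\<lambda>t. g (t - c x) * F (x + t *\<^sub>R b)" "c x"] by (simp add: add.commute)
  qed
  also have "\<dots> = (\<integral>\<^sup>+ t. \<integral>\<^sup>+ x. g (t - c x) * F (x + t *\<^sub>R b) \<partial>lborel \<partial>lborel)"
    by (rule lborel_pair.Fubini') measurable
  also have "\<dots> = (\<integral>\<^sup>+ t. \<integral>\<^sup>+ x. g (t - c x) * F x \<partial>lborel \<partial>lborel)"
    by (rule nn_integral_cong, subst (2) tr[symmetric, of _ t for t]) (auto simp: c)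
  also have "\<dots> = (\<integral>\<^sup>+ x. \<integral>\<^sup>+ t. g (t - c x) * F x \<partial>lborel \<partial>lborel)"
    by (rule lborel_pair.Fubini') measurable
  also have "\<dots> = (\<integral>\<^sup>+ x. F x \<partial>lborel)"
    by (simp add: nn_integral_multc gt)
  finally show ?thesis .
qed


text \<open>Rotation by the angle \<open>2 arctan a\<close> in the plane of \<open>b\<close> and
  \<open>c\<close>, in the rational parametrisation \<open>cos = (1 - a^2) / (1 + a^2)\<close>,
  \<open>sin = 2 a / (1 + a^2)\<close>. It omits the angle pi, but rotations near
  \<open>a = 0\<close> suffice to differentiate.\<close>

definition plane_rotation :: "'a \<Rightarrow> 'a \<Rightarrow> real \<Rightarrow> 'a \<Rightarrow> 'a::euclidean_space" where
  "plane_rotation b c a x = x + ((- 2 * a\<^sup>2 * (x \<bullet> b) - 2 * a * (x \<bullet> c)) / (1 + a\<^sup>2)) *\<^sub>R b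
     + ((2 * a * (x \<bullet> b) - 2 * a\<^sup>2 * (x \<bullet> c)) / (1 + a\<^sup>2)) *\<^sub>R c"

lemma one_plus_square_nonzero: "1 + a\<^sup>2 \<noteq> (0::real)"
  by (smt (verit) zero_le_power2)

text \<open>A rotation by \<theta> is a product of three shears with slopes
  \<open>- tan (\<theta> / 2)\<close>, \<open>sin \<theta>\<close> and
  \<open>- tan (\<theta> / 2)\<close>, here \<open>- a\<close>, \<open>s\<close> and
  \<open>- a\<close>; each shear along a coordinate direction preserves Lebesgue measure.\<close>

lemma nn_integral_plane_rotation:
  fixes F :: "'a::euclidean_space \<Rightarrow> ennreal"
  assumes [measurable]: "F \<in> borel_measurable borel" and bc: "b \<in> Basis" "c \<in> Basis" "b \<noteq> c"
  shows "(\<integral>\<^sup>+ x. F (plane_rotation b c a x) \<partial>lborel) = (\<integral>\<^sup>+ x. F x \<partial>lborel)"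
proof -
  define s where "s = 2 * a / (1 + a\<^sup>2)"
  define S1 where "S1 x = x + (- a * (x \<bullet> c)) *\<^sub>R b" for x
  define S2 where "S2 x = x + (s * (x \<bullet> b)) *\<^sub>R c" for x
  have [measurable]: "S1 \<in> borel_measurable borel" "S2 \<in> borel_measurable borel"
    unfolding S1_def[abs_def] S2_def[abs_def] by measurable
  have ip: "b \<bullet> b = 1" "c \<bullet> c = 1" "b \<bullet> c = 0" "c \<bullet> b = 0" using bc by (auto simp: inner_Basis)
  have 1: "(\<integral>\<^sup>+ x. G (S1 x) \<partial>lborel) = (\<integral>\<^sup>+ x. G x \<partial>lborel)"
    and 2: "(\<integral>\<^sup>+ x. G (S2 x) \<partial>lborel) = (\<integral>\<^sup>+ x. G x \<partial>lborel)"
    if [measurable]: "G \<in> borel_measurable borel" for G :: "'a \<Rightarrow> ennreal"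
    unfolding S1_def S2_def by (rule nn_integral_lborel_shear; simp add: inner_left_distrib ip)+
  have "plane_rotation b c a x = S1 (S2 (S1 x))" for x
  proof -
    have e1: "S1 x \<bullet> b = x \<bullet> b - a * (x \<bullet> c)" "S1 x \<bullet> c = x \<bullet> c"
      unfolding S1_def by (auto simp: inner_left_distrib inner_diff_left ip)
    have e2: "S2 (S1 x) = x + (- a * (x \<bullet> c)) *\<^sub>R b + (s * (x \<bullet> b - a * (x \<bullet> c))) *\<^sub>R c"
      unfolding S2_def e1 by (simp add: S1_def)
    have e3: "S2 (S1 x) \<bullet> c = x \<bullet> c + s * (x \<bullet> b - a * (x \<bullet> c))"
      unfolding e2 by (simp add: inner_left_distrib inner_diff_left ip)
    have "S1 (S2 (S1 x)) = S2 (S1 x) + (- a * (x \<bullet> c + s * (x \<bullet> b - a * (x \<bullet> c)))) *\<^sub>R b"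
      unfolding S1_def[of "S2 (S1 x)"] e3 ..
    also have "\<dots> = x + (- a * (x \<bullet> c) - a * (x \<bullet> c + s * (x \<bullet> b - a * (x \<bullet> c)))) *\<^sub>R b + (s * (x \<bullet> b - a * (x \<bullet> c))) *\<^sub>R c"
      unfolding e2 by (simp add: scaleR_left_diff_distrib)
    finally have "S1 (S2 (S1 x)) = x + (- a * (x \<bullet> c) - a * (x \<bullet> c + s * (x \<bullet> b - a * (x \<bullet> c)))) *\<^sub>R b + (s * (x \<bullet> b - a * (x \<bullet> c))) *\<^sub>R c" .
    moreover have "- a * (x \<bullet> c) - a * (x \<bullet> c + s * (x \<bullet> b - a * (x \<bullet> c))) = (- 2 * a\<^sup>2 * (x \<bullet> b) - 2 * a * (x \<bullet> c)) / (1 + a\<^sup>2)"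
      "s * (x \<bullet> b - a * (x \<bullet> c)) = (2 * a * (x \<bullet> b) - 2 * a\<^sup>2 * (x \<bullet> c)) / (1 + a\<^sup>2)"
      unfolding s_def using one_plus_square_nonzero[of a] by (simp_all add: field_simps power2_eq_square)
    ultimately show ?thesis unfolding plane_rotation_def by simp
  qed
  thus ?thesis using 1[of F] 2[of "\<lambda>x. F (S1 x)"] 1[of "\<lambda>x. F (S1 (S2 x))"] by simp
qed

lemma plane_rotation_measurable [measurable]: "plane_rotation b c a \<in> borel_measurable borel"
  unfolding plane_rotation_def[abs_def] by measurable

lemma norm_plane_rotation:
  assumes bc: "b \<in> Basis" "c \<in> Basis" "b \<noteq> c"
  shows "norm (plane_rotation b c a x) = norm x"
proof -
  have ip: "b \<bullet> b = 1" "c \<bullet> c = 1" "b \<bullet> c = 0" "c \<bullet> b = 0" using bc by (auto simp: inner_Basis)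
  define u where "u = x \<bullet> b"
  define w where "w = x \<bullet> c"
  define D where "D = 1 + a\<^sup>2"
  have D: "D \<noteq> 0" unfolding D_def by (rule one_plus_square_nonzero)
  define p where "p = (- 2 * a\<^sup>2 * u - 2 * a * w) / D"
  define q where "q = (2 * a * u - 2 * a\<^sup>2 * w) / D"
  have "plane_rotation b c a x \<bullet> plane_rotation b c a x = x \<bullet> x + (2 * p * u + p * p + 2 * q * w + q * q)"
    unfolding plane_rotation_def u_def[symmetric] w_def[symmetric] D_def[symmetric] p_def[symmetric] q_def[symmetric]
    by (simp add: inner_left_distrib inner_right_distrib ip u_def w_def inner_commute algebra_simps)
  also have "2 * p * u + p * p + 2 * q * w + q * q = 0"
  proof -
    have p: "p * D = - 2 * a\<^sup>2 * u - 2 * a * w" and q: "q * D = 2 * a * u - 2 * a\<^sup>2 * w"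
      unfolding p_def q_def using D by auto
    have "(2 * p * u + p * p + 2 * q * w + q * q) * D\<^sup>2 = 2 * (p * D) * u * D + (p * D) * (p * D) + 2 * (q * D) * w * D + (q * D) * (q * D)"
      by (simp add: algebra_simps power2_eq_square)
    also have "\<dots> = 0" unfolding p q unfolding D_def by algebra
    finally show ?thesis using D by simp
  qed
  finally show ?thesis by (simp add: norm_eq_sqrt_inner)
qed

text \<open>A rotation is linear and keeps the norm, so it commutes with \<open>x / |x|\<close> and
  leaves the annulus weight unchanged; invariance is inherited from Lebesgue measure.\<close>

lemma nn_integral_sphere_rotation:
  fixes h :: "'a::euclidean_space \<Rightarrow> ennreal"
  assumes [measurable]: "h \<in> borel_measurable borel" and bc: "b \<in> Basis" "c \<in> Basis" "b \<noteq> c"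
  shows "(\<integral>\<^sup>+ x. h (plane_rotation b c a x) \<partial>sphere_measure) = (\<integral>\<^sup>+ x. h x \<partial>sphere_measure)"
proof -
  let ?T = "plane_rotation b c a"
  have lin: "?T (r *\<^sub>R x) = r *\<^sub>R ?T x" for r x
    unfolding plane_rotation_def by (simp add: algebra_simps diff_divide_distrib add_divide_distrib)
  have "(\<integral>\<^sup>+ x. h (?T x) \<partial>sphere_measure) = (\<integral>\<^sup>+ x. ennreal (annulus_weight (?T x)) * h (?T x /\<^sub>R norm (?T x)) \<partial>lborel)"
  proof -
    have "annulus_weight (?T x) = annulus_weight x" for x
      unfolding annulus_weight_def norm_plane_rotation[OF bc] ..
    thus ?thesis by (subst nn_integral_sphere_measure) (auto simp: lin norm_plane_rotation[OF bc])
  qed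
  also have "\<dots> = (\<integral>\<^sup>+ x. h x \<partial>sphere_measure)"
    by (subst nn_integral_plane_rotation[OF _ bc, of "\<lambda>x. ennreal (annulus_weight x) * h (x /\<^sub>R norm x)"])
       (auto simp: nn_integral_sphere_measure)
  finally show ?thesis .
qed

lemma distr_sphere_rotation:
  assumes bc: "b \<in> Basis" "c \<in> Basis" "b \<noteq> c"
  shows "distr sphere_measure borel (plane_rotation b c a) = (sphere_measure :: 'a::euclidean_space measure)"
proof (rule measure_eqI)
  fix A :: "'a set" assume "A \<in> sets (distr sphere_measure borel (plane_rotation b c a))"
  hence A [measurable]: "A \<in> sets borel" by simp
  have "emeasure (distr sphere_measure borel (plane_rotation b c a)) A = (\<integral>\<^sup>+ x. indicator A x \<partial>distr sphere_measure borel (plane_rotation b c a))"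
    by simp
  also have "\<dots> = (\<integral>\<^sup>+ x. indicator A (plane_rotation b c a x) \<partial>sphere_measure)"
    by (subst nn_integral_distr) auto
  also have "\<dots> = (\<integral>\<^sup>+ x. indicator A x \<partial>sphere_measure)" by (rule nn_integral_sphere_rotation[OF _ bc]) simp
  finally show "emeasure (distr sphere_measure borel (plane_rotation b c a)) A = emeasure sphere_measure A" by simp
qed simp

lemma integral_sphere_rotation:
  fixes h :: "'a::euclidean_space \<Rightarrow> real"
  assumes [measurable]: "h \<in> borel_measurable borel" and bc: "b \<in> Basis" "c \<in> Basis" "b \<noteq> c"
  shows "(\<integral> x. h (plane_rotation b c a x) \<partial>sphere_measure) = (\<integral> x. h x \<partial>sphere_measure)"
  using integral_distr[of "plane_rotation b c a" "sphere_measure" borel h] distr_sphere_rotation[OF bc] by simp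

section \<open>Sphere integrals depending on a parameter\<close>

lemma AE_sphere_bounded:
  fixes h :: "'a::euclidean_space \<Rightarrow> real"
  assumes "\<And>x. norm x = 1 \<Longrightarrow> \<bar>h x\<bar> \<le> C"
  shows "AE x in sphere_measure. \<bar>h x\<bar> \<le> C"
  using AE_sphere_measure by eventually_elim (rule assms)

lemma integrable_sphere_continuous:
  fixes h :: "'a::euclidean_space \<Rightarrow> real"
  assumes "continuous_on UNIV h"
  shows "integrable sphere_measure h"
proof -
  have "compact (h ` sphere 0 1)" by (rule compact_continuous_image) (use assms continuous_on_subset in auto)
  then obtain C where C0: "\<forall>v\<in>h ` sphere 0 1. norm v \<le> C"
    by (auto dest!: compact_imp_bounded simp: bounded_iff)
  have C: "\<bar>h x\<bar> \<le> C" if "norm x = 1" for x using bspec[OF C0, of "h x"] that by simp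
  have m: "h \<in> borel_measurable sphere_measure" using borel_measurable_continuous_onI[OF assms] by measurable
  show ?thesis
    by (rule sphere_measure.integrable_const_bound[where B = C, OF _ m]) (use AE_sphere_bounded[of h C] C in simp)
qed

lemma sphere_integral_mono:
  fixes g h :: "'a::euclidean_space \<Rightarrow> real"
  assumes "continuous_on UNIV g" "continuous_on UNIV h" "\<And>x. norm x = 1 \<Longrightarrow> g x \<le> h x"
  shows "(\<integral> x. g x \<partial>sphere_measure) \<le> (\<integral> x. h x \<partial>sphere_measure)"
  by (rule integral_mono_AE[OF integrable_sphere_continuous[OF assms(1)] integrable_sphere_continuous[OF assms(2)]])
     (use AE_sphere_measure in eventually_elim, rule assms)

lemma sphere_integral_cong:
  fixes g h :: "'a::euclidean_space \<Rightarrow> real"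
  assumes "continuous_on UNIV g" "continuous_on UNIV h" "\<And>x. norm x = 1 \<Longrightarrow> g x = h x"
  shows "(\<integral> x. g x \<partial>sphere_measure) = (\<integral> x. h x \<partial>sphere_measure)"
  by (intro antisym sphere_integral_mono) (use assms in auto)

lemma continuous_on_section:
  assumes "continuous_on UNIV (\<lambda>(z, x). F z x)"
  shows "continuous_on UNIV (F z)"
proof -
  have "continuous_on UNIV ((\<lambda>(z, x). F z x) \<circ> (\<lambda>x. (z, x)))"
    by (rule continuous_on_compose) (auto intro!: continuous_intros continuous_on_subset[OF assms])
  thus ?thesis by (simp add: o_def)
qed

lemma continuous_on_sphere_integral:
  fixes F :: "'z::euclidean_space \<Rightarrow> 'a::euclidean_space \<Rightarrow> real"
  assumes F: "continuous_on UNIV (\<lambda>(z, x). F z x)"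
  shows "continuous_on UNIV (\<lambda>z. \<integral> x. F z x \<partial>sphere_measure)"
proof (subst continuous_on_sequentially, clarify)
  fix u :: "nat \<Rightarrow> 'z" and z
  assume u: "u \<longlonglongrightarrow> z"
  \<comment> \<open>A convergent sequence together with its limit is compact, which gives one bound
    for the integrands along the whole sequence.\<close>
  have K: "compact (insert z (range u))" using u by (rule compact_sequence_with_limit)
  have "compact ((\<lambda>(z, x). F z x) ` (insert z (range u) \<times> sphere 0 1))"
    by (intro compact_continuous_image continuous_on_subset[OF F] compact_Times K) auto
  then obtain C where C0: "\<forall>v\<in>(\<lambda>(z, x). F z x) ` (insert z (range u) \<times> sphere 0 1). norm v \<le> C"
    by (auto dest!: compact_imp_bounded simp: bounded_iff)
  have mem: "F (u n) x \<in> (\<lambda>(z, x). F z x) ` (insert z (range u) \<times> sphere 0 1)" if "norm x = 1" for n x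
    by (rule image_eqI[of _ _ "(u n, x)"]) (use that in auto)
  have C: "\<bar>F (u n) x\<bar> \<le> C" if "norm x = 1" for n x using bspec[OF C0 mem[OF that]] by simp
  have m: "F z \<in> borel_measurable sphere_measure" for z
    using borel_measurable_continuous_onI[OF continuous_on_section[OF F]] by measurable
  show "((\<lambda>z. \<integral> x. F z x \<partial>sphere_measure) \<circ> u) \<longlonglongrightarrow> (\<integral> x. F z x \<partial>sphere_measure)"
    unfolding o_def
  proof (rule integral_dominated_convergence[where w = "\<lambda>_. C"])
    show "AE x in sphere_measure. (\<lambda>n. F (u n) x) \<longlonglongrightarrow> F z x"
    proof (rule AE_I2)
      fix x
      have "(\<lambda>n. (\<lambda>(z, x). F z x) (u n, x)) \<longlonglongrightarrow> (\<lambda>(z, x). F z x) (z, x)"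
        by (rule continuous_on_tendsto_compose[OF F]) (auto intro!: tendsto_intros u)
      thus "(\<lambda>n. F (u n) x) \<longlonglongrightarrow> F z x" by simp
    qed
    show "AE x in sphere_measure. norm (F (u n) x) \<le> C" for n
      using AE_sphere_bounded[of "F (u n)" C] C by simp
  qed (use m in auto)
qed

text \<open>Dominated convergence along null sequences: by the mean value theorem the difference
  quotients are bounded by the maximum of \<open>F'\<close> over a compact set, and constants are
  integrable for a finite measure.\<close>

lemma DERIV_sphere_integral:
  fixes F F' :: "real \<Rightarrow> 'a::euclidean_space \<Rightarrow> real"
  assumes F: "\<And>y. continuous_on UNIV (F y)" and F': "continuous_on UNIV (\<lambda>(y, x). F' y x)"
    and d: "\<And>y x. ((\<lambda>y. F y x) has_real_derivative F' y x) (at y)"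
  shows "((\<lambda>y. \<integral> x. F y x \<partial>sphere_measure) has_real_derivative (\<integral> x. F' y x \<partial>sphere_measure)) (at y)"
  unfolding DERIV_def
proof (subst tendsto_at_iff_sequentially, intro allI impI)
  fix h :: "nat \<Rightarrow> real"
  assume hn: "\<forall>i. h i \<in> UNIV - {0}" and h: "h \<longlonglongrightarrow> 0"
  have "Bseq h" using h by (rule convergent_imp_Bseq[OF convergentI])
  then obtain H where H: "\<And>n. \<bar>h n\<bar> \<le> H" "0 < H" unfolding Bseq_def by auto
  have "compact ((\<lambda>(z, x). F' z x) ` ({y - H..y + H} \<times> sphere 0 1))"
    by (intro compact_continuous_image continuous_on_subset[OF F'] compact_Times) auto
  then obtain C where C0: "\<forall>v\<in>(\<lambda>(z, x). F' z x) ` ({y - H..y + H} \<times> sphere 0 1). norm v \<le> C"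
    by (auto dest!: compact_imp_bounded simp: bounded_iff)
  have mem: "F' z x \<in> (\<lambda>(z, x). F' z x) ` ({y - H..y + H} \<times> sphere 0 1)" if "\<bar>z - y\<bar> \<le> H" "norm x = 1" for z x
    by (rule image_eqI[of _ _ "(z, x)"]) (use that in \<open>auto simp: abs_le_iff\<close>)
  have C: "\<bar>F' z x\<bar> \<le> C" if "\<bar>z - y\<bar> \<le> H" "norm x = 1" for z x using bspec[OF C0 mem[OF that]] by simp
  define q where "q n x = (F (y + h n) x - F y x) / h n" for n x
  have m: "F y \<in> borel_measurable sphere_measure" for y
    using borel_measurable_continuous_onI[OF F] by measurable
  have m': "F' y \<in> borel_measurable sphere_measure"
    using borel_measurable_continuous_onI[OF continuous_on_section[OF F']] by measurable
  have q: "\<bar>q n x\<bar> \<le> C" if "norm x = 1" for n x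
  proof -
    have "norm (F (y + h n) x - F y x) \<le> C * norm (y + h n - y)"
    proof (rule field_differentiable_bound[of "cball y H" "\<lambda>y. F y x" "\<lambda>y. F' y x"])
      show "norm (F' z x) \<le> C" if "z \<in> cball y H" for z
        using C[of z x] that \<open>norm x = 1\<close> by (auto simp: dist_real_def abs_minus_commute)
      show "((\<lambda>y. F y x) has_field_derivative F' z x) (at z within cball y H)" for z
        by (rule has_field_derivative_at_within[OF d])
      show "y + h n \<in> cball y H" using H(1)[of n] by (simp add: dist_real_def)
    qed (use H(2) in simp_all)
    moreover have "h n \<noteq> 0" using hn by simp
    ultimately show ?thesis unfolding q_def by (simp add: divide_le_eq abs_divide)
  qed
  have "(\<lambda>n. \<integral> x. q n x \<partial>sphere_measure) \<longlonglongrightarrow> (\<integral> x. F' y x \<partial>sphere_measure)"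
  proof (rule integral_dominated_convergence[where w = "\<lambda>_. C"])
    show "AE x in sphere_measure. (\<lambda>n. q n x) \<longlonglongrightarrow> F' y x"
    proof (rule AE_I2)
      fix x
      show "(\<lambda>n. q n x) \<longlonglongrightarrow> F' y x"
        using d[of x y] hn h unfolding DERIV_def tendsto_at_iff_sequentially q_def by (auto simp: o_def)
    qed
    show "AE x in sphere_measure. norm (q n x) \<le> C" for n
      using AE_sphere_bounded[of "q n" C] q by simp
  qed (use m m' in \<open>auto simp: q_def[abs_def]\<close>)
  moreover have "(\<integral> x. q n x \<partial>sphere_measure) = ((\<integral> x. F (y + h n) x \<partial>sphere_measure) - (\<integral> x. F y x \<partial>sphere_measure)) / h n" for n
    unfolding q_def by (simp add: integrable_sphere_continuous F)
  ultimately show "((\<lambda>h. ((\<integral> x. F (y + h) x \<partial>sphere_measure) - (\<integral> x. F y x \<partial>sphere_measure)) / h) \<circ> h) \<longlonglongrightarrow> (\<integral> x. F' y x \<partial>sphere_measure)"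
    by (simp add: o_def)
qed

text \<open>By rotation invariance the integral of \<open>g\<close> composed with the rotations does
  not depend on \<open>a\<close>; its derivative at \<open>a = 0\<close> is twice the stated
  integral, because the angle \<open>2 arctan a\<close> grows at rate 2.\<close>

lemma integral_sphere_angular_derivative:
  fixes g :: "'a::euclidean_space \<Rightarrow> real"
  assumes bc: "b \<in> Basis" "c \<in> Basis" "b \<noteq> c"
    and g: "\<And>x. (g has_derivative g' x) (at x)"
    and cont: "continuous_on UNIV (\<lambda>x. g' x b)" "continuous_on UNIV (\<lambda>x. g' x c)"
  shows "(\<integral> x. (x \<bullet> b) * g' x c - (x \<bullet> c) * g' x b \<partial>sphere_measure) = 0"
proof -
  define p where "p a x = (- 2 * a\<^sup>2 * (x \<bullet> b) - 2 * a * (x \<bullet> c)) / (1 + a\<^sup>2)" for a and x :: 'a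
  define q where "q a x = (2 * a * (x \<bullet> b) - 2 * a\<^sup>2 * (x \<bullet> c)) / (1 + a\<^sup>2)" for a and x :: 'a
  define p' where "p' a x = ((- 4 * a * (x \<bullet> b) - 2 * (x \<bullet> c)) * (1 + a\<^sup>2) - (- 2 * a\<^sup>2 * (x \<bullet> b) - 2 * a * (x \<bullet> c)) * (2 * a)) / (1 + a\<^sup>2)\<^sup>2" for a and x :: 'a
  define q' where "q' a x = ((2 * (x \<bullet> b) - 4 * a * (x \<bullet> c)) * (1 + a\<^sup>2) - (2 * a * (x \<bullet> b) - 2 * a\<^sup>2 * (x \<bullet> c)) * (2 * a)) / (1 + a\<^sup>2)\<^sup>2" for a and x :: 'a
  let ?T = "plane_rotation b c"
  have T: "?T a x = x + p a x *\<^sub>R b + q a x *\<^sub>R c" for a x unfolding plane_rotation_def p_def q_def ..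
  have dd: "((\<lambda>a. 1 + a\<^sup>2) has_real_derivative 2 * a) (at a)" for a :: real
    by (auto intro!: derivative_eq_intros)
  have np: "((\<lambda>a. - 2 * a\<^sup>2 * u - 2 * a * w) has_real_derivative - 4 * a * u - 2 * w) (at a)"
    and nq: "((\<lambda>a. 2 * a * u - 2 * a\<^sup>2 * w) has_real_derivative 2 * u - 4 * a * w) (at a)" for a u w :: real
    by (auto intro!: derivative_eq_intros)
  have dp: "((\<lambda>a. p a x) has_real_derivative p' a x) (at a)" for a x
    unfolding p_def p'_def
    by (rule DERIV_cong[OF DERIV_divide[OF np dd one_plus_square_nonzero]]) (simp only: power2_eq_square)
  have dq: "((\<lambda>a. q a x) has_real_derivative q' a x) (at a)" for a x
    unfolding q_def q'_def
    by (rule DERIV_cong[OF DERIV_divide[OF nq dd one_plus_square_nonzero]]) (simp only: power2_eq_square)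
  have gc: "continuous_on UNIV g"
    by (rule continuous_at_imp_continuous_on) (use has_derivative_continuous[OF g] in auto)
  define F' where "F' a x = p' a x * g' (?T a x) b + q' a x * g' (?T a x) c" for a x
  have dF: "((\<lambda>a. g (?T a x)) has_real_derivative F' a x) (at a)" for a x
  proof -
    have "((\<lambda>a. x + p a x *\<^sub>R b + q a x *\<^sub>R c) has_derivative (\<lambda>h. 0 + (p' a x * h) *\<^sub>R b + (q' a x * h) *\<^sub>R c)) (at a)"
      by (intro has_derivative_add has_derivative_const has_derivative_scaleR_left
           dp[unfolded has_field_derivative_def] dq[unfolded has_field_derivative_def])
    from diff_chain_at[OF this[folded T] g]
    have "((\<lambda>a. g (?T a x)) has_derivative (\<lambda>h. g' (?T a x) (0 + (p' a x * h) *\<^sub>R b + (q' a x * h) *\<^sub>R c))) (at a)"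
      by (simp only: o_def)
    moreover have "g' (?T a x) (0 + (p' a x * h) *\<^sub>R b + (q' a x * h) *\<^sub>R c) = F' a x * h" for h
    proof -
      interpret bounded_linear "g' (?T a x)" by (rule has_derivative_bounded_linear[OF g])
      show ?thesis unfolding F'_def by (simp add: scaleR add distrib_right)
    qed
    ultimately show ?thesis unfolding has_field_derivative_def by simp
  qed
  have cT: "continuous_on UNIV (\<lambda>z. ?T (fst z) (snd z))"
    unfolding plane_rotation_def by (auto intro!: continuous_intros simp: one_plus_square_nonzero)
  have cF': "continuous_on UNIV (\<lambda>(a, x). F' a x)"
  proof -
    have "continuous_on UNIV (\<lambda>z. p' (fst z) (snd z))" "continuous_on UNIV (\<lambda>z. q' (fst z) (snd z))"
      unfolding p'_def q'_def by (auto intro!: continuous_intros simp: one_plus_square_nonzero)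
    moreover have "continuous_on UNIV (\<lambda>z. g' (?T (fst z) (snd z)) b)" "continuous_on UNIV (\<lambda>z. g' (?T (fst z) (snd z)) c)"
      by (rule continuous_on_compose2[OF cont(1) cT], simp, rule continuous_on_compose2[OF cont(2) cT], simp)
    ultimately show ?thesis unfolding F'_def case_prod_unfold by (intro continuous_intros)
  qed
  have cF: "continuous_on UNIV (\<lambda>x. g (?T a x))" for a
    using continuous_on_compose2[OF gc continuous_on_section[of "\<lambda>a x. ?T a x" a]] cT by (simp add: case_prod_unfold)
  have "((\<lambda>a. \<integral> x. g (?T a x) \<partial>sphere_measure) has_real_derivative (\<integral> x. F' 0 x \<partial>sphere_measure)) (at 0)"
    by (rule DERIV_sphere_integral[OF cF cF' dF])
  moreover have "(\<lambda>a. \<integral> x. g (?T a x) \<partial>sphere_measure) = (\<lambda>a. \<integral> x. g x \<partial>sphere_measure)"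
    using integral_sphere_rotation[OF borel_measurable_continuous_onI[OF gc] bc] by auto
  ultimately have "(\<integral> x. F' 0 x \<partial>sphere_measure) = 0" using DERIV_const DERIV_unique by metis
  moreover have "F' 0 = (\<lambda>x. 2 * ((x \<bullet> b) * g' x c - (x \<bullet> c) * g' x b))"
    unfolding F'_def p'_def q'_def plane_rotation_def by (simp add: algebra_simps)
  ultimately have "(\<integral> x. 2 * ((x \<bullet> b) * g' x c - (x \<bullet> c) * g' x b) \<partial>sphere_measure) = 0" by simp
  thus ?thesis by (subst (asm) integral_mult_right_zero) simp
qed

subsection \<open>Smooth functions and angular derivatives\<close>

lemma partial_eq:
  assumes "(f has_derivative f') (at x)"
  shows "partial i f x = f' (axis i 1)"
proof -
  have "((\<lambda>h. x + h *\<^sub>R axis i 1) has_derivative (\<lambda>h. h *\<^sub>R axis i 1)) (at 0)"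
    by (auto intro!: derivative_eq_intros)
  moreover have "(f has_derivative f') (at (x + 0 *\<^sub>R axis i 1))" using assms by simp
  ultimately have "((\<lambda>h. f (x + h *\<^sub>R axis i 1)) has_derivative (\<lambda>h. f' (h *\<^sub>R axis i 1))) (at 0)"
    using diff_chain_at[of "\<lambda>h. x + h *\<^sub>R axis i 1" _ 0 f f'] by (simp add: o_def)
  moreover have "f' (h *\<^sub>R axis i 1) = f' (axis i 1) * h" for h
    using linear_simps(5)[OF has_derivative_bounded_linear[OF assms]] by simp
  ultimately have "((\<lambda>h. f (x + h *\<^sub>R axis i 1)) has_real_derivative f' (axis i 1)) (at 0)"
    by (simp add: has_field_derivative_def)
  thus ?thesis unfolding partial_def by (rule DERIV_imp_deriv)
qed

lemma has_derivative_partial: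
  fixes f :: "real ^ 'n \<Rightarrow> real"
  assumes "f differentiable (at x)"
  shows "(f has_derivative (\<lambda>h. \<Sum>i\<in>UNIV. h $ i * partial i f x)) (at x)"
proof -
  obtain f' where f': "(f has_derivative f') (at x)" using assms unfolding differentiable_def by blast
  have "f' h = (\<Sum>i\<in>UNIV. h $ i * partial i f x)" for h
  proof -
    have lin: "linear f'" using has_derivative_linear[OF f'] .
    have "f' h = f' (\<Sum>i\<in>UNIV. h $ i *\<^sub>R axis i 1)"
      using basis_expansion[of h] by (simp add: scalar_mult_eq_scaleR)
    also have "\<dots> = (\<Sum>i\<in>UNIV. h $ i * partial i f x)"
      unfolding linear_sum[OF lin] partial_eq[OF f'] by (simp add: linear_cmul[OF lin])
    finally show ?thesis .
  qed
  hence "f' = (\<lambda>h. \<Sum>i\<in>UNIV. h $ i * partial i f x)" by blast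
  thus ?thesis using f' by simp
qed

lemma smooth_differentiable:
  assumes "smooth f"
  shows "f differentiable (at x)"
proof -
  have "partials [] f differentiable_on UNIV" using assms unfolding smooth_def by blast
  thus ?thesis by (simp add: differentiable_on_def)
qed

lemma partials_append: "partials (is @ js) f = partials is (partials js f)"
  by (induction "is") auto

lemma smooth_partial:
  assumes "smooth f"
  shows "smooth (partial i f)"
  unfolding smooth_def
proof
  fix "is"
  have "partials (is @ [i]) f differentiable_on UNIV" using assms unfolding smooth_def by blast
  thus "partials is (partial i f) differentiable_on UNIV" by (simp add: partials_append)
qed

lemma smooth_has_derivative:
  "smooth f \<Longrightarrow> (f has_derivative (\<lambda>h. \<Sum>i\<in>UNIV. h $ i * partial i f x)) (at x)"
  by (rule has_derivative_partial[OF smooth_differentiable])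

lemma smooth_continuous: "smooth f \<Longrightarrow> continuous_on S f"
  by (meson continuous_at_imp_continuous_on smooth_has_derivative has_derivative_continuous)

text \<open>\<open>smooth\<close> describes the largest class of differentiable functions that is
  closed under \<open>partial\<close>, hence a coinduction principle: any such class consists of
  smooth functions.\<close>

lemma smooth_coinduct:
  assumes "Z f" "\<And>g x. Z g \<Longrightarrow> g differentiable (at x)" "\<And>g i. Z g \<Longrightarrow> Z (partial i g)"
  shows "smooth f"
proof -
  have "Z (partials is f)" for "is" by (induction "is") (use assms in auto)
  thus ?thesis unfolding smooth_def differentiable_on_def using assms(2) by simp
qed

lemma partial_add:
  assumes "f differentiable (at x)" "g differentiable (at x)"
  shows "partial i (\<lambda>x. f x + g x) x = partial i f x + partial i g x"
proof -
  obtain f' g' where d: "(f has_derivative f') (at x)" "(g has_derivative g') (at x)"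
    using assms unfolding differentiable_def by blast
  show ?thesis using partial_eq[OF has_derivative_add[OF d]] partial_eq[OF d(1)] partial_eq[OF d(2)] by simp
qed

lemma partial_mult:
  fixes f g :: "real ^ 'n \<Rightarrow> real"
  assumes "f differentiable (at x)" "g differentiable (at x)"
  shows "partial i (\<lambda>x. f x * g x) x = f x * partial i g x + partial i f x * g x"
proof -
  obtain f' g' where d: "(f has_derivative f') (at x)" "(g has_derivative g') (at x)"
    using assms unfolding differentiable_def by blast
  show ?thesis using partial_eq[OF has_derivative_mult[OF d]] partial_eq[OF d(1)] partial_eq[OF d(2)] by simp
qed

lemma partial_const [simp]: "partial i (\<lambda>_. c) x = 0"
  by (rule partial_eq[of _ "\<lambda>_. 0", simplified]) simp

lemma partial_coord: "partial i (\<lambda>x::real^'n::finite. x $ j) x = (if i = j then 1 else 0)"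
proof -
  have "((\<lambda>x::real^'n. x $ j) has_derivative (\<lambda>x. x $ j)) (at x)"
    by (rule bounded_linear.has_derivative[OF bounded_linear_vec_nth has_derivative_ident])
  from partial_eq[OF this] show ?thesis by (simp add: axis_def)
qed

text \<open>Products alone are not stable under \<open>partial\<close>, because the product rule
  produces sums. The algebra generated by the smooth functions is stable and serves as the invariant
  class for \<open>smooth_coinduct\<close>.\<close>

inductive smooth_alg :: "(real ^ 'n::finite \<Rightarrow> real) \<Rightarrow> bool" where
  "smooth f \<Longrightarrow> smooth_alg f"
| "smooth_alg f \<Longrightarrow> smooth_alg g \<Longrightarrow> smooth_alg (\<lambda>x. f x + g x)"
| "smooth_alg f \<Longrightarrow> smooth_alg g \<Longrightarrow> smooth_alg (\<lambda>x. f x * g x)"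

lemma smooth_alg_smooth:
  assumes "smooth_alg f"
  shows "smooth f"
proof -
  have d: "smooth_alg g \<Longrightarrow> g differentiable (at x)" for g :: "real ^ 'n \<Rightarrow> real" and x
    by (induction rule: smooth_alg.induct) (auto intro: smooth_differentiable)
  show ?thesis
  proof (rule smooth_coinduct[of smooth_alg, OF assms d])
    fix g i assume "smooth_alg (g :: real ^ 'n \<Rightarrow> real)"
    thus "smooth_alg (partial i g)"
    proof (induction rule: smooth_alg.induct)
      case (2 f g)
      have "partial i (\<lambda>x. f x + g x) = (\<lambda>x. partial i f x + partial i g x)"
        using 2 d by (intro ext partial_add) auto
      thus ?case using 2 by (simp add: smooth_alg.intros)
    next
      case (3 f g)
      have "partial i (\<lambda>x. f x * g x) = (\<lambda>x. f x * partial i g x + partial i f x * g x)"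
        using 3 d by (intro ext partial_mult) auto
      thus ?case using 3 by (simp add: smooth_alg.intros)
    qed (auto intro: smooth_alg.intros smooth_partial)
  qed
qed

lemma smooth_add: "smooth f \<Longrightarrow> smooth g \<Longrightarrow> smooth (\<lambda>x. f x + g x)"
  and smooth_mult: "smooth f \<Longrightarrow> smooth g \<Longrightarrow> smooth (\<lambda>x. f x * g x)"
  by (rule smooth_alg_smooth, simp add: smooth_alg.intros)+

lemma smooth_const: "smooth (\<lambda>_. c)"
proof (rule smooth_coinduct[of "\<lambda>f. \<exists>c. f = (\<lambda>_. c)"])
  fix g :: "real ^ 'a \<Rightarrow> real" and i assume "\<exists>c. g = (\<lambda>_. c)"
  hence "partial i g = (\<lambda>_. 0)" by (auto intro!: ext)
  thus "\<exists>c. partial i g = (\<lambda>_. c)" by blast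
qed auto

lemma smooth_coord: "smooth (\<lambda>x::real^'n::finite. x $ j)"
proof (rule smooth_coinduct[of "\<lambda>f. smooth f \<or> f = (\<lambda>x. x $ j)"])
  fix g :: "real ^ 'n \<Rightarrow> real" and x i
  assume g: "smooth g \<or> g = (\<lambda>x. x $ j)"
  have "(\<lambda>x::real^'n. x $ j) differentiable (at x)"
    by (rule differentiableI[OF bounded_linear.has_derivative[OF bounded_linear_vec_nth has_derivative_ident]])
  thus "g differentiable (at x)" using g smooth_differentiable by blast
  have "partial i (\<lambda>x. x $ j) = (\<lambda>_. if i = j then 1 else 0 :: real)" by (rule ext, rule partial_coord)
  hence "smooth (partial i (\<lambda>x. x $ j))" using smooth_const[of "if i = j then 1 else 0 :: real"] by (simp only:)
  thus "smooth (partial i g) \<or> partial i g = (\<lambda>x. x $ j)"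
    using g smooth_partial[of g i] by blast
qed simp

lemma smooth_cmult: "smooth f \<Longrightarrow> smooth (\<lambda>x. c * f x)"
  by (intro smooth_mult smooth_const)

lemma smooth_diff: "smooth f \<Longrightarrow> smooth g \<Longrightarrow> smooth (\<lambda>x. f x - g x)"
  using smooth_add[of f "\<lambda>x. (-1) * g x"] smooth_cmult[of g "-1"] by simp

lemma smooth_sum: "(\<And>i. i \<in> A \<Longrightarrow> smooth (f i)) \<Longrightarrow> smooth (\<lambda>x. \<Sum>i\<in>A. f i x)"
  by (induction A rule: infinite_finite_induct) (auto intro: smooth_const smooth_add)

lemma partial_cmult: "smooth f \<Longrightarrow> partial i (\<lambda>x. c * f x) x = c * partial i f x"
  by (subst partial_mult) (auto intro: smooth_differentiable)

lemma partial_diff: "smooth f \<Longrightarrow> smooth g \<Longrightarrow> partial i (\<lambda>x. f x - g x) x = partial i f x - partial i g x"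
  using partial_add[of f x "\<lambda>x. (-1) * g x" i] partial_cmult[of g i "-1" x]
  by (simp add: smooth_differentiable smooth_cmult)

lemma partial_sum:
  assumes "finite A" "\<And>j. j \<in> A \<Longrightarrow> smooth (f j)"
  shows "partial i (\<lambda>x. \<Sum>j\<in>A. f j x) x = (\<Sum>j\<in>A. partial i (f j) x)"
  using assms by (induction A rule: finite_induct)
    (auto simp: partial_add smooth_differentiable smooth_sum)

lemma partials_cmult: "smooth f \<Longrightarrow> partials is (\<lambda>x. c * f x) x = c * partials is f x"
proof (induction "is" arbitrary: x)
  case (Cons i "is")
  have "smooth (partials is f)"
    using Cons.prems by (induction "is") (auto intro: smooth_partial)
  moreover have "partials is (\<lambda>x. c * f x) = (\<lambda>x. c * partials is f x)" using Cons by blast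
  ultimately show ?case by (simp add: partial_cmult)
qed simp

lemma smooth_partials: "smooth f \<Longrightarrow> smooth (partials is f)"
  by (induction "is") (auto intro: smooth_partial)

lemma partials_diff: "smooth f \<Longrightarrow> smooth g \<Longrightarrow> partials is (\<lambda>x. f x - g x) x = partials is f x - partials is g x"
proof (induction "is" arbitrary: x)
  case (Cons i "is")
  have "partials is (\<lambda>x. f x - g x) = (\<lambda>x. partials is f x - partials is g x)" using Cons by blast
  thus ?case using Cons.prems by (simp add: partial_diff smooth_partials)
qed simp

section \<open>Radial and angular derivatives\<close>

definition euler :: "(real ^ 'n::finite \<Rightarrow> real) \<Rightarrow> real ^ 'n \<Rightarrow> real" where
  "euler f x = (\<Sum>i\<in>UNIV. x $ i * partial i f x)"

definition rotder :: "'n \<Rightarrow> 'n \<Rightarrow> (real ^ 'n::finite \<Rightarrow> real) \<Rightarrow> real ^ 'n \<Rightarrow> real" where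
  "rotder i j f x = x $ i * partial j f x - x $ j * partial i f x"

text \<open>Laplace-Beltrami operator as the sum of squares of the rotation generators, halved
  because every unordered pair occurs twice. Being a differential operator on the whole space that
  is tangent to all centred spheres, it needs no calculus on a manifold.\<close>

definition sphere_laplacian :: "(real ^ 'n::finite \<Rightarrow> real) \<Rightarrow> real ^ 'n \<Rightarrow> real" where
  "sphere_laplacian f x = 1/2 * (\<Sum>i\<in>UNIV. \<Sum>j\<in>UNIV. rotder i j (rotder i j f) x)"

lemma smooth_euler: "smooth f \<Longrightarrow> smooth (euler f)"
  unfolding euler_def[abs_def] by (intro smooth_sum smooth_mult smooth_coord smooth_partial)

lemma smooth_rotder: "smooth f \<Longrightarrow> smooth (rotder i j f)"
  unfolding rotder_def[abs_def] by (intro smooth_diff smooth_mult smooth_coord smooth_partial)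

lemma smooth_sphere_laplacian: "smooth f \<Longrightarrow> smooth (sphere_laplacian f)"
  unfolding sphere_laplacian_def[abs_def] by (intro smooth_cmult smooth_sum smooth_rotder)

lemma smooth_laplacian: "smooth f \<Longrightarrow> smooth (laplacian f)"
  unfolding laplacian_def[abs_def] by (intro smooth_sum smooth_partial)

lemma partial_coord_mult:
  "smooth f \<Longrightarrow> partial j (\<lambda>x. x $ i * f x) x = x $ i * partial j f x + (if j = i then f x else 0)"
  by (subst partial_mult) (auto intro: smooth_differentiable smooth_coord simp: partial_coord)

lemma euler_euler:
  assumes "smooth f"
  shows "euler (euler f) x = (\<Sum>j\<in>UNIV. \<Sum>i\<in>UNIV. x $ j * x $ i * partial j (partial i f) x) + euler f x"
proof -
  have "partial j (euler f) x = (\<Sum>i\<in>UNIV. x $ i * partial j (partial i f) x) + partial j f x" for j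
    unfolding euler_def[abs_def]
    by (subst partial_sum) (auto simp: assms partial_coord_mult smooth_partial smooth_mult smooth_coord sum.distrib)
  thus ?thesis
    unfolding euler_def[of "euler f"] by (simp add: distrib_left sum.distrib sum_distrib_left mult.assoc) (simp add: euler_def)
qed

lemma rotder_rotder:
  assumes "smooth f" "i \<noteq> j"
  shows "rotder i j (rotder i j f) x = (x $ i)\<^sup>2 * partial j (partial j f) x + (x $ j)\<^sup>2 * partial i (partial i f) x
    - x $ i * x $ j * partial j (partial i f) x - x $ j * x $ i * partial i (partial j f) x
    - x $ i * partial i f x - x $ j * partial j f x"
proof -
  have pd: "partial k (rotder i j f) x = x $ i * partial k (partial j f) x + (if k = i then partial j f x else 0)
     - (x $ j * partial k (partial i f) x + (if k = j then partial i f x else 0))" for k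
    unfolding rotder_def[abs_def]
    by (subst partial_diff) (auto simp: assms partial_coord_mult smooth_partial smooth_mult smooth_coord)
  show ?thesis unfolding rotder_def[of i j "rotder i j f"] pd using assms(2)
    by (simp add: algebra_simps power2_eq_square)
qed

lemma rotder_same: "rotder i i f x = 0"
  by (simp add: rotder_def)

lemma norm_power2_vec: "(norm x)\<^sup>2 = (\<Sum>i\<in>UNIV. (x $ i)\<^sup>2)" for x :: "real ^ 'n"
  by (subst power2_norm_eq_inner) (simp add: inner_vec_def power2_eq_square)

text \<open>Sum of \<open>rotder_rotder\<close> over all pairs: the mixed second derivatives
  reassemble to \<open>euler (euler f) - euler f\<close>, and the first-order terms count the
  dimension.\<close>

lemma laplacian_polar:
  fixes f :: "real ^ 'n::finite \<Rightarrow> real"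
  assumes f: "smooth f"
  shows "(norm x)\<^sup>2 * laplacian f x = euler (euler f) x + (real CARD('n) - 2) * euler f x + sphere_laplacian f x"
proof -
  define h where "h i j = x $ i * x $ j * partial j (partial i f) x" for i j
  define a where "a i = x $ i * partial i f x" for i
  define L where "L i j = (x $ i)\<^sup>2 * partial j (partial j f) x" for i j
  \<comment> \<open>The formula for the squared generator needs distinct indices; for
    \<open>i = j\<close> the same expression is off by exactly \<open>2 * a i\<close>, which is
    added back.\<close>
  have rr: "rotder i j (rotder i j f) x = L i j + L j i - h i j - h j i - a i - a j + (if i = j then 2 * a i else 0)" for i j
  proof (cases "i = j")
    case True
    have "rotder i i (rotder i i f) x = 0" unfolding rotder_same ..
    thus ?thesis using True by (simp add: L_def h_def power2_eq_square)
  next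
    case False
    thus ?thesis unfolding rotder_rotder[OF f False] L_def h_def a_def by simp
  qed
  have e: "euler f x = (\<Sum>i\<in>UNIV. a i)" unfolding euler_def a_def ..
  have ee: "euler (euler f) x = (\<Sum>i\<in>UNIV. \<Sum>j\<in>UNIV. h i j) + euler f x"
    unfolding euler_euler[OF f] h_def by (subst sum.swap) (simp add: ac_simps)
  have s: "(\<Sum>i\<in>UNIV. \<Sum>j\<in>UNIV. h j i) = (\<Sum>i\<in>UNIV. \<Sum>j\<in>UNIV. h i j)"
    "(\<Sum>i\<in>UNIV. \<Sum>j\<in>UNIV. L j i) = (\<Sum>i\<in>UNIV. \<Sum>j\<in>UNIV. L i j)" by (rule sum.swap)+
  have l: "(\<Sum>i\<in>UNIV. \<Sum>j\<in>UNIV. L i j) = (norm x)\<^sup>2 * laplacian f x"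
    unfolding L_def norm_power2_vec laplacian_def sum_product ..
  have "(\<Sum>i\<in>UNIV. \<Sum>j\<in>UNIV. rotder i j (rotder i j f) x)
    = 2 * ((norm x)\<^sup>2 * laplacian f x) - 2 * (\<Sum>i\<in>UNIV. \<Sum>j\<in>UNIV. h i j) - 2 * real CARD('n) * euler f x + 2 * euler f x"
    unfolding rr by (simp add: sum.distrib sum_subtractf s l e sum_distrib_left[symmetric] sum_distrib_right[symmetric] algebra_simps)
  thus ?thesis unfolding sphere_laplacian_def ee by (simp add: algebra_simps)
qed

text \<open>Lagrange's identity for the vectors \<open>x\<close> and
  \<open>gradient f x\<close>.\<close>

lemma gradient_polar:
  fixes f :: "real ^ 'n::finite \<Rightarrow> real"
  shows "(norm x)\<^sup>2 * (norm (gradient f x))\<^sup>2 = (euler f x)\<^sup>2 + 1/2 * (\<Sum>i\<in>UNIV. \<Sum>j\<in>UNIV. (rotder i j f x)\<^sup>2)"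
proof -
  define a where "a i = x $ i" for i
  define b where "b i = partial i f x" for i
  have 1: "(\<Sum>i\<in>UNIV. \<Sum>j\<in>UNIV. (a j)\<^sup>2 * (b i)\<^sup>2) = (\<Sum>i\<in>UNIV. \<Sum>j\<in>UNIV. (a i)\<^sup>2 * (b j)\<^sup>2)" by (rule sum.swap)
  have "(\<Sum>i\<in>UNIV. \<Sum>j\<in>UNIV. (rotder i j f x)\<^sup>2)
    = (\<Sum>i\<in>UNIV. \<Sum>j\<in>UNIV. (a i)\<^sup>2 * (b j)\<^sup>2 + (a j)\<^sup>2 * (b i)\<^sup>2 - 2 * ((a i * b i) * (a j * b j)))"
    unfolding rotder_def a_def b_def by (intro sum.cong refl) (simp add: power2_eq_square algebra_simps)
  also have "\<dots> = 2 * ((norm x)\<^sup>2 * (norm (gradient f x))\<^sup>2) - 2 * (euler f x)\<^sup>2"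
  proof -
    have 2: "(\<Sum>i\<in>UNIV. \<Sum>j\<in>UNIV. (a i)\<^sup>2 * (b j)\<^sup>2) = (norm x)\<^sup>2 * (norm (gradient f x))\<^sup>2"
      unfolding norm_power2_vec sum_product a_def b_def gradient_def by simp
    have 3: "(\<Sum>i\<in>UNIV. \<Sum>j\<in>UNIV. (a i * b i) * (a j * b j)) = (euler f x)\<^sup>2"
      unfolding euler_def power2_eq_square sum_product a_def b_def ..
    show ?thesis
      unfolding sum.distrib sum_subtractf 1 2 sum_distrib_left[symmetric, of 2] 3 by simp
  qed
  finally show ?thesis by (simp add: field_simps)
qed

lemma smooth_dilate:
  assumes "smooth f"
  shows "smooth (\<lambda>x. f (r *\<^sub>R x))" "partial i (\<lambda>x. f (r *\<^sub>R x)) x = r * partial i f (r *\<^sub>R x)"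
proof -
  have d: "((\<lambda>x. g (r *\<^sub>R x)) has_derivative (\<lambda>h. \<Sum>i\<in>UNIV. (r *\<^sub>R h) $ i * partial i g (r *\<^sub>R x))) (at x)"
    if "smooth g" for g and x :: "real ^ 'n"
  proof -
    have "((\<lambda>x. r *\<^sub>R x) has_derivative (\<lambda>h. r *\<^sub>R h)) (at x)" by (auto intro!: derivative_eq_intros)
    from diff_chain_at[OF this smooth_has_derivative[OF that]] show ?thesis by (simp add: o_def)
  qed
  have p: "partial i (\<lambda>x. g (r *\<^sub>R x)) x = r * partial i g (r *\<^sub>R x)" if "smooth g" for g i x
  proof -
    have "(\<Sum>k\<in>UNIV. (r *\<^sub>R axis i 1) $ k * partial k g (r *\<^sub>R x)) = (\<Sum>k\<in>UNIV. if k = i then r * partial k g (r *\<^sub>R x) else 0)"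
      by (intro sum.cong) (auto simp: axis_def)
    thus ?thesis using partial_eq[OF d[OF that]] by simp
  qed
  show "partial i (\<lambda>x. f (r *\<^sub>R x)) x = r * partial i f (r *\<^sub>R x)" by (rule p[OF assms])
  show "smooth (\<lambda>x. f (r *\<^sub>R x))"
  \<comment> \<open>Each partial derivative brings out a factor \<open>r\<close>, so the invariant
    class has to admit constant multiples.\<close>
  proof (rule smooth_coinduct[of "\<lambda>g. \<exists>f c. smooth f \<and> g = (\<lambda>x. c * f (r *\<^sub>R x))"])
    show "\<exists>g c. smooth g \<and> (\<lambda>x. f (r *\<^sub>R x)) = (\<lambda>x. c * g (r *\<^sub>R x))"
      using assms by (intro exI[of _ f] exI[of _ 1]) auto
  next
    fix g :: "real ^ 'n \<Rightarrow> real" and x i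
    assume "\<exists>f c. smooth f \<and> g = (\<lambda>x. c * f (r *\<^sub>R x))"
    then obtain f c where f: "smooth f" "g = (\<lambda>x. c * f (r *\<^sub>R x))" by blast
    have dd: "(\<lambda>x. f (r *\<^sub>R x)) differentiable (at x)" for x using d[OF f(1)] unfolding differentiable_def by blast
    show "g differentiable (at x)" unfolding f by (intro differentiable_mult differentiable_const dd)
    have "partial i g = (\<lambda>x. (c * r) * partial i f (r *\<^sub>R x))"
      unfolding f by (rule ext, subst partial_mult) (auto simp: dd p[OF f(1)])
    thus "\<exists>f c. smooth f \<and> partial i g = (\<lambda>x. c * f (r *\<^sub>R x))" using smooth_partial[OF f(1)] by blast
  qed
qed

lemma euler_dilate: "smooth f \<Longrightarrow> euler (\<lambda>x. f (r *\<^sub>R x)) x = euler f (r *\<^sub>R x)"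
  unfolding euler_def by (simp add: smooth_dilate sum_distrib_left ac_simps)

lemma rotder_dilate: "smooth f \<Longrightarrow> rotder i j (\<lambda>x. f (r *\<^sub>R x)) x = rotder i j f (r *\<^sub>R x)"
  unfolding rotder_def by (simp add: smooth_dilate algebra_simps)

lemma sphere_laplacian_dilate:
  assumes "smooth f"
  shows "sphere_laplacian (\<lambda>x. f (r *\<^sub>R x)) x = sphere_laplacian f (r *\<^sub>R x)"
proof -
  have "rotder i j (\<lambda>x. f (r *\<^sub>R x)) = (\<lambda>x. rotder i j f (r *\<^sub>R x))" for i j
    using rotder_dilate[OF assms] by blast
  thus ?thesis unfolding sphere_laplacian_def by (simp add: rotder_dilate smooth_rotder assms)
qed

lemma DERIV_ray:
  assumes "smooth f"
  shows "((\<lambda>y. f (exp (- y) *\<^sub>R x)) has_real_derivative - euler f (exp (- y) *\<^sub>R x)) (at y)"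
proof -
  have "((\<lambda>y. exp (- y) *\<^sub>R x) has_derivative (\<lambda>h. (- exp (- y) * h) *\<^sub>R x)) (at y)"
    by (auto intro!: derivative_eq_intros)
  from diff_chain_at[OF this smooth_has_derivative[OF assms]]
  have "((\<lambda>y. f (exp (- y) *\<^sub>R x)) has_derivative (\<lambda>h. \<Sum>i\<in>UNIV. ((- exp (- y) * h) *\<^sub>R x) $ i * partial i f (exp (- y) *\<^sub>R x))) (at y)"
    by (simp add: o_def)
  moreover have "(\<lambda>h. \<Sum>i\<in>UNIV. ((- exp (- y) * h) *\<^sub>R x) $ i * partial i f (exp (- y) *\<^sub>R x)) = (*) (- euler f (exp (- y) *\<^sub>R x))"
    unfolding euler_def fun_eq_iff by (simp add: sum_distrib_right sum_distrib_left sum_negf ac_simps)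
  ultimately show ?thesis unfolding has_field_derivative_def by (simp only:)
qed

section \<open>Integration by parts on the sphere\<close>

lemma integral_rotder:
  assumes "smooth f"
  shows "(\<integral> x. rotder i j f x \<partial>sphere_measure) = 0"
proof (cases "i = j")
  case False
  have d: "(f has_derivative (\<lambda>h. \<Sum>k\<in>UNIV. h $ k * partial k f x)) (at x)" for x
    by (rule smooth_has_derivative[OF assms])
  have ax: "(\<Sum>k\<in>UNIV. axis i 1 $ k * partial k f x) = partial i f x" for i x
  proof -
    have "(\<Sum>k\<in>UNIV. axis i 1 $ k * partial k f x) = (\<Sum>k\<in>UNIV. if k = i then partial k f x else 0)"
      by (intro sum.cong) (auto simp: axis_def)
    thus ?thesis by simp
  qed
  have "(\<integral> x. (x \<bullet> axis i 1) * (\<Sum>k\<in>UNIV. axis j 1 $ k * partial k f x)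
      - (x \<bullet> axis j 1) * (\<Sum>k\<in>UNIV. axis i 1 $ k * partial k f x) \<partial>sphere_measure) = 0"
    by (rule integral_sphere_angular_derivative[OF _ _ _ d])
       (use False assms in \<open>auto simp: ax axis_eq_axis axis_in_Basis_iff intro: smooth_continuous smooth_partial\<close>)
  thus ?thesis unfolding ax rotder_def by (simp add: inner_axis)
qed (simp add: rotder_same)

definition sphere_inner :: "(real ^ 'n::finite \<Rightarrow> real) \<Rightarrow> (real ^ 'n \<Rightarrow> real) \<Rightarrow> real" where
  "sphere_inner f g = (\<integral> x. f x * g x \<partial>sphere_measure)"

text \<open>The product rule and \<open>integral_rotder\<close> for \<open>f g\<close>: the sphere
  has no boundary, so angular derivatives are antisymmetric.\<close>

lemma sphere_inner_rotder:
  assumes f: "smooth f" and g: "smooth g"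
  shows "sphere_inner (rotder i j f) g = - sphere_inner f (rotder i j g)"
proof -
  have "rotder i j (\<lambda>x. f x * g x) x = rotder i j f x * g x + f x * rotder i j g x" for x
    unfolding rotder_def by (subst (1 2) partial_mult) (auto simp: f g smooth_differentiable algebra_simps)
  hence "0 = (\<integral> x. rotder i j f x * g x + f x * rotder i j g x \<partial>sphere_measure)"
    using integral_rotder[OF smooth_mult[OF f g], of i j] by simp
  also have "\<dots> = sphere_inner (rotder i j f) g + sphere_inner f (rotder i j g)"
    unfolding sphere_inner_def
    by (rule Bochner_Integration.integral_add)
       (intro integrable_sphere_continuous continuous_intros smooth_continuous smooth_rotder f g)+
  finally show ?thesis by simp
qed

lemma sphere_inner_sphere_laplacian_sum:
  assumes f: "smooth f" and g: "smooth g"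
  shows "sphere_inner (sphere_laplacian f) g = - 1/2 * (\<Sum>i\<in>UNIV. \<Sum>j\<in>UNIV. sphere_inner (rotder i j f) (rotder i j g))"
proof -
  have int: "integrable sphere_measure (\<lambda>x. rotder i j (rotder i j f) x * g x)" for i j
    by (intro integrable_sphere_continuous continuous_intros smooth_continuous smooth_rotder f g)
  have "sphere_inner (sphere_laplacian f) g = (\<integral> x. 1/2 * (\<Sum>i\<in>UNIV. \<Sum>j\<in>UNIV. rotder i j (rotder i j f) x * g x) \<partial>sphere_measure)"
    unfolding sphere_inner_def sphere_laplacian_def by (simp add: sum_distrib_right)
  also have "\<dots> = 1/2 * (\<Sum>i\<in>UNIV. \<Sum>j\<in>UNIV. sphere_inner (rotder i j (rotder i j f)) g)"
    by (simp add: int sphere_inner_def)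
  finally show ?thesis by (simp add: sphere_inner_rotder smooth_rotder f g sum_negf)
qed

lemma sphere_inner_commute: "sphere_inner f g = sphere_inner g f"
  unfolding sphere_inner_def by (simp add: mult.commute)

lemma sphere_laplacian_symmetric:
  assumes f: "smooth f" and g: "smooth g"
  shows "sphere_inner (sphere_laplacian f) g = sphere_inner f (sphere_laplacian g)"
  using sphere_inner_sphere_laplacian_sum[OF f g] sphere_inner_sphere_laplacian_sum[OF g f]
    sphere_inner_commute[of f "sphere_laplacian g"] sphere_inner_commute[of "rotder _ _ f"] by simp

subsection \<open>Polynomials on the sphere\<close>

definition monomial :: "'n list \<Rightarrow> real ^ 'n::finite \<Rightarrow> real" where
  "monomial is x = prod_list (map (\<lambda>i. x $ i) is)"

text \<open>Degree strictly below \<open>N\<close>. The strict bound makes \<open>N = 0\<close> the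
  zero function, so that the construction of harmonics can start from the empty family. Index lists
  represent monomials non-uniquely, which does no harm.\<close>

inductive poly_below :: "nat \<Rightarrow> (real ^ 'n::finite \<Rightarrow> real) \<Rightarrow> bool" for N where
  zero: "poly_below N (\<lambda>_. 0)"
| mono: "length is < N \<Longrightarrow> poly_below N (monomial is)"
| add: "poly_below N p \<Longrightarrow> poly_below N q \<Longrightarrow> poly_below N (\<lambda>x. p x + q x)"
| scale: "poly_below N p \<Longrightarrow> poly_below N (\<lambda>x. c * p x)"

lemma poly_below_leD:
  assumes "poly_below N p" "N \<le> M"
  shows "poly_below M p"
  using assms(1) by (induction rule: poly_below.induct) (use assms(2) in \<open>auto intro: poly_below.intros\<close>)

lemma monomial_Nil: "monomial [] = (\<lambda>_. 1)" and monomial_Cons: "monomial (i # is) = (\<lambda>x. x $ i * monomial is x)"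
  by (auto simp: monomial_def)

lemma smooth_monomial: "smooth (monomial is)"
  by (induction "is") (auto simp: monomial_Nil monomial_Cons intro: smooth_const smooth_mult smooth_coord)

lemma smooth_poly_below: "poly_below N p \<Longrightarrow> smooth p"
  by (induction rule: poly_below.induct) (auto intro: smooth_const smooth_monomial smooth_add smooth_cmult)

lemma poly_below_coord_mult:
  assumes "poly_below N p"
  shows "poly_below (Suc N) (\<lambda>x. x $ i * p x)"
  using assms
proof (induction rule: poly_below.induct)
  case (mono "is")
  thus ?case using poly_below.mono[of "i # is" "Suc N"] by (simp add: monomial_Cons)
next
  case (add p q)
  thus ?case using poly_below.add[of "Suc N" "\<lambda>x. x $ i * p x" "\<lambda>x. x $ i * q x"] by (simp add: algebra_simps)
next
  case (scale p c)
  thus ?case using poly_below.scale[of "Suc N" "\<lambda>x. x $ i * p x" c] by (simp add: ac_simps)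
qed (simp add: poly_below.zero)

lemma poly_below_sum:
  "finite A \<Longrightarrow> (\<And>i. i \<in> A \<Longrightarrow> poly_below N (f i)) \<Longrightarrow> poly_below N (\<lambda>x. \<Sum>i\<in>A. f i x)"
  by (induction A rule: finite_induct) (auto intro: poly_below.intros)

lemma poly_below_diff:
  assumes "poly_below N p" "poly_below N q"
  shows "poly_below N (\<lambda>x. p x - q x)"
  using poly_below.add[OF assms(1) poly_below.scale[OF assms(2), of "-1"]] by simp

lemma poly_below_partial_monomial: "poly_below (length is) (partial j (monomial is))"
proof (induction "is")
  case Nil
  have "partial j (monomial []) = (\<lambda>_. 0)" by (auto simp: monomial_Nil)
  thus ?case by (simp add: poly_below.zero)
next
  case (Cons i "is")
  have "partial j (monomial (i # is)) = (\<lambda>x. x $ i * partial j (monomial is) x + (if j = i then 1 else 0) * monomial is x)"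
    unfolding monomial_Cons by (rule ext) (simp add: partial_coord_mult smooth_monomial)
  moreover have "poly_below (Suc (length is)) (\<lambda>x. (if j = i then 1 else 0) * monomial is x)"
    by (intro poly_below.scale poly_below.mono) simp
  ultimately show ?case using poly_below.add[OF poly_below_coord_mult[OF Cons.IH, of i]] by simp
qed

lemma poly_below_partial:
  assumes "poly_below N p"
  shows "poly_below N (partial j p)"
  using assms
proof (induction rule: poly_below.induct)
  case zero
  have "partial j (\<lambda>_. 0) = (\<lambda>_::real^'a. 0::real)" by (auto intro!: ext)
  thus ?case by (simp add: poly_below.zero)
next
  case (mono "is")
  thus ?case using poly_below_leD[OF poly_below_partial_monomial, of "is" N j] by simp
next
  case (add p q)
  have "partial j (\<lambda>x. p x + q x) = (\<lambda>x. partial j p x + partial j q x)"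
    using add by (intro ext partial_add smooth_differentiable smooth_poly_below)
  thus ?case using poly_below.add[OF add.IH] by simp
next
  case (scale p c)
  have "partial j (\<lambda>x. c * p x) = (\<lambda>x. c * partial j p x)"
    using scale by (intro ext partial_cmult smooth_poly_below)
  thus ?case using poly_below.scale[OF scale.IH] by simp
qed

lemma euler_monomial: "euler (monomial is) x = real (length is) * monomial is x"
proof (induction "is")
  case Nil
  thus ?case by (simp add: euler_def monomial_Nil)
next
  case (Cons i "is")
  have "euler (monomial (i # is)) x = (\<Sum>j\<in>UNIV. x $ i * (x $ j * partial j (monomial is) x) + (if j = i then x $ i * monomial is x else 0))"
    unfolding euler_def monomial_Cons by (intro sum.cong refl) (auto simp: partial_coord_mult smooth_monomial algebra_simps)
  also have "\<dots> = x $ i * euler (monomial is) x + x $ i * monomial is x"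
    by (simp add: sum.distrib euler_def sum_distrib_left)
  finally show ?case unfolding Cons.IH by (simp add: monomial_Cons algebra_simps)
qed

definition sphere_eig :: "'n::finite itself \<Rightarrow> nat \<Rightarrow> real" where
  "sphere_eig _ N = real N * (real N + (real CARD('n) - 2))"

lemma sphere_laplacian_monomial:
  fixes x :: "real ^ 'n::finite"
  assumes "norm x = 1"
  shows "sphere_laplacian (monomial is) x = laplacian (monomial is) x - sphere_eig TYPE('n) (length is) * monomial is x"
proof -
  have "euler (monomial is) = (\<lambda>x. real (length is) * monomial is x)" by (rule ext, rule euler_monomial)
  moreover have "euler (\<lambda>x. real (length is) * monomial is x) x = real (length is) * euler (monomial is) x"
    unfolding euler_def by (simp add: partial_cmult smooth_monomial sum_distrib_left ac_simps)
  ultimately have "euler (euler (monomial is)) x = real (length is) * (real (length is) * monomial is x)"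
    by (simp add: euler_monomial)
  thus ?thesis
    using laplacian_polar[OF smooth_monomial, of x "is"] assms unfolding sphere_eig_def
    by (simp add: euler_monomial algebra_simps)
qed

lemma sphere_laplacian_add:
  assumes "smooth f" "smooth g"
  shows "sphere_laplacian (\<lambda>x. f x + g x) x = sphere_laplacian f x + sphere_laplacian g x"
proof -
  have r: "rotder i j (\<lambda>x. f x + g x) = (\<lambda>x. rotder i j f x + rotder i j g x)" if "smooth f" "smooth g" for f g i j
    unfolding rotder_def using that by (intro ext) (simp add: partial_add smooth_differentiable algebra_simps)
  show ?thesis unfolding sphere_laplacian_def
    by (simp add: r assms smooth_rotder sum.distrib)
qed

lemma sphere_laplacian_cmult:
  assumes "smooth f"
  shows "sphere_laplacian (\<lambda>x. c * f x) x = c * sphere_laplacian f x"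
proof -
  have r: "rotder i j (\<lambda>x. c * f x) = (\<lambda>x. c * rotder i j f x)" if "smooth f" for f i j
    unfolding rotder_def using that by (intro ext) (simp add: partial_cmult algebra_simps)
  show ?thesis unfolding sphere_laplacian_def
    by (simp add: r assms smooth_rotder sum_distrib_left ac_simps)
qed

text \<open>On the unit sphere the operator is triangular with respect to the degree: by Euler's
  relation the radial terms multiply a monomial of degree d by \<open>d (d + n - 2)\<close>, and the
  flat Laplacian lowers the degree. Monomials of degree below \<open>N\<close>, whose own eigenvalue
  differs, are put into \<open>q\<close>.\<close>

lemma sphere_laplacian_poly:
  fixes p :: "real ^ 'n::finite \<Rightarrow> real"
  assumes "poly_below (Suc N) p"
  shows "\<exists>q. poly_below N q \<and> (\<forall>x. norm x = 1 \<longrightarrow> sphere_laplacian p x = q x - sphere_eig TYPE('n) N * p x)"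
  using assms
proof (induction rule: poly_below.induct)
  case zero
  have "sphere_laplacian (\<lambda>_. 0) x = 0" for x :: "real ^ 'n"
    using sphere_laplacian_cmult[of "\<lambda>_. 0" 0 x] smooth_const[of 0] by simp
  thus ?case by (intro exI[of _ "\<lambda>_. 0"]) (simp add: poly_below.zero)
next
  case (mono "is")
  define q where "q x = laplacian (monomial is) x + (sphere_eig TYPE('n) N - sphere_eig TYPE('n) (length is)) * monomial is x" for x
  have "poly_below N (laplacian (monomial is))"
    unfolding laplacian_def[abs_def] using mono
    by (intro poly_below_sum poly_below_partial poly_below_leD[OF poly_below_partial_monomial]) auto
  moreover have "poly_below N (\<lambda>x. (sphere_eig TYPE('n) N - sphere_eig TYPE('n) (length is)) * monomial is x)"
  proof (cases "length is = N")
    case True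
    thus ?thesis by (simp add: poly_below.zero)
  next
    case False
    thus ?thesis using mono by (intro poly_below.scale poly_below.mono) simp
  qed
  ultimately have "poly_below N q" unfolding q_def by (rule poly_below.add)
  moreover have "\<forall>x. norm x = 1 \<longrightarrow> sphere_laplacian (monomial is) x = q x - sphere_eig TYPE('n) N * monomial is x"
    by (auto simp: q_def sphere_laplacian_monomial algebra_simps)
  ultimately show ?case by blast
next
  case (add p q)
  then obtain p' q' where h: "poly_below N p'" "\<forall>x. norm x = 1 \<longrightarrow> sphere_laplacian p x = p' x - sphere_eig TYPE('n) N * p x"
    "poly_below N q'" "\<forall>x. norm x = 1 \<longrightarrow> sphere_laplacian q x = q' x - sphere_eig TYPE('n) N * q x" by blast
  show ?case
    by (rule exI[of _ "\<lambda>x. p' x + q' x"])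
       (use h add in \<open>auto intro: poly_below.add simp: sphere_laplacian_add smooth_poly_below algebra_simps\<close>)
next
  case (scale p c)
  then obtain p' where h: "poly_below N p'" "\<forall>x. norm x = 1 \<longrightarrow> sphere_laplacian p x = p' x - sphere_eig TYPE('n) N * p x" by blast
  show ?case
  proof (intro exI[of _ "\<lambda>x. c * p' x"] conjI poly_below.scale h(1) allI impI)
    fix x :: "real ^ 'n" assume "norm x = 1"
    hence "sphere_laplacian p x = p' x - sphere_eig TYPE('n) N * p x" using h(2) by blast
    thus "sphere_laplacian (\<lambda>x. c * p x) x = c * p' x - sphere_eig TYPE('n) N * (c * p x)"
      by (simp only: sphere_laplacian_cmult[OF smooth_poly_below[OF scale.hyps]] right_diff_distrib mult.left_commute)
  qed
qed

lemma poly_below_mult: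
  assumes "poly_below N p" "poly_below M q"
  shows "poly_below (N + M) (\<lambda>x. p x * q x)"
  using assms(1)
proof (induction rule: poly_below.induct)
  case (mono "is")
  have "poly_below (length is + M) (\<lambda>x. monomial is x * q x)"
  proof (induction "is")
    case (Cons i "is")
    from poly_below_coord_mult[OF this, of i] show ?case by (simp add: monomial_Cons mult.assoc)
  qed (use assms(2) in \<open>simp add: monomial_Nil\<close>)
  thus ?case by (rule poly_below_leD) (use mono in simp)
next
  case (add p p')
  from poly_below.add[OF add.IH] show ?case by (simp add: algebra_simps)
next
  case (scale p c)
  from poly_below.scale[OF scale.IH] show ?case by (simp add: mult.assoc)
qed (simp add: poly_below.zero)

lemma poly_below_const: "poly_below (Suc 0) (\<lambda>_. c)"
  using poly_below.scale[OF poly_below.mono[of "[]" "Suc 0"], of c] by (simp add: monomial_Nil)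

lemma real_polynomial_function_poly_below:
  fixes p :: "real ^ 'n::finite \<Rightarrow> real"
  assumes "real_polynomial_function p"
  shows "\<exists>N. poly_below N p"
  using assms
proof (induction rule: real_polynomial_function.induct)
  case (linear f)
  have lin: "linear f" using linear by (rule bounded_linear.linear)
  have "f x = (\<Sum>i\<in>UNIV. f (axis i 1) * monomial [i] x)" for x
  proof -
    have "f x = f (\<Sum>i\<in>UNIV. x $ i *\<^sub>R axis i 1)"
      using basis_expansion[of x] by (simp add: scalar_mult_eq_scaleR)
    also have "\<dots> = (\<Sum>i\<in>UNIV. f (axis i 1) * monomial [i] x)"
      unfolding linear_sum[OF lin] by (simp add: linear_cmul[OF lin] monomial_def ac_simps)
    finally show ?thesis .
  qed
  hence "f = (\<lambda>x. \<Sum>i\<in>UNIV. f (axis i 1) * monomial [i] x)" by blast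
  moreover have "poly_below 2 (\<lambda>x. \<Sum>i\<in>UNIV. f (axis i 1) * monomial [i] x)"
    by (intro poly_below_sum poly_below.scale poly_below.mono) auto
  ultimately show ?case by metis
next
  case (const c)
  thus ?case using poly_below_const by blast
next
  case (add f g)
  then obtain N M where "poly_below N f" "poly_below M g" by blast
  hence "poly_below (max N M) f" "poly_below (max N M) g" by (auto intro: poly_below_leD)
  thus ?case using poly_below.add by blast
next
  case (mult f g)
  thus ?case using poly_below_mult by blast
qed

subsection \<open>Spherical harmonics\<close>

lemma sphere_inner_add_left:
  assumes "continuous_on UNIV f" "continuous_on UNIV g" "continuous_on UNIV h"
  shows "sphere_inner (\<lambda>x. f x + g x) h = sphere_inner f h + sphere_inner g h"
  unfolding sphere_inner_def distrib_right
  by (rule Bochner_Integration.integral_add) (intro integrable_sphere_continuous continuous_intros assms)+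

lemma sphere_inner_scale_left: "sphere_inner (\<lambda>x. c * f x) h = c * sphere_inner f h"
  unfolding sphere_inner_def by (simp add: mult.assoc)

lemma sphere_inner_diff_left:
  assumes "continuous_on UNIV f" "continuous_on UNIV g" "continuous_on UNIV h"
  shows "sphere_inner (\<lambda>x. f x - g x) h = sphere_inner f h - sphere_inner g h"
  unfolding sphere_inner_def left_diff_distrib
  by (rule Bochner_Integration.integral_diff) (intro integrable_sphere_continuous continuous_intros assms)+

lemma sphere_inner_sum_left:
  assumes "\<And>i. i \<in> A \<Longrightarrow> continuous_on UNIV (f i)" "continuous_on UNIV h"
  shows "sphere_inner (\<lambda>x. \<Sum>i\<in>A. f i x) h = (\<Sum>i\<in>A. sphere_inner (f i) h)"
  unfolding sphere_inner_def sum_distrib_right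
  by (rule Bochner_Integration.integral_sum) (intro integrable_sphere_continuous continuous_intros assms)

lemma sphere_inner_self_nonneg: "0 \<le> sphere_inner f f"
  unfolding sphere_inner_def by simp

text \<open>Functions of norm zero may be nonzero off the sphere; this allows them to be discarded
  inside inner products.\<close>

lemma sphere_inner_null:
  assumes "continuous_on UNIV f" "sphere_inner f f = 0"
  shows "sphere_inner f g = 0"
proof -
  have "AE x in sphere_measure. f x * f x = 0"
    using assms(2) unfolding sphere_inner_def
    by (subst (asm) integral_nonneg_eq_0_iff_AE)
       (auto intro!: integrable_sphere_continuous continuous_intros assms(1))
  hence "AE x in sphere_measure. f x * g x = 0" by eventually_elim simp
  thus ?thesis unfolding sphere_inner_def by (rule integral_eq_zero_AE)
qed

lemma sphere_inner_cong:
  assumes "continuous_on UNIV f" "continuous_on UNIV f'" "continuous_on UNIV g" "\<And>x. norm x = 1 \<Longrightarrow> f x = f' x"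
  shows "sphere_inner f g = sphere_inner f' g"
  unfolding sphere_inner_def by (rule sphere_integral_cong) (use assms in \<open>auto intro!: continuous_intros\<close>)

lemma sphere_inner_null_add:
  assumes "continuous_on UNIV f" "continuous_on UNIV g" "sphere_inner f f = 0"
  shows "sphere_inner (\<lambda>x. f x + g x) (\<lambda>x. f x + g x) = sphere_inner g g"
proof -
  have fg: "continuous_on UNIV (\<lambda>x. f x + g x)" by (intro continuous_intros assms)
  have "sphere_inner (\<lambda>x. f x + g x) (\<lambda>x. f x + g x) = sphere_inner g (\<lambda>x. f x + g x)"
    using sphere_inner_add_left[OF assms(1,2) fg] sphere_inner_null[OF assms(1,3)] by simp
  also have "\<dots> = sphere_inner (\<lambda>x. f x + g x) g" by (rule sphere_inner_commute)
  also have "\<dots> = sphere_inner g g"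
    using sphere_inner_add_left[OF assms(1,2,2)] sphere_inner_null[OF assms(1,3)] by simp
  finally show ?thesis .
qed

section \<open>Orthonormal families and orthogonal projection\<close>

definition orthonormal :: "(real ^ 'n::finite \<Rightarrow> real) set \<Rightarrow> bool" where
  "orthonormal E \<longleftrightarrow> finite E \<and> (\<forall>y\<in>E. continuous_on UNIV y) \<and>
     (\<forall>y\<in>E. \<forall>z\<in>E. sphere_inner y z = (if y = z then 1 else 0))"

definition resid :: "(real ^ 'n::finite \<Rightarrow> real) set \<Rightarrow> (real ^ 'n \<Rightarrow> real) \<Rightarrow> real ^ 'n \<Rightarrow> real" where
  "resid E p x = p x - (\<Sum>y\<in>E. sphere_inner p y * y x)"

text \<open>Membership in the span modulo functions of norm zero, rather than equality on the whole
  space: different polynomials such as 1 and \<open>|x|^2\<close> agree on the sphere, and there the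
  residual vanishes only in the norm.\<close>

definition captures :: "(real ^ 'n::finite \<Rightarrow> real) set \<Rightarrow> (real ^ 'n \<Rightarrow> real) \<Rightarrow> bool" where
  "captures E p \<longleftrightarrow> sphere_inner (resid E p) (resid E p) = 0"

context
  fixes E :: "(real ^ 'n::finite \<Rightarrow> real) set"
  assumes E: "orthonormal E"
begin

lemma continuous_resid: "continuous_on UNIV p \<Longrightarrow> continuous_on UNIV (resid E p)"
  using E unfolding orthonormal_def resid_def[abs_def] by (auto intro!: continuous_intros)

lemma sphere_inner_sum_basis:
  assumes "y \<in> E"
  shows "sphere_inner (\<lambda>x. \<Sum>z\<in>E. c z * z x) y = c y"
proof -
  have "sphere_inner (\<lambda>x. \<Sum>z\<in>E. c z * z x) y = (\<Sum>z\<in>E. c z * sphere_inner z y)"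
    using E assms unfolding orthonormal_def
    by (subst sphere_inner_sum_left) (auto intro!: continuous_intros simp: sphere_inner_scale_left)
  also have "\<dots> = (\<Sum>z\<in>E. if z = y then c y else 0)"
    using E assms unfolding orthonormal_def by (intro sum.cong) auto
  finally show ?thesis using E assms unfolding orthonormal_def by simp
qed

lemma continuous_basis_sum: "continuous_on UNIV (\<lambda>x. \<Sum>z\<in>E. c z * z x)"
  using E unfolding orthonormal_def by (auto intro!: continuous_intros)

lemma resid_orthogonal:
  assumes "continuous_on UNIV p" "y \<in> E"
  shows "sphere_inner (resid E p) y = 0"
proof -
  have "continuous_on UNIV y" using E assms unfolding orthonormal_def by blast
  thus ?thesis unfolding resid_def[abs_def]
    using sphere_inner_diff_left[OF assms(1) continuous_basis_sum] sphere_inner_sum_basis[OF assms(2)] by simp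
qed

lemma sphere_inner_resid_left:
  assumes "continuous_on UNIV p" "continuous_on UNIV g"
  shows "sphere_inner (resid E p) g = sphere_inner p g - (\<Sum>y\<in>E. sphere_inner p y * sphere_inner y g)"
proof -
  have "sphere_inner (\<lambda>x. \<Sum>z\<in>E. sphere_inner p z * z x) g = (\<Sum>y\<in>E. sphere_inner p y * sphere_inner y g)"
    using E assms(2) unfolding orthonormal_def
    by (subst sphere_inner_sum_left) (auto intro!: continuous_intros simp: sphere_inner_scale_left)
  thus ?thesis unfolding resid_def[abs_def] using sphere_inner_diff_left[OF assms(1) continuous_basis_sum assms(2)] by simp
qed

lemma resid_self:
  assumes "continuous_on UNIV p"
  shows "sphere_inner (resid E p) (resid E p) = sphere_inner p p - (\<Sum>y\<in>E. (sphere_inner p y)\<^sup>2)"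
proof -
  have "sphere_inner (resid E p) (resid E p) = sphere_inner p (resid E p) - (\<Sum>y\<in>E. sphere_inner p y * sphere_inner y (resid E p))"
    by (rule sphere_inner_resid_left[OF assms continuous_resid[OF assms]])
  also have "(\<Sum>y\<in>E. sphere_inner p y * sphere_inner y (resid E p)) = 0"
    by (rule sum.neutral) (auto simp: resid_orthogonal[OF assms] sphere_inner_commute[of _ "resid E p"])
  also have "sphere_inner p (resid E p) = sphere_inner p p - (\<Sum>y\<in>E. sphere_inner p y * sphere_inner y p)"
    using sphere_inner_resid_left[OF assms assms] sphere_inner_commute[of p "resid E p"] by simp
  also have "(\<Sum>y\<in>E. sphere_inner p y * sphere_inner y p) = (\<Sum>y\<in>E. (sphere_inner p y)\<^sup>2)"
    by (intro sum.cong refl) (simp add: power2_eq_square sphere_inner_commute)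
  finally show ?thesis by simp
qed

lemma bessel:
  assumes "continuous_on UNIV p"
  shows "(\<Sum>y\<in>E. (sphere_inner p y)\<^sup>2) \<le> sphere_inner p p"
  using resid_self[OF assms] sphere_inner_self_nonneg[of "resid E p"] by simp

lemma resid_add:
  assumes "continuous_on UNIV p" "continuous_on UNIV q"
  shows "resid E (\<lambda>x. p x + q x) = (\<lambda>x. resid E p x + resid E q x)"
proof -
  have "sphere_inner (\<lambda>x. p x + q x) y = sphere_inner p y + sphere_inner q y" if "y \<in> E" for y
    using sphere_inner_add_left assms E that unfolding orthonormal_def by blast
  thus ?thesis unfolding resid_def by (auto simp: distrib_right sum.distrib)
qed

lemma resid_scale: "resid E (\<lambda>x. c * p x) = (\<lambda>x. c * resid E p x)"
  unfolding resid_def by (auto simp: sphere_inner_scale_left right_diff_distrib sum_distrib_left mult.assoc)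

lemma captures_add:
  assumes "continuous_on UNIV p" "continuous_on UNIV q" "captures E p" "captures E q"
  shows "captures E (\<lambda>x. p x + q x)"
  using assms sphere_inner_null_add[OF continuous_resid continuous_resid]
  unfolding captures_def resid_add[OF assms(1,2)] by simp

lemma captures_scale: "captures E p \<Longrightarrow> captures E (\<lambda>x. c * p x)"
  unfolding captures_def resid_scale sphere_inner_scale_left
  by (subst sphere_inner_commute) (simp add: sphere_inner_scale_left)

lemma captures_zero: "captures E (\<lambda>_. 0)"
  unfolding captures_def resid_def[abs_def] sphere_inner_def by simp

lemma captures_orthogonal:
  assumes "continuous_on UNIV p" "continuous_on UNIV z" "captures E p" "\<And>y. y \<in> E \<Longrightarrow> sphere_inner y z = 0"
  shows "sphere_inner p z = 0"
  using sphere_inner_resid_left[OF assms(1,2)] sphere_inner_null[OF continuous_resid[OF assms(1)], of z] assms(3,4)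
  unfolding captures_def by simp

text \<open>A captured \<open>p\<close> adds nothing; otherwise its normalised residual is the new
  vector. The last clause records the shape of that vector, from which its degree is read
  off.\<close>

lemma gram_schmidt_step:
  assumes p: "continuous_on UNIV p"
  obtains E' where "orthonormal E'" "E \<subseteq> E'" "captures E' p"
    "\<And>q. continuous_on UNIV q \<Longrightarrow> captures E q \<Longrightarrow> captures E' q"
    "\<And>y. y \<in> E' - E \<Longrightarrow> \<exists>c. y = (\<lambda>x. c * resid E p x)"
proof (cases "captures E p")
  case True
  show ?thesis by (rule that[of E]) (use E True in auto)
next
  case False
  define N where "N = sphere_inner (resid E p) (resid E p)"
  have N: "0 < N" using False sphere_inner_self_nonneg[of "resid E p"] unfolding N_def captures_def by simp
  define y where "y = (\<lambda>x. 1 / sqrt N * resid E p x)"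
  have cy: "continuous_on UNIV y" unfolding y_def by (intro continuous_intros continuous_resid p)
  have yy: "sphere_inner y y = 1"
  proof -
    have "sphere_inner y y = 1 / sqrt N * sphere_inner (resid E p) y"
      unfolding y_def by (rule sphere_inner_scale_left)
    also have "sphere_inner (resid E p) y = 1 / sqrt N * N"
      unfolding N_def y_def by (subst sphere_inner_commute) (rule sphere_inner_scale_left)
    finally show ?thesis using N by (simp add: field_simps)
  qed
  have yE: "sphere_inner y z = 0" if "z \<in> E" for z
    using resid_orthogonal[OF p that] unfolding y_def by (simp add: sphere_inner_scale_left del: times_divide_eq_left)
  have Ey: "sphere_inner z y = 0" if "z \<in> E" for z
    using yE[OF that] sphere_inner_commute[of z y] by simp
  have ynot: "y \<notin> E" using yE[of y] yy by auto
  have orth: "orthonormal (insert y E)"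
    using E cy yy yE Ey ynot unfolding orthonormal_def by auto
  have res: "resid (insert y E) q = (\<lambda>x. resid E q x - sphere_inner q y * y x)" for q
    unfolding resid_def using E ynot unfolding orthonormal_def by auto
  show ?thesis
  proof (rule that[OF orth])
    have "sphere_inner p y = sphere_inner (resid E p) y"
      using sphere_inner_resid_left[OF p cy] Ey by simp
    also have "\<dots> = sqrt N"
    proof -
      have "sphere_inner (resid E p) y = 1 / sqrt N * N"
        unfolding N_def y_def by (subst sphere_inner_commute) (rule sphere_inner_scale_left)
      thus ?thesis using N by (simp add: real_div_sqrt)
    qed
    finally have "resid (insert y E) p = (\<lambda>x. 0)"
      unfolding res using N by (auto simp: y_def)
    thus "captures (insert y E) p" unfolding captures_def sphere_inner_def by simp
    fix q assume q: "continuous_on UNIV q" "captures E q"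
    have "sphere_inner q y = 0"
      by (rule captures_orthogonal[OF q(1) cy q(2) Ey])
    thus "captures (insert y E) q" using q(2) unfolding captures_def res by simp
  next
    fix y' assume "y' \<in> insert y E - E"
    hence "y' = y" by blast
    thus "\<exists>c. y' = (\<lambda>x. c * resid E p x)" unfolding y_def by blast
  qed auto
qed

end

section \<open>Existence and completeness of spherical harmonics\<close>

lemma poly_below_resid:
  assumes "finite E" "poly_below N p" "\<And>y. y \<in> E \<Longrightarrow> poly_below N y"
  shows "poly_below N (resid E p)"
  unfolding resid_def[abs_def] using assms by (intro poly_below_diff poly_below_sum poly_below.scale) auto

text \<open>The eigenvalue equation is stated weakly, against all smooth \<open>u\<close>: this is
  how it acts on the coefficients of a function, and it is insensitive to the values of
  \<open>y\<close> off the sphere.\<close>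

definition harmonic_family :: "nat \<Rightarrow> (real ^ 'n::finite \<Rightarrow> real) set \<Rightarrow> bool" where
  "harmonic_family N E \<longleftrightarrow> orthonormal E \<and>
     (\<forall>y\<in>E. poly_below N y \<and> (\<exists>k. \<forall>u. smooth u \<longrightarrow>
        sphere_inner (sphere_laplacian u) y = - sphere_eig TYPE('n) k * sphere_inner u y)) \<and>
     (\<forall>p. poly_below N p \<longrightarrow> captures E p)"

lemma poly_below_0: "poly_below 0 p \<Longrightarrow> p x = 0"
  by (induction rule: poly_below.induct) auto

lemma continuous_poly_below: "poly_below N p \<Longrightarrow> continuous_on S p"
  by (rule smooth_continuous[OF smooth_poly_below])

text \<open>Gram-Schmidt, degree by degree. A new vector \<open>y\<close> is orthogonal to all
  polynomials of lower degree, and \<open>sphere_laplacian y = q - l y\<close> on the sphere with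
  \<open>q\<close> of lower degree. By symmetry \<open><q, q> = <sphere_laplacian y, q> = <y,
  sphere_laplacian q> = 0\<close>, since the last function again has lower degree. So
  \<open>y\<close> is an eigenfunction, and no decomposition into harmonic polynomials is
  involved.\<close>

lemma harmonic_family_exists: "\<exists>E :: (real ^ 'n::finite \<Rightarrow> real) set. harmonic_family N E"
proof (induction N)
  case 0
  have o: "orthonormal ({} :: (real ^ 'n \<Rightarrow> real) set)" by (simp add: orthonormal_def)
  have "captures {} p" if "poly_below 0 p" for p :: "real ^ 'n \<Rightarrow> real"
  proof -
    have "p = (\<lambda>_. 0)" using poly_below_0[OF that] by blast
    thus ?thesis using captures_zero[OF o] by simp
  qed
  thus ?case using o unfolding harmonic_family_def by blast
next
  case (Suc N)
  then obtain E :: "(real ^ 'n \<Rightarrow> real) set" where E: "orthonormal E"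
    and EP: "\<And>y. y \<in> E \<Longrightarrow> poly_below N y"
    and Eeig: "\<And>y. y \<in> E \<Longrightarrow> \<exists>k. \<forall>u. smooth u \<longrightarrow>
        sphere_inner (sphere_laplacian u) y = - sphere_eig TYPE('n) k * sphere_inner u y"
    and Ecap: "\<And>p. poly_below N p \<Longrightarrow> captures E p"
    unfolding harmonic_family_def by blast
  \<comment> \<open>Invariant for adding the monomials of degree \<open>N\<close> one at a time:
    \<open>A\<close> is the set already treated.\<close>
  define P where "P A F \<longleftrightarrow> orthonormal F \<and> E \<subseteq> F \<and> (\<forall>y\<in>F. poly_below (Suc N) y)
      \<and> (\<forall>p. poly_below N p \<longrightarrow> captures F p) \<and> (\<forall>is\<in>A. captures F (monomial is))" for A F
  have PD: "orthonormal F" "E \<subseteq> F" "\<And>y. y \<in> F \<Longrightarrow> poly_below (Suc N) y"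
      "\<And>p. poly_below N p \<Longrightarrow> captures F p" "\<And>is. is \<in> A \<Longrightarrow> captures F (monomial is)" if "P A F" for A F
    using that unfolding P_def by simp_all
  have ex: "\<exists>F. P A F"
    if "finite A" "A \<subseteq> {is :: 'n list. length is = N}" for A
    using that
  proof (induction A rule: finite_induct)
    case empty
    have "poly_below (Suc N) y" if "y \<in> E" for y by (rule poly_below_leD[OF EP[OF that]]) simp
    hence "P {} E" using E Ecap unfolding P_def by simp
    thus ?case by blast
  next
    case (insert l A)
    then obtain F where "P A F" by auto
    note F = PD[OF this]
    have cm: "continuous_on UNIV (monomial l)" for l :: "'n list" by (rule smooth_continuous[OF smooth_monomial])
    obtain F' where F': "orthonormal F'" "F \<subseteq> F'" "captures F' (monomial l)"
      "\<And>q. continuous_on UNIV q \<Longrightarrow> captures F q \<Longrightarrow> captures F' q"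
      "\<And>y. y \<in> F' - F \<Longrightarrow> \<exists>c. y = (\<lambda>x. c * resid F (monomial l) x)"
      by (rule gram_schmidt_step[OF F(1) cm[of l]]) (rule that)
    have "poly_below (Suc N) (resid F (monomial l))"
      using F(1,3) insert.prems unfolding orthonormal_def
      by (intro poly_below_resid poly_below.mono) auto
    hence r: "poly_below (Suc N) (\<lambda>x. c * resid F (monomial l) x)" for c by (rule poly_below.scale)
    have "poly_below (Suc N) y" if y: "y \<in> F'" for y
    proof (cases "y \<in> F")
      case False
      then obtain c where "y = (\<lambda>x. c * resid F (monomial l) x)" using F'(5)[of y] y by blast
      thus ?thesis using r[of c] by simp
    qed (rule F(3))
    moreover have "captures F' p" if "poly_below N p" for p
      using F'(4)[OF continuous_poly_below[OF that] F(4)[OF that]] .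
    moreover have "captures F' (monomial is)" if "is \<in> insert l A" for "is"
      using that F'(3) F'(4)[OF cm F(5)[of "is"]] by (cases "is = l") simp_all
    moreover have "E \<subseteq> F'" using F(2) F'(2) by simp
    ultimately have "P (insert l A) F'" using F'(1) unfolding P_def by simp
    thus ?case by blast
  qed
  have "finite {is :: 'n list. length is = N}"
    using finite_lists_length_eq[of "UNIV :: 'n set" N] by simp
  from ex[OF this subset_refl] obtain F where "P {is. length is = N} F" by blast
  note F = PD[OF this]
  have cap: "captures F p" if "poly_below (Suc N) p" for p
    using that
  proof (induction rule: poly_below.induct)
    case zero
    show ?case by (rule captures_zero[OF F(1)])
  next
    case (mono "is")
    thus ?case using F(4)[OF poly_below.mono[of "is" N]] F(5)[of "is"] by (cases "length is = N") simp_all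
  next
    case (add p q)
    show ?case by (rule captures_add[OF F(1) continuous_poly_below[OF add.hyps(1)] continuous_poly_below[OF add.hyps(2)] add.IH])
  next
    case (scale p c)
    show ?case by (rule captures_scale[OF F(1) scale.IH])
  qed
  have eig: "sphere_inner (sphere_laplacian u) y = - sphere_eig TYPE('n) N * sphere_inner u y"
    if y: "y \<in> F" "y \<notin> E" and u: "smooth u" for u y
  proof -
    let ?l = "sphere_eig TYPE('n) N"
    have sy: "smooth y" using F(3)[OF y(1)] by (rule smooth_poly_below)
    have orth: "sphere_inner p y = 0" if "poly_below N p" for p
    proof (rule captures_orthogonal[OF E continuous_poly_below[OF that] _ Ecap[OF that]])
      show "continuous_on UNIV y" using sy by (rule smooth_continuous)
      show "sphere_inner z y = 0" if "z \<in> E" for z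
        using F(1,2) y that unfolding orthonormal_def by auto
    qed
    obtain q where q: "poly_below N q" "\<And>x. norm x = 1 \<Longrightarrow> sphere_laplacian y x = q x - ?l * y x"
      using sphere_laplacian_poly[OF F(3)[OF y(1)]] by blast
    \<comment> \<open>Applying the formula with index \<open>N\<close> again, although
      \<open>q\<close> has lower degree, keeps the eigenvalue \<open>?l\<close>; the difference goes
      into \<open>q2\<close>.\<close>
    obtain q2 where q2: "poly_below N q2" "\<And>x. norm x = 1 \<Longrightarrow> sphere_laplacian q x = q2 x - ?l * q x"
      using sphere_laplacian_poly[OF poly_below_leD[OF q(1), of "Suc N"]] by auto
    have c: "continuous_on UNIV y" "continuous_on UNIV q" "continuous_on UNIV q2" "continuous_on UNIV u"
      "continuous_on UNIV (sphere_laplacian y)" "continuous_on UNIV (sphere_laplacian q)"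
      using sy q(1) q2(1) u by (auto intro: smooth_continuous smooth_poly_below smooth_sphere_laplacian)
    have Ly: "sphere_inner (sphere_laplacian y) g = sphere_inner q g - ?l * sphere_inner y g" if "continuous_on UNIV g" for g
    proof -
      have "sphere_inner (sphere_laplacian y) g = sphere_inner (\<lambda>x. q x - ?l * y x) g"
        by (rule sphere_inner_cong) (use q(2) c that in \<open>auto intro!: continuous_intros\<close>)
      thus ?thesis
        using sphere_inner_diff_left[OF c(2) _ that, of "\<lambda>x. ?l * y x"] c(1)
        by (simp add: sphere_inner_scale_left continuous_on_mult_left)
    qed
    have "sphere_inner (sphere_laplacian q) y = sphere_inner (\<lambda>x. q2 x - ?l * q x) y"
      by (rule sphere_inner_cong) (use q2(2) c in \<open>auto intro!: continuous_intros\<close>)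
    also have "\<dots> = 0"
      using sphere_inner_diff_left[OF c(3) _ c(1), of "\<lambda>x. ?l * q x"] c(2) orth[OF q2(1)] orth[OF q(1)]
      by (simp add: sphere_inner_scale_left continuous_on_mult_left)
    finally have "sphere_inner (sphere_laplacian y) q = 0"
      using sphere_laplacian_symmetric[OF smooth_poly_below[OF q(1)] sy]
        sphere_inner_commute[of q "sphere_laplacian y"] by simp
    hence "sphere_inner q q = 0" using Ly[OF c(2)] orth[OF q(1)] sphere_inner_commute[of y q] by simp
    hence "sphere_inner q u = 0" by (rule sphere_inner_null[OF c(2)])
    thus ?thesis
      using Ly[OF c(4)] sphere_laplacian_symmetric[OF u sy] sphere_inner_commute[of u "sphere_laplacian y"]
        sphere_inner_commute[of u y] by simp
  qed
  have "harmonic_family (Suc N) F"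
    unfolding harmonic_family_def using F(1,3) cap eig Eeig by blast
  thus ?case by blast
qed

text \<open>The families for different \<open>N\<close> need not be nested, so the sums need not be
  monotone. Convergence comes from Stone-Weierstrass: on the sphere \<open>u\<close> is uniformly
  close to a polynomial, which every \<open>E N\<close> with large \<open>N\<close> captures, and
  projecting does not increase the norm of the remainder.\<close>

lemma parseval_limit:
  fixes u :: "real ^ 'n::finite \<Rightarrow> real"
  assumes E: "\<And>N. harmonic_family N (E N)" and u: "continuous_on UNIV u"
  shows "(\<lambda>N. \<Sum>y\<in>E N. (sphere_inner u y)\<^sup>2) \<longlonglongrightarrow> sphere_inner u u"
proof (rule LIMSEQ_I)
  fix r :: real assume r: "0 < r"
  define m where "m = measure (sphere_measure :: (real^'n) measure) UNIV"
  have m: "0 \<le> m" unfolding m_def by simp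
  \<comment> \<open>\<open>m\<close> is the total mass of the sphere, so an error \<open>e\<close>
    in the supremum norm costs \<open>e^2 * m < r\<close>; \<open>m + 1\<close> keeps the
    denominator positive.\<close>
  define e where "e = sqrt (r / (2 * (m + 1)))"
  have e: "0 < e" "e\<^sup>2 * m < r"
  proof -
    show "0 < e" unfolding e_def using r m by simp
    have "e\<^sup>2 = r / (2 * (m + 1))" unfolding e_def using r m by simp
    moreover have "m / (2 * (m + 1)) < 1" using m by (simp add: divide_less_eq)
    hence "r * (m / (2 * (m + 1))) < r * 1" by (rule mult_strict_left_mono[OF _ r])
    ultimately show "e\<^sup>2 * m < r" by simp
  qed
  obtain p where p: "real_polynomial_function p" "\<And>x. x \<in> sphere 0 1 \<Longrightarrow> \<bar>u x - p x\<bar> < e"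
    by (rule Stone_Weierstrass_real_polynomial_function[OF compact_sphere continuous_on_subset[OF u subset_UNIV] e(1)]) (rule that)
  obtain M where M: "poly_below M p" using real_polynomial_function_poly_below[OF p(1)] by blast
  have cp: "continuous_on UNIV p" using M by (rule continuous_poly_below)
  define d where "d x = u x - p x" for x
  have cd: "continuous_on UNIV d" unfolding d_def by (intro continuous_intros u cp)
  have dd: "sphere_inner d d \<le> e\<^sup>2 * m"
  proof -
    have "sphere_inner d d \<le> (\<integral> x. e\<^sup>2 \<partial>(sphere_measure :: (real^'n) measure))"
      unfolding sphere_inner_def
    proof (rule sphere_integral_mono)
      fix x :: "real ^ 'n" assume "norm x = 1"
      hence "\<bar>d x\<bar>\<^sup>2 \<le> e\<^sup>2" using p(2)[of x] unfolding d_def by (intro power_mono) auto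
      thus "d x * d x \<le> e\<^sup>2" by (simp add: power2_eq_square)
    qed (auto intro!: continuous_intros cd)
    thus ?thesis by (simp add: m_def mult.commute)
  qed
  show "\<exists>N0. \<forall>N\<ge>N0. norm ((\<Sum>y\<in>E N. (sphere_inner u y)\<^sup>2) - sphere_inner u u) < r"
  proof (intro exI[of _ M] allI impI)
    fix N assume "M \<le> N"
    have o: "orthonormal (E N)" and cap: "captures (E N) p"
      using E[of N] poly_below_leD[OF M \<open>M \<le> N\<close>] unfolding harmonic_family_def by auto
    have "u = (\<lambda>x. p x + d x)" unfolding d_def by auto
    hence "resid (E N) u = resid (E N) (\<lambda>x. p x + d x)" by (rule arg_cong)
    also note resid_add[OF o cp cd]
    finally have "resid (E N) u = (\<lambda>x. resid (E N) p x + resid (E N) d x)" .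
    hence "sphere_inner (resid (E N) u) (resid (E N) u) = sphere_inner (resid (E N) d) (resid (E N) d)"
      using sphere_inner_null_add[OF continuous_resid[OF o cp] continuous_resid[OF o cd]] cap unfolding captures_def by simp
    also have "\<dots> \<le> sphere_inner d d"
      using resid_self[OF o cd] by (simp add: sum_nonneg)
    finally have "sphere_inner u u - (\<Sum>y\<in>E N. (sphere_inner u y)\<^sup>2) < r"
      using resid_self[OF o u] dd e(2) by simp
    thus "norm ((\<Sum>y\<in>E N. (sphere_inner u y)\<^sup>2) - sphere_inner u u) < r"
      using bessel[OF o u] by simp
  qed
qed

subsection \<open>Regularity in the time variables\<close>

lemma continuous_on_uniform_family:
  fixes F :: "'p::metric_space \<Rightarrow> 'a::heine_borel \<Rightarrow> real"
  assumes F: "\<And>p. continuous_on UNIV (F p)"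
    and lim: "\<And>p K. compact K \<Longrightarrow> uniform_limit K F (F p) (at p)"
  shows "continuous_on UNIV (\<lambda>(p, x). F p x)"
proof (rule continuous_at_imp_continuous_on, intro ballI)
  fix z :: "'p \<times> 'a"
  obtain p x where z: "z = (p, x)" by (cases z)
  show "isCont (\<lambda>(p, x). F p x) z"
    unfolding continuous_at_eps_delta
  proof (intro allI impI)
    fix e :: real assume e: "0 < e"
    have "\<forall>\<^sub>F q in at p. \<forall>y\<in>cball x 1. dist (F q y) (F p y) < e / 2"
      by (rule uniform_limitD[OF lim[OF compact_cball] half_gt_zero[OF e]])
    then obtain d where d: "0 < d" "\<And>q y. q \<noteq> p \<Longrightarrow> dist q p < d \<Longrightarrow> y \<in> cball x 1 \<Longrightarrow> dist (F q y) (F p y) < e / 2"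
      unfolding eventually_at by auto
    have "isCont (F p) x" using F[of p] by (simp add: continuous_on_eq_continuous_at)
    then obtain d' where d': "0 < d'" "\<And>y. dist y x < d' \<Longrightarrow> dist (F p y) (F p x) < e / 2"
      using e unfolding continuous_at_eps_delta by (metis half_gt_zero)
    show "\<exists>d>0. \<forall>z'. dist z' z < d \<longrightarrow> dist ((\<lambda>(p, x). F p x) z') ((\<lambda>(p, x). F p x) z) < e"
    proof (intro exI[of _ "min 1 (min d d')"] conjI allI impI)
      fix z' assume dz: "dist z' z < min 1 (min d d')"
      obtain q y where z': "z' = (q, y)" by (cases z')
      have b: "dist q p < min 1 (min d d')" "dist y x < min 1 (min d d')"
        using dz dist_fst_le[of z' z] dist_snd_le[of z' z] unfolding z z' by auto
      have "dist (F q y) (F p y) < e / 2"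
        using d(2)[of q y] b e by (cases "q = p") (auto simp: dist_commute)
      moreover have "dist (F p y) (F p x) < e / 2" using d'(2)[of y] b by simp
      ultimately show "dist ((\<lambda>(p, x). F p x) z') ((\<lambda>(p, x). F p x) z) < e"
        unfolding z z' using dist_triangle[of "F q y" "F p x" "F p y"] by simp
    qed (use d d' in simp)
  qed
qed

text \<open>\<open>C1_smooth\<close> states continuity only for the time derivatives. For the
  function itself it follows from the mean value theorem, first in t and then in \<tau>, inside a
  product of balls on which both derivatives are bounded.\<close>

lemma continuous_on_partial_derivatives:
  fixes g :: "real \<Rightarrow> real \<Rightarrow> 'a::euclidean_space \<Rightarrow> real"
  assumes g: "\<And>t \<tau>. continuous_on UNIV (g t \<tau>)"
    and du: "\<And>t \<tau> x. ((\<lambda>t. g t \<tau> x) has_real_derivative gu t \<tau> x) (at t)"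
    and dv: "\<And>t \<tau> x. ((\<lambda>\<tau>. g t \<tau> x) has_real_derivative gv t \<tau> x) (at \<tau>)"
    and cu: "continuous_on UNIV (\<lambda>(t, \<tau>, x). gu t \<tau> x)" and cv: "continuous_on UNIV (\<lambda>(t, \<tau>, x). gv t \<tau> x)"
  shows "continuous_on UNIV (\<lambda>(t, \<tau>, x). g t \<tau> x)"
proof (rule continuous_at_imp_continuous_on, intro ballI)
  fix z :: "real \<times> real \<times> 'a"
  obtain t0 \<tau>0 x0 where z: "z = (t0, \<tau>0, x0)" by (cases z)
  define K where "K = cball t0 1 \<times> cball \<tau>0 1 \<times> cball x0 1"
  have K: "compact K" unfolding K_def by (intro compact_Times compact_cball)
  obtain C where C: "\<And>t \<tau> x. (t, \<tau>, x) \<in> K \<Longrightarrow> \<bar>gu t \<tau> x\<bar> \<le> C \<and> \<bar>gv t \<tau> x\<bar> \<le> C"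
  proof -
    have "bounded ((\<lambda>(t, \<tau>, x). gu t \<tau> x) ` K)" "bounded ((\<lambda>(t, \<tau>, x). gv t \<tau> x) ` K)"
      by (intro compact_imp_bounded compact_continuous_image K continuous_on_subset[OF cu] continuous_on_subset[OF cv] subset_UNIV)+
    then obtain C1 C2 where "\<And>t \<tau> x. (t, \<tau>, x) \<in> K \<Longrightarrow> \<bar>gu t \<tau> x\<bar> \<le> C1"
      "\<And>t \<tau> x. (t, \<tau>, x) \<in> K \<Longrightarrow> \<bar>gv t \<tau> x\<bar> \<le> C2"
      unfolding bounded_iff by fastforce
    thus ?thesis using that[of "max C1 C2"] by (meson max.coboundedI1 max.coboundedI2)
  qed
  have bnd: "\<bar>g t \<tau> x - g t0 \<tau>0 x\<bar> \<le> C * \<bar>t - t0\<bar> + C * \<bar>\<tau> - \<tau>0\<bar>" if "(t, \<tau>, x) \<in> K" for t \<tau> x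
  proof -
    have "norm (g t \<tau> x - g t0 \<tau> x) \<le> C * norm (t - t0)"
      by (rule field_differentiable_bound[of "cball t0 1" "\<lambda>t. g t \<tau> x" "\<lambda>t. gu t \<tau> x"])
         (use that C in \<open>auto simp: K_def intro: has_field_derivative_at_within[OF du]\<close>)
    moreover have "norm (g t0 \<tau> x - g t0 \<tau>0 x) \<le> C * norm (\<tau> - \<tau>0)"
      by (rule field_differentiable_bound[of "cball \<tau>0 1" "\<lambda>\<tau>. g t0 \<tau> x" "\<lambda>\<tau>. gv t0 \<tau> x"])
         (use that C in \<open>auto simp: K_def intro: has_field_derivative_at_within[OF dv]\<close>)
    ultimately show ?thesis by simp
  qed
  have "((\<lambda>z'. (\<lambda>(t, \<tau>, x). g t \<tau> x) z' - g t0 \<tau>0 x0) \<longlongrightarrow> 0) (at z)"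
  proof (rule Lim_null_comparison)
    have "eventually (\<lambda>z'. z' \<in> ball z 1) (at z)" 
      unfolding eventually_at by (intro exI[of _ 1]) (simp add: dist_commute)
    thus "\<forall>\<^sub>F z' in at z. norm ((\<lambda>(t, \<tau>, x). g t \<tau> x) z' - g t0 \<tau>0 x0)
      \<le> C * \<bar>fst z' - t0\<bar> + C * \<bar>fst (snd z') - \<tau>0\<bar> + \<bar>g t0 \<tau>0 (snd (snd z')) - g t0 \<tau>0 x0\<bar>"
    proof eventually_elim
      case (elim z')
      obtain t \<tau> x where z': "z' = (t, \<tau>, x)" by (cases z')
      have "dist t t0 \<le> dist z' z" "dist (\<tau>, x) (\<tau>0, x0) \<le> dist z' z"
        using dist_fst_le[of z' z] dist_snd_le[of z' z] unfolding z z' by auto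
      moreover have "dist \<tau> \<tau>0 \<le> dist (\<tau>, x) (\<tau>0, x0)" "dist x x0 \<le> dist (\<tau>, x) (\<tau>0, x0)"
        using dist_fst_le[of "(\<tau>, x)" "(\<tau>0, x0)"] dist_snd_le[of "(\<tau>, x)" "(\<tau>0, x0)"] by auto
      ultimately have "(t, \<tau>, x) \<in> K" using elim by (auto simp: K_def dist_commute)
      from bnd[OF this] show ?case unfolding z' by simp
    qed
    have "((\<lambda>z'. g t0 \<tau>0 (snd (snd z'))) \<longlongrightarrow> g t0 \<tau>0 (snd (snd z))) (at z)"
      by (rule continuous_on_tendsto_compose[OF g]) (auto intro!: tendsto_intros)
    hence "((\<lambda>z'. C * \<bar>fst z' - t0\<bar> + C * \<bar>fst (snd z') - \<tau>0\<bar> + \<bar>g t0 \<tau>0 (snd (snd z')) - g t0 \<tau>0 x0\<bar>)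
      \<longlongrightarrow> C * \<bar>fst z - t0\<bar> + C * \<bar>fst (snd z) - \<tau>0\<bar> + \<bar>g t0 \<tau>0 (snd (snd z)) - g t0 \<tau>0 x0\<bar>) (at z)"
      by (intro tendsto_intros)
    thus "((\<lambda>z'. C * \<bar>fst z' - t0\<bar> + C * \<bar>fst (snd z') - \<tau>0\<bar> + \<bar>g t0 \<tau>0 (snd (snd z')) - g t0 \<tau>0 x0\<bar>) \<longlongrightarrow> 0) (at z)"
      unfolding z by simp
  qed
  thus "isCont (\<lambda>(t, \<tau>, x). g t \<tau> x) z" unfolding isCont_def by (subst LIM_zero_iff[symmetric]) (simp add: z)
qed

text \<open>The chain rule along \<open>(c + s, s)\<close> requires total differentiability, which
  continuity of one of the two partial derivatives already provides.\<close>

lemma DERIV_diagonal: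
  fixes g :: "real \<Rightarrow> real \<Rightarrow> real"
  assumes du: "\<And>t \<tau>. ((\<lambda>t. g t \<tau>) has_real_derivative gu t \<tau>) (at t)"
    and dv: "\<And>t \<tau>. ((\<lambda>\<tau>. g t \<tau>) has_real_derivative gv t \<tau>) (at \<tau>)"
    and cv: "continuous_on UNIV (\<lambda>(t, \<tau>). gv t \<tau>)"
  shows "((\<lambda>s. g (c + s) s) has_real_derivative gu (c + s) s + gv (c + s) s) (at s)"
proof -
  have "((\<lambda>(t, \<tau>). g t \<tau>) has_derivative (\<lambda>(a, b). gu (c + s) s * a + blinfun_apply (blinfun_mult_right (gv (c + s) s)) b))
      (at (c + s, s) within UNIV \<times> UNIV)"
  proof (rule has_derivative_partialsI[where fy = "\<lambda>t \<tau>. blinfun_mult_right (gv t \<tau>)"])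
    show "((\<lambda>t. g t s) has_derivative (*) (gu (c + s) s)) (at (c + s) within UNIV)"
      using du by (simp add: has_field_derivative_def)
    show "((\<lambda>\<tau>. g t \<tau>) has_derivative blinfun_apply (blinfun_mult_right (gv t \<tau>))) (at \<tau> within UNIV)" for t \<tau>
      using dv[of t \<tau>] unfolding has_field_derivative_def by (simp add: blinfun_mult_right.rep_eq)
    have "continuous_on UNIV (\<lambda>z. blinfun_mult_right ((\<lambda>(t, \<tau>). gv t \<tau>) z))"
      by (intro bounded_linear.continuous_on[OF bounded_linear_blinfun_mult_right] cv)
    thus "continuous (at (c + s, s) within UNIV \<times> UNIV) (\<lambda>(t, \<tau>). blinfun_mult_right (gv t \<tau>))"
      by (simp add: continuous_on_eq_continuous_at case_prod_unfold)
  qed auto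
  hence d: "((\<lambda>(t, \<tau>). g t \<tau>) has_derivative (\<lambda>(a, b). gu (c + s) s * a + gv (c + s) s * b)) (at (c + s, s))"
    by (simp add: blinfun_mult_right.rep_eq)
  have "((\<lambda>s. (c + s, s)) has_derivative (\<lambda>h. (h, h))) (at s)"
    by (auto intro!: derivative_eq_intros)
  from diff_chain_at[OF this d] have dd: "((\<lambda>s. g (c + s) s) has_derivative (\<lambda>h. gu (c + s) s * h + gv (c + s) s * h)) (at s)"
    by (simp add: o_def)
  show ?thesis
  proof -
    have "(*) (gu (c + s) s + gv (c + s) s) = (\<lambda>h. gu (c + s) s * h + gv (c + s) s * h)" by (auto simp: distrib_right)
    thus ?thesis using dd unfolding has_field_derivative_def by (simp only:)
  qed
qed

text \<open>Difference quotients in time commute with \<open>partials\<close>, so convergence in the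
  Frechet topology, read at single points, says that every space derivative of \<open>w\<close> is
  differentiable in time.\<close>

lemma C1_smoothE:
  fixes w :: "real \<Rightarrow> real \<Rightarrow> real ^ 'n::finite \<Rightarrow> real"
  assumes "C1_smooth w"
  obtains u v where "\<And>t \<tau>. smooth (w t \<tau>)" "\<And>t \<tau>. smooth (u t \<tau>)" "\<And>t \<tau>. smooth (v t \<tau>)"
    "\<And>t \<tau> is x. ((\<lambda>t. partials is (w t \<tau>) x) has_real_derivative partials is (u t \<tau>) x) (at t)"
    "\<And>t \<tau> is x. ((\<lambda>\<tau>. partials is (w t \<tau>) x) has_real_derivative partials is (v t \<tau>) x) (at \<tau>)"
    "\<And>is. continuous_on UNIV (\<lambda>(t, \<tau>, x). partials is (w t \<tau>) x)"
    "\<And>is. continuous_on UNIV (\<lambda>(t, \<tau>, x). partials is (u t \<tau>) x)"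
    "\<And>is. continuous_on UNIV (\<lambda>(t, \<tau>, x). partials is (v t \<tau>) x)"
proof -
  obtain u v where sw: "\<And>t \<tau>. smooth (w t \<tau>)" and su: "\<And>t \<tau>. smooth (u t \<tau>)" and sv: "\<And>t \<tau>. smooth (v t \<tau>)"
    and lu: "\<And>t \<tau>. smooth_tendsto (\<lambda>h x. (w (t + h) \<tau> x - w t \<tau> x) / h) (u t \<tau>) (at 0)"
    and lv: "\<And>t \<tau>. smooth_tendsto (\<lambda>h x. (w t (\<tau> + h) x - w t \<tau> x) / h) (v t \<tau>) (at 0)"
    and cu: "\<And>t \<tau>. smooth_tendsto (\<lambda>(s, \<sigma>). u s \<sigma>) (u t \<tau>) (at (t, \<tau>))"
    and cv: "\<And>t \<tau>. smooth_tendsto (\<lambda>(s, \<sigma>). v s \<sigma>) (v t \<tau>) (at (t, \<tau>))"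
  proof -
    from assms have sw: "\<And>t \<tau>. smooth (w t \<tau>)" unfolding C1_smooth_def by simp
    from assms obtain u v where uv: "\<forall>t \<tau>. smooth (u t \<tau>) \<and> smooth (v t \<tau>) \<and>
        smooth_tendsto (\<lambda>h x. (w (t + h) \<tau> x - w t \<tau> x) / h) (u t \<tau>) (at 0) \<and>
        smooth_tendsto (\<lambda>h x. (w t (\<tau> + h) x - w t \<tau> x) / h) (v t \<tau>) (at 0) \<and>
        smooth_tendsto (\<lambda>(s, \<sigma>). u s \<sigma>) (u t \<tau>) (at (t, \<tau>)) \<and>
        smooth_tendsto (\<lambda>(s, \<sigma>). v s \<sigma>) (v t \<tau>) (at (t, \<tau>))" unfolding C1_smooth_def by (elim conjE exE)
    show thesis by (rule that[of u v]) (simp_all add: sw uv)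
  qed
  have q: "partials is (\<lambda>x. (f x - g x) / h) x = (partials is f x - partials is g x) / h"
    if "smooth f" "smooth g" for f g :: "real ^ 'n \<Rightarrow> real" and h x "is"
    using partials_cmult[OF smooth_diff[OF that], of "is" "1 / h" x] partials_diff[OF that, of "is" x] by simp
  have pt: "((\<lambda>h. partials is (G h) x) \<longlongrightarrow> partials is f x) F" if "smooth_tendsto G f F" for G f F "is" and x :: "real ^ 'n"
  proof -
    have "uniform_limit {x} (\<lambda>h. partials is (G h)) (partials is f) F"
      using that compact_sing[of x] unfolding smooth_tendsto_def by blast
    thus ?thesis by (rule tendsto_uniform_limitI) simp
  qed
  have du: "((\<lambda>t. partials is (w t \<tau>) x) has_real_derivative partials is (u t \<tau>) x) (at t)" for t \<tau> x "is"
    using pt[OF lu[of t \<tau>], of "is" x] unfolding DERIV_def q[OF sw sw] .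
  have dv: "((\<lambda>\<tau>. partials is (w t \<tau>) x) has_real_derivative partials is (v t \<tau>) x) (at \<tau>)" for t \<tau> x "is"
    using pt[OF lv[of t \<tau>], of "is" x] unfolding DERIV_def q[OF sw sw] .
  have jc: "continuous_on UNIV (\<lambda>(t, \<tau>, x). partials is (f t \<tau>) x)"
    if "\<And>t \<tau>. smooth (f t \<tau>)" "\<And>t \<tau>. smooth_tendsto (\<lambda>(s, \<sigma>). f s \<sigma>) (f t \<tau>) (at (t, \<tau>))"
    for f :: "real \<Rightarrow> real \<Rightarrow> real ^ 'n \<Rightarrow> real" and "is"
  proof -
    have 1: "continuous_on UNIV (\<lambda>(p, x). (\<lambda>p. partials is (f (fst p) (snd p))) p x)"
    proof (rule continuous_on_uniform_family)
      show "continuous_on UNIV (partials is (f (fst p) (snd p)))" for p :: "real \<times> real"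
        by (intro smooth_continuous smooth_partials that)
      show "uniform_limit K (\<lambda>p. partials is (f (fst p) (snd p))) (partials is (f (fst p) (snd p))) (at p)"
        if "compact K" for K and p :: "real \<times> real"
        using that \<open>\<And>t \<tau>. smooth_tendsto (\<lambda>(s, \<sigma>). f s \<sigma>) (f t \<tau>) (at (t, \<tau>))\<close>[of "fst p" "snd p"]
        unfolding smooth_tendsto_def by (simp add: case_prod_unfold)
    qed
    have "continuous_on UNIV (\<lambda>z. (\<lambda>(p, x). partials is (f (fst p) (snd p)) x) ((fst z, fst (snd z)), snd (snd z)))"
      by (rule continuous_on_compose2[OF 1]) (auto intro!: continuous_intros)
    thus ?thesis by (simp add: case_prod_unfold)
  qed
  have jw: "continuous_on UNIV (\<lambda>(t, \<tau>, x). partials is (w t \<tau>) x)" for "is"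
    by (rule continuous_on_partial_derivatives[OF _ du dv jc[OF su cu] jc[OF sv cv]])
       (intro smooth_continuous smooth_partials sw)
  show ?thesis by (rule that[OF sw su sv du dv jw jc[OF su cu] jc[OF sv cv]])
qed

subsection \<open>Reduction to spherical modes\<close>

text \<open>Polarisation of \<open>parseval_limit\<close>.\<close>

lemma parseval_limit_inner:
  fixes u v :: "real ^ 'n::finite \<Rightarrow> real"
  assumes E: "\<And>N. harmonic_family N (E N)" and u: "continuous_on UNIV u" and v: "continuous_on UNIV v"
  shows "(\<lambda>N. \<Sum>y\<in>E N. sphere_inner u y * sphere_inner v y) \<longlonglongrightarrow> sphere_inner u v"
proof -
  have cE: "continuous_on UNIV y" if "y \<in> E N" for y N
    using E[of N] that unfolding harmonic_family_def orthonormal_def by blast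
  have uv: "continuous_on UNIV (\<lambda>x. u x + v x)" by (intro continuous_intros u v)
  have a: "sphere_inner (\<lambda>x. u x + v x) y = sphere_inner u y + sphere_inner v y" if "continuous_on UNIV y" for y
    by (rule sphere_inner_add_left[OF u v that])
  have s: "sphere_inner (\<lambda>x. u x + v x) (\<lambda>x. u x + v x) = sphere_inner u u + 2 * sphere_inner u v + sphere_inner v v"
    using a[OF uv] a[OF u] a[OF v] sphere_inner_commute[of u "\<lambda>x. u x + v x"] sphere_inner_commute[of v "\<lambda>x. u x + v x"]
      sphere_inner_commute[of v u] by simp
  have lim: "(\<lambda>N. 1/2 * ((\<Sum>y\<in>E N. (sphere_inner (\<lambda>x. u x + v x) y)\<^sup>2) - (\<Sum>y\<in>E N. (sphere_inner u y)\<^sup>2) - (\<Sum>y\<in>E N. (sphere_inner v y)\<^sup>2)))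
     \<longlonglongrightarrow> 1/2 * (sphere_inner (\<lambda>x. u x + v x) (\<lambda>x. u x + v x) - sphere_inner u u - sphere_inner v v)"
    by (intro tendsto_intros parseval_limit E u v uv)
  have eq: "(\<Sum>y\<in>E N. sphere_inner u y * sphere_inner v y)
      = 1/2 * ((\<Sum>y\<in>E N. (sphere_inner (\<lambda>x. u x + v x) y)\<^sup>2) - (\<Sum>y\<in>E N. (sphere_inner u y)\<^sup>2) - (\<Sum>y\<in>E N. (sphere_inner v y)\<^sup>2))" for N
    unfolding sum_subtractf[symmetric] sum_distrib_left
    by (intro sum.cong refl) (simp add: a[OF cE] power2_sum)
  show ?thesis using lim unfolding eq[symmetric] s by simp
qed

lemma continuous_on_ray:
  fixes G :: "real \<Rightarrow> real ^ 'n::finite \<Rightarrow> real"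
  assumes "continuous_on UNIV (\<lambda>(s, x). G s x)"
  shows "continuous_on UNIV (\<lambda>(z, x). G (fst z) (exp (- snd z) *\<^sub>R x))"
proof -
  have "continuous_on UNIV (\<lambda>q. (\<lambda>(s, x). G s x) (fst (fst q), exp (- snd (fst q)) *\<^sub>R snd q))"
    by (rule continuous_on_compose2[OF assms]) (auto intro!: continuous_intros)
  thus ?thesis by (simp add: case_prod_unfold)
qed

lemma continuous_on_ray_mode:
  fixes G :: "real \<Rightarrow> real ^ 'n::finite \<Rightarrow> real"
  assumes G: "continuous_on UNIV (\<lambda>(s, x). G s x)" and Y: "continuous_on UNIV Y"
  shows "continuous_on UNIV (\<lambda>(s, y). sphere_inner (\<lambda>x. G s (exp (- y) *\<^sub>R x)) Y)"
proof -
  have "continuous_on UNIV (\<lambda>(z, x). G (fst z) (exp (- snd z) *\<^sub>R x) * Y x)"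
    using continuous_on_mult[OF continuous_on_ray[OF G], of "\<lambda>(z, x). Y x"] continuous_on_compose2[OF Y, of UNIV snd]
    by (simp add: case_prod_unfold continuous_on_snd)
  from continuous_on_sphere_integral[OF this] show ?thesis
    unfolding sphere_inner_def by (simp add: case_prod_unfold)
qed

lemma DERIV_mode_radial:
  fixes f :: "real ^ 'n::finite \<Rightarrow> real"
  assumes f: "smooth f" and Y: "continuous_on UNIV Y"
  shows "((\<lambda>y. sphere_inner (\<lambda>x. f (exp (- y) *\<^sub>R x)) Y) has_real_derivative
    - sphere_inner (\<lambda>x. euler f (exp (- y) *\<^sub>R x)) Y) (at y)"
proof -
  have "((\<lambda>y. \<integral> x. f (exp (- y) *\<^sub>R x) * Y x \<partial>sphere_measure) has_real_derivative
      (\<integral> x. - euler f (exp (- y) *\<^sub>R x) * Y x \<partial>sphere_measure)) (at y)"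
  proof (rule DERIV_sphere_integral)
    show "continuous_on UNIV (\<lambda>x. f (exp (- y) *\<^sub>R x) * Y x)" for y
      by (intro continuous_intros Y continuous_on_compose2[OF smooth_continuous[OF f]]) auto
    show "continuous_on UNIV (\<lambda>(y, x). - euler f (exp (- y) *\<^sub>R x) * Y x)"
      unfolding case_prod_unfold
      by (intro continuous_intros continuous_on_compose2[OF Y] continuous_on_compose2[OF smooth_continuous[OF smooth_euler[OF f]]]) auto
    show "((\<lambda>y. f (exp (- y) *\<^sub>R x) * Y x) has_real_derivative - euler f (exp (- y) *\<^sub>R x) * Y x) (at y)" for y x
      by (rule DERIV_cmult_right[OF DERIV_ray[OF f]])
  qed
  thus ?thesis unfolding sphere_inner_def by simp
qed

lemma DERIV_mode_time:
  fixes G :: "real \<Rightarrow> real ^ 'n::finite \<Rightarrow> real"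
  assumes G: "\<And>s. continuous_on UNIV (G s)" and G': "continuous_on UNIV (\<lambda>(s, x). G' s x)"
    and d: "\<And>s x. ((\<lambda>s. G s x) has_real_derivative G' s x) (at s)" and Y: "continuous_on UNIV Y"
  shows "((\<lambda>s. sphere_inner (\<lambda>x. G s (exp (- y) *\<^sub>R x)) Y) has_real_derivative
    sphere_inner (\<lambda>x. G' s (exp (- y) *\<^sub>R x)) Y) (at s)"
  unfolding sphere_inner_def
proof (rule DERIV_sphere_integral)
  show "continuous_on UNIV (\<lambda>x. G s (exp (- y) *\<^sub>R x) * Y x)" for s
    by (intro continuous_intros Y continuous_on_compose2[OF G]) auto
  have "continuous_on UNIV (\<lambda>z. (\<lambda>(s, x). G' s x) (fst z, exp (- y) *\<^sub>R snd z))"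
    by (rule continuous_on_compose2[OF G']) (auto intro!: continuous_intros)
  thus "continuous_on UNIV (\<lambda>(s, x). G' s (exp (- y) *\<^sub>R x) * Y x)"
    unfolding case_prod_unfold fst_conv snd_conv
    by (intro continuous_intros continuous_on_compose2[OF Y]) auto
  show "((\<lambda>s. G s (exp (- y) *\<^sub>R x) * Y x) has_real_derivative G' s (exp (- y) *\<^sub>R x) * Y x) (at s)" for s x
    by (rule DERIV_cmult_right[OF d])
qed

text \<open>Projection of the polar form of the equation onto \<open>Y\<close>. The angular
  Laplacian commutes with dilations, so the eigenvalue relation applies at every radius. The left
  side is arranged as \<open>b2 - m b1 - k (k + m) b - exp (- 2 y) bs\<close>, where
  \<open>b1\<close> is minus the \<open>euler\<close> coefficient because y decreases with the
  radius; hence the double sign.\<close>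

lemma sphere_eig_radial:
  fixes W Ws :: "real ^ 'n::finite \<Rightarrow> real"
  assumes W: "smooth W" and Ws: "continuous_on UNIV Ws" and Y: "continuous_on UNIV Y"
    and eig: "\<And>u. smooth u \<Longrightarrow> sphere_inner (sphere_laplacian u) Y = - sphere_eig TYPE('n) k * sphere_inner u Y"
  shows "sphere_inner (\<lambda>x. euler (euler W) (exp (- y) *\<^sub>R x)) Y
      - (real CARD('n) - 2) * - sphere_inner (\<lambda>x. euler W (exp (- y) *\<^sub>R x)) Y
      - sphere_eig TYPE('n) k * sphere_inner (\<lambda>x. W (exp (- y) *\<^sub>R x)) Y
      - exp (- 2 * y) * sphere_inner (\<lambda>x. Ws (exp (- y) *\<^sub>R x)) Y
    = sphere_inner (\<lambda>x. exp (- 2 * y) * (laplacian W (exp (- y) *\<^sub>R x) - Ws (exp (- y) *\<^sub>R x))) Y"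
proof -
  let ?e = "exp (- y)" and ?m = "real CARD('n) - 2"
  have c: "continuous_on UNIV (\<lambda>x. G (?e *\<^sub>R x))" if "continuous_on UNIV G" for G :: "real ^ 'n \<Rightarrow> real"
    by (rule continuous_on_compose2[OF that]) (auto intro!: continuous_intros)
  note cc [continuous_intros] = c[OF smooth_continuous[OF W]] c[OF smooth_continuous[OF smooth_euler[OF W]]]
    c[OF smooth_continuous[OF smooth_euler[OF smooth_euler[OF W]]]]
    c[OF smooth_continuous[OF smooth_sphere_laplacian[OF W]]] c[OF smooth_continuous[OF smooth_laplacian[OF W]]] c[OF Ws]
  have e2: "exp (- 2 * y) = ?e\<^sup>2" by (simp add: power2_eq_square flip: exp_add)
  have "sphere_inner (\<lambda>x. exp (- 2 * y) * (laplacian W (?e *\<^sub>R x) - Ws (?e *\<^sub>R x))) Y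
    = sphere_inner (\<lambda>x. (euler (euler W) (?e *\<^sub>R x) + ?m * euler W (?e *\<^sub>R x)) + (sphere_laplacian W (?e *\<^sub>R x) - exp (- 2 * y) * Ws (?e *\<^sub>R x))) Y"
  proof (rule sphere_inner_cong)
    fix x :: "real ^ 'n" assume "norm x = 1"
    hence "exp (- 2 * y) * laplacian W (?e *\<^sub>R x) = euler (euler W) (?e *\<^sub>R x) + ?m * euler W (?e *\<^sub>R x) + sphere_laplacian W (?e *\<^sub>R x)"
      using laplacian_polar[OF W, of "?e *\<^sub>R x"] unfolding e2 by simp
    thus "exp (- 2 * y) * (laplacian W (?e *\<^sub>R x) - Ws (?e *\<^sub>R x))
      = (euler (euler W) (?e *\<^sub>R x) + ?m * euler W (?e *\<^sub>R x)) + (sphere_laplacian W (?e *\<^sub>R x) - exp (- 2 * y) * Ws (?e *\<^sub>R x))"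
      unfolding right_diff_distrib by simp
  qed (intro continuous_intros Y)+
  also have "\<dots> = sphere_inner (\<lambda>x. euler (euler W) (?e *\<^sub>R x)) Y + ?m * sphere_inner (\<lambda>x. euler W (?e *\<^sub>R x)) Y
    + (sphere_inner (\<lambda>x. sphere_laplacian W (?e *\<^sub>R x)) Y - exp (- 2 * y) * sphere_inner (\<lambda>x. Ws (?e *\<^sub>R x)) Y)"
    by (subst sphere_inner_add_left sphere_inner_diff_left sphere_inner_scale_left, (intro continuous_intros Y)+)+ (simp only: sphere_inner_scale_left)
  also have "sphere_inner (\<lambda>x. sphere_laplacian W (?e *\<^sub>R x)) Y = - sphere_eig TYPE('n) k * sphere_inner (\<lambda>x. W (?e *\<^sub>R x)) Y"
  proof -
    have "(\<lambda>x. sphere_laplacian W (?e *\<^sub>R x)) = sphere_laplacian (\<lambda>x. W (?e *\<^sub>R x))"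
      using sphere_laplacian_dilate[OF W] by auto
    thus ?thesis using eig[OF smooth_dilate(1)[OF W]] by simp
  qed
  finally show ?thesis by simp
qed

lemma nn_integral_polar_weight:
  fixes H :: "real ^ 'n::finite \<Rightarrow> real"
  assumes h: "continuous_on UNIV h" "\<And>y. 0 \<le> h y" and H: "continuous_on UNIV H" "\<And>x. 0 \<le> H x"
  shows "(\<integral>\<^sup>+ x. ennreal (h (- ln (norm x)) * (1 / norm x ^ CARD('n)) * H x) \<partial>lborel)
    = (\<integral>\<^sup>+ y. ennreal (h y * (\<integral> x. H (exp (- y) *\<^sub>R x) \<partial>sphere_measure)) \<partial>lborel)"
proof -
  have [measurable]: "h \<in> borel_measurable borel" "H \<in> borel_measurable borel"
    using borel_measurable_continuous_onI h(1) H(1) by auto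
  have "(\<integral>\<^sup>+ x. ennreal (h (- ln (norm x)) * (1 / norm x ^ CARD('n)) * H x) \<partial>lborel)
    = (\<integral>\<^sup>+ x. ennreal (1 / norm x ^ DIM(real ^ 'n)) * ennreal (h (- ln (norm x)) * H x) \<partial>lborel)"
    by (intro nn_integral_cong, subst ennreal_mult'[symmetric]) (auto simp: ac_simps)
  also have "\<dots> = (\<integral>\<^sup>+ y. \<integral>\<^sup>+ x. ennreal (h (- ln (norm (exp (- y) *\<^sub>R x))) * H (exp (- y) *\<^sub>R x)) \<partial>sphere_measure \<partial>lborel)"
    by (rule nn_integral_polar) measurable
  also have "\<dots> = (\<integral>\<^sup>+ y. ennreal (h y * (\<integral> x. H (exp (- y) *\<^sub>R x) \<partial>sphere_measure)) \<partial>lborel)"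
  proof (rule nn_integral_cong)
    fix y :: real
    have cH: "continuous_on UNIV (\<lambda>x. h y * H (exp (- y) *\<^sub>R x))"
      by (intro continuous_intros continuous_on_compose2[OF H(1)]) auto
    have "(\<integral>\<^sup>+ x. ennreal (h (- ln (norm (exp (- y) *\<^sub>R x))) * H (exp (- y) *\<^sub>R x)) \<partial>sphere_measure)
      = (\<integral>\<^sup>+ x. ennreal (h y * H (exp (- y) *\<^sub>R x)) \<partial>sphere_measure)"
    proof (rule nn_integral_cong_AE)
      show "AE x in sphere_measure. ennreal (h (- ln (norm (exp (- y) *\<^sub>R (x::real^'n)))) * H (exp (- y) *\<^sub>R x))
          = ennreal (h y * H (exp (- y) *\<^sub>R x))"
        using AE_sphere_measure by eventually_elim simp
    qed
    also have "\<dots> = ennreal (\<integral> x. h y * H (exp (- y) *\<^sub>R x) \<partial>sphere_measure)"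
      by (rule nn_integral_eq_integral[OF integrable_sphere_continuous[OF cH]]) (use h H in auto)
    finally show "(\<integral>\<^sup>+ x. ennreal (h (- ln (norm (exp (- y) *\<^sub>R x))) * H (exp (- y) *\<^sub>R x)) \<partial>sphere_measure)
      = ennreal (h y * (\<integral> x. H (exp (- y) *\<^sub>R x) \<partial>sphere_measure))" by simp
  qed
  finally show ?thesis .
qed

section \<open>Joint continuity of the space derivatives of a family\<close>

context
  fixes W :: "'p::topological_space \<Rightarrow> real ^ 'n::finite \<Rightarrow> real"
  assumes sW: "\<And>s. smooth (W s)"
    and cW: "\<And>is. continuous_on UNIV (\<lambda>(s, x). partials is (W s) x)"
begin

lemma continuous_on_family: "continuous_on UNIV (\<lambda>(s, x). W s x)"
  using cW[of "[]"] by simp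

lemma continuous_on_family_partial: "continuous_on UNIV (\<lambda>z. partial i (W (fst z)) (snd z))"
  using cW[of "[i]"] by (simp add: case_prod_unfold)

lemma continuous_on_family_partial2: "continuous_on UNIV (\<lambda>z. partial j (partial i (W (fst z))) (snd z))"
  using cW[of "[j, i]"] by (simp add: case_prod_unfold)

lemma continuous_on_family_euler: "continuous_on UNIV (\<lambda>(s, x). euler (W s) x)"
  unfolding euler_def case_prod_unfold by (intro continuous_intros continuous_on_family_partial)

lemma continuous_on_family_euler2: "continuous_on UNIV (\<lambda>(s, x). euler (euler (W s)) x)"
  unfolding euler_euler[OF sW] case_prod_unfold
  by (intro continuous_intros continuous_on_family_partial2 continuous_on_family_euler[unfolded case_prod_unfold])

lemma continuous_on_family_laplacian: "continuous_on UNIV (\<lambda>(s, x). laplacian (W s) x)"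
  unfolding laplacian_def case_prod_unfold by (intro continuous_intros continuous_on_family_partial2)

lemma continuous_on_family_gradient: "continuous_on UNIV (\<lambda>(s, x). (norm (gradient (W s) x))\<^sup>2)"
  unfolding norm_power2_vec case_prod_unfold gradient_def by (simp, intro continuous_intros continuous_on_family_partial)

end

text \<open>The angular part of the gradient is written as \<open>- <sphere_laplacian u, u>\<close>,
  because Parseval turns this product into a sum over modes weighted by the eigenvalues, as on the
  left of \<open>mode_estimate\<close>. The constant \<open>c\<close> is 1 in the finiteness
  condition and \<beta>^2 in the estimate.\<close>

lemma energy_ray:
  fixes f :: "real ^ 'n::finite \<Rightarrow> real" and y :: real
  assumes f: "smooth f"
  defines "u \<equiv> \<lambda>x. f (exp (- y) *\<^sub>R x)"
  shows "(\<integral> x. (norm (exp (- y) *\<^sub>R x))\<^sup>2 * (norm (gradient f (exp (- y) *\<^sub>R x)))\<^sup>2 + c * (f (exp (- y) *\<^sub>R x))\<^sup>2 \<partial>sphere_measure)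
    = sphere_inner (euler u) (euler u) - sphere_inner (sphere_laplacian u) u + c * sphere_inner u u"
proof -
  have su: "smooth u" unfolding u_def by (rule smooth_dilate(1)[OF f])
  have cs: "continuous_on UNIV (euler u)" "continuous_on UNIV u" "continuous_on UNIV (rotder i j u)" for i j
    using su by (auto intro: smooth_continuous smooth_euler smooth_rotder)
  have int: "integrable sphere_measure (\<lambda>x. (euler u x)\<^sup>2)" "integrable sphere_measure (\<lambda>x. (u x)\<^sup>2)"
    "integrable sphere_measure (\<lambda>x. (rotder i j u x)\<^sup>2)" for i j
    by (intro integrable_sphere_continuous continuous_intros cs)+
  have "(norm (exp (- y) *\<^sub>R x))\<^sup>2 * (norm (gradient f (exp (- y) *\<^sub>R x)))\<^sup>2 + c * (f (exp (- y) *\<^sub>R x))\<^sup>2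
    = (euler u x)\<^sup>2 + (1/2 * (\<Sum>i\<in>UNIV. \<Sum>j\<in>UNIV. (rotder i j u x)\<^sup>2) + c * (u x)\<^sup>2)" for x
    unfolding gradient_polar u_def euler_dilate[OF f] rotder_dilate[OF f] by simp
  hence "(\<integral> x. (norm (exp (- y) *\<^sub>R x))\<^sup>2 * (norm (gradient f (exp (- y) *\<^sub>R x)))\<^sup>2 + c * (f (exp (- y) *\<^sub>R x))\<^sup>2 \<partial>sphere_measure)
    = (\<integral> x. (euler u x)\<^sup>2 + (1/2 * (\<Sum>i\<in>UNIV. \<Sum>j\<in>UNIV. (rotder i j u x)\<^sup>2) + c * (u x)\<^sup>2) \<partial>sphere_measure)"
    by (simp only:)
  also have "\<dots> = sphere_inner (euler u) (euler u) + (1/2 * (\<Sum>i\<in>UNIV. \<Sum>j\<in>UNIV. sphere_inner (rotder i j u) (rotder i j u)) + c * sphere_inner u u)"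
    unfolding sphere_inner_def power2_eq_square[symmetric] by (simp add: int)
  finally show ?thesis using sphere_inner_sphere_laplacian_sum[OF su su] by simp
qed

text \<open>Sums \<open>mode_estimate\<close> over the harmonics of \<open>E N\<close>. Bessel's
  inequality bounds the right-hand sides independently of \<open>N\<close>, and Parseval recovers
  the full energy on the left as \<open>N\<close> grows.\<close>

lemma slice_estimate:
  fixes W Ws :: "real \<Rightarrow> real ^ 'n::finite \<Rightarrow> real"
  assumes n: "2 \<le> CARD('n)"
    and sW: "\<And>s. smooth (W s)" and sWs: "\<And>s. smooth (Ws s)"
    and d: "\<And>is s x. ((\<lambda>s. partials is (W s) x) has_real_derivative partials is (Ws s) x) (at s)"
    and cW: "\<And>is. continuous_on UNIV (\<lambda>(s, x). partials is (W s) x)"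
    and cWs: "\<And>is. continuous_on UNIV (\<lambda>(s, x). partials is (Ws s) x)"
    and supp: "\<And>s x. exp 1 \<le> norm x \<or> R < \<bar>s\<bar> \<Longrightarrow> W s x = 0"
    and par: "\<beta> = real j + 1/4" "2 \<le> \<beta>"
  defines "Q \<equiv> \<lambda>c s y. \<integral> x. (norm (exp (- y) *\<^sub>R x))\<^sup>2 * (norm (gradient (W s) (exp (- y) *\<^sub>R x)))\<^sup>2 + c * (W s (exp (- y) *\<^sub>R x))\<^sup>2 \<partial>sphere_measure"
  defines "F \<equiv> \<lambda>s y x. exp (- 2 * y) * (laplacian (W s) (exp (- y) *\<^sub>R x) - Ws s (exp (- y) *\<^sub>R x))"
  assumes fin: "(\<integral>\<^sup>+ (s, y). ennreal ((exp (psi \<beta> y))\<^sup>2 * Q 1 s y) \<partial>lborel) < \<infinity>"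
  shows "(\<integral>\<^sup>+ (s, y). ennreal ((exp (psi \<beta> y))\<^sup>2 * (1 + conj_convexity \<beta> y) * Q (\<beta>\<^sup>2) s y) \<partial>lborel)
    \<le> 420 * (\<integral>\<^sup>+ (s, y). ennreal ((exp (psi \<beta> y))\<^sup>2 * (\<integral> x. (F s y x)\<^sup>2 \<partial>sphere_measure)) \<partial>lborel)"
proof -
  define m where "m = real CARD('n) - 2"
  have m: "0 \<le> m" using n unfolding m_def by simp
  define w where "w y = (exp (psi \<beta> y))\<^sup>2 * (1 + conj_convexity \<beta> y)" for y
  have w: "0 \<le> w y" for y using par unfolding w_def conj_convexity_def by simp
  have cw: "continuous_on UNIV (\<lambda>z::real\<times>real. w (snd z))" and ce: "continuous_on UNIV (\<lambda>z::real\<times>real. (exp (psi \<beta> (snd z)))\<^sup>2)"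
    unfolding w_def psi_def conj_convexity_def by (auto intro!: continuous_intros)
  obtain E :: "nat \<Rightarrow> (real ^ 'n \<Rightarrow> real) set" where E: "\<And>N. harmonic_family N (E N)"
    using harmonic_family_exists by metis
  have oE: "orthonormal (E N)" for N using E[of N] unfolding harmonic_family_def by blast
  have finE: "finite (E N)" and cE: "Y \<in> E N \<Longrightarrow> continuous_on UNIV Y" for N Y
    using oE[of N] unfolding orthonormal_def by blast+
  \<comment> \<open>The family only asserts that each harmonic has some degree; one is chosen per
    function.\<close>
  define k where "k Y = (SOME k. \<forall>u. smooth u \<longrightarrow>
      sphere_inner (sphere_laplacian u) Y = - sphere_eig TYPE('n) k * sphere_inner u Y)" for Y :: "real ^ 'n \<Rightarrow> real"
  have k: "sphere_inner (sphere_laplacian u) Y = - sphere_eig TYPE('n) (k Y) * sphere_inner u Y"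
    if "Y \<in> E N" "smooth u" for Y N u
  proof -
    have "\<exists>k. \<forall>u. smooth u \<longrightarrow> sphere_inner (sphere_laplacian u) Y = - sphere_eig TYPE('n) k * sphere_inner u Y"
      using E[of N] that(1) unfolding harmonic_family_def by blast
    from someI_ex[OF this] that(2) show ?thesis unfolding k_def by blast
  qed
  define U where "U s y x = W s (exp (- y) *\<^sub>R x)" for s y and x :: "real ^ 'n"
  have sU: "smooth (U s y)" for s y unfolding U_def by (rule smooth_dilate(1)[OF sW])
  have eU: "euler (U s y) = (\<lambda>x. euler (W s) (exp (- y) *\<^sub>R x))" for s y
    unfolding U_def using euler_dilate[OF sW] by auto
  have Qe: "Q c s y = sphere_inner (euler (U s y)) (euler (U s y)) - sphere_inner (sphere_laplacian (U s y)) (U s y) + c * sphere_inner (U s y) (U s y)" for c s y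
    unfolding Q_def U_def by (rule energy_ray[OF sW])
  define b where "b Y s y = sphere_inner (U s y) Y" for Y s y
  define b1 where "b1 Y s y = - sphere_inner (euler (U s y)) Y" for Y s y
  define q where "q N s y = (\<Sum>Y\<in>E N. (b1 Y s y)\<^sup>2 + (sphere_eig TYPE('n) (k Y) + \<beta>\<^sup>2) * (b Y s y)\<^sup>2)" for N s y
  define f where "f Y s y = sphere_inner (F s y) Y" for Y s y
  have cUs: "continuous_on UNIV (U s y)" "continuous_on UNIV (euler (U s y))" "continuous_on UNIV (sphere_laplacian (U s y))" for s y
    using sU by (auto intro: smooth_continuous smooth_euler smooth_sphere_laplacian)
  have cF: "continuous_on UNIV (F s y)" for s y
    unfolding F_def
    by (intro continuous_intros continuous_on_compose2[OF smooth_continuous[OF smooth_laplacian[OF sW]]]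
        continuous_on_compose2[OF smooth_continuous[OF sWs]]) auto
  have q_lim: "(\<lambda>N. q N s y) \<longlonglongrightarrow> Q (\<beta>\<^sup>2) s y" for s y
  proof -
    have "q N s y = (\<Sum>Y\<in>E N. (sphere_inner (euler (U s y)) Y)\<^sup>2)
        - (\<Sum>Y\<in>E N. sphere_inner (sphere_laplacian (U s y)) Y * sphere_inner (U s y) Y)
        + \<beta>\<^sup>2 * (\<Sum>Y\<in>E N. (sphere_inner (U s y) Y)\<^sup>2)" for N
      unfolding q_def sum_subtractf[symmetric] sum_distrib_left sum.distrib[symmetric]
      by (intro sum.cong refl) (simp add: b_def b1_def k[OF _ sU] power2_eq_square algebra_simps)
    moreover have "(\<lambda>N. (\<Sum>Y\<in>E N. (sphere_inner (euler (U s y)) Y)\<^sup>2)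
        - (\<Sum>Y\<in>E N. sphere_inner (sphere_laplacian (U s y)) Y * sphere_inner (U s y) Y)
        + \<beta>\<^sup>2 * (\<Sum>Y\<in>E N. (sphere_inner (U s y) Y)\<^sup>2)) \<longlonglongrightarrow> Q (\<beta>\<^sup>2) s y"
      unfolding Qe by (intro tendsto_intros parseval_limit parseval_limit_inner E cUs)
    ultimately show ?thesis by simp
  qed
  have c1: "continuous_on UNIV (\<lambda>(s, x). W s x)" "continuous_on UNIV (\<lambda>(s, x). Ws s x)"
    by (rule continuous_on_family[OF sW cW], rule continuous_on_family[OF sWs cWs])
  have d_euler: "((\<lambda>s. euler (W s) x) has_real_derivative euler (Ws s) x) (at s)" for s x
    unfolding euler_def using d[of "[i]" for i] by (auto intro!: derivative_eq_intros simp: mult.commute)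
  have mode: "(\<integral>\<^sup>+ z. ennreal (w (snd z) * ((b1 Y (fst z) (snd z))\<^sup>2 + (sphere_eig TYPE('n) (k Y) + \<beta>\<^sup>2) * (b Y (fst z) (snd z))\<^sup>2)) \<partial>lborel)
      \<le> 420 * (\<integral>\<^sup>+ z. ennreal ((exp (psi \<beta> (snd z)))\<^sup>2 * (f Y (fst z) (snd z))\<^sup>2) \<partial>lborel)" if Y: "Y \<in> E N" for Y N
  proof -
    note cY = cE[OF Y]
    define b2 where "b2 s y = sphere_inner (\<lambda>x. euler (euler (W s)) (exp (- y) *\<^sub>R x)) Y" for s y
    define bs where "bs s y = sphere_inner (\<lambda>x. Ws s (exp (- y) *\<^sub>R x)) Y" for s y
    define bs1 where "bs1 s y = - sphere_inner (\<lambda>x. euler (Ws s) (exp (- y) *\<^sub>R x)) Y" for s y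
    have eq: "b2 s y - m * b1 Y s y - real (k Y) * (real (k Y) + m) * b Y s y - exp (- 2 * y) * bs s y = f Y s y" for s y
      using sphere_eig_radial[OF sW[of s] smooth_continuous[OF sWs[of s]] cY k[OF Y], of y]
      unfolding b2_def b1_def b_def bs_def f_def F_def m_def sphere_eig_def eU U_def by simp
    have "(\<integral>\<^sup>+ (s, y). ennreal ((exp (psi \<beta> y))\<^sup>2 * (1 + conj_convexity \<beta> y) *
        ((b1 Y s y)\<^sup>2 + (real (k Y) * (real (k Y) + m) + \<beta>\<^sup>2) * (b Y s y)\<^sup>2)) \<partial>lborel)
      \<le> 420 * (\<integral>\<^sup>+ (s, y). ennreal ((exp (psi \<beta> y))\<^sup>2 *
        (b2 s y - m * b1 Y s y - real (k Y) * (real (k Y) + m) * b Y s y - exp (- 2 * y) * bs s y)\<^sup>2) \<partial>lborel)"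
    proof (rule mode_estimate[OF _ _ _ _ _ _ _ _ _ _ _ m par, where R = R and ?bs1.0 = bs1])
      show "continuous_on UNIV (\<lambda>(s, y). b Y s y)"
        unfolding b_def U_def by (rule continuous_on_ray_mode[OF c1(1) cY])
      show "continuous_on UNIV (\<lambda>(s, y). b1 Y s y)"
        using continuous_on_minus[OF continuous_on_ray_mode[OF continuous_on_family_euler[OF sW cW] cY]]
        unfolding b1_def eU by (simp add: case_prod_unfold)
      show "continuous_on UNIV (\<lambda>(s, y). b2 s y)"
        unfolding b2_def by (rule continuous_on_ray_mode[OF continuous_on_family_euler2[OF sW cW] cY])
      show "continuous_on UNIV (\<lambda>(s, y). bs s y)"
        unfolding bs_def by (rule continuous_on_ray_mode[OF c1(2) cY])
      show "continuous_on UNIV (\<lambda>(s, y). bs1 s y)"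
        using continuous_on_minus[OF continuous_on_ray_mode[OF continuous_on_family_euler[OF sWs cWs] cY]]
        unfolding bs1_def by (simp add: case_prod_unfold)
      show "(b Y s has_real_derivative b1 Y s y) (at y)" for s y
        unfolding b_def[abs_def] b1_def eU unfolding U_def by (rule DERIV_mode_radial[OF sW cY])
      show "(b1 Y s has_real_derivative b2 s y) (at y)" for s y
        using DERIV_minus[OF DERIV_mode_radial[OF smooth_euler[OF sW] cY]] unfolding b1_def[abs_def] b2_def eU by simp
      show "((\<lambda>s. b Y s y) has_real_derivative bs s y) (at s)" for s y
        unfolding b_def bs_def U_def
        by (rule DERIV_mode_time[OF smooth_continuous[OF sW] c1(2) _ cY]) (use d[of "[]"] in simp)
      show "((\<lambda>s. b1 Y s y) has_real_derivative bs1 s y) (at s)" for s y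
        unfolding b1_def bs1_def eU
        by (rule DERIV_minus[OF DERIV_mode_time[OF smooth_continuous[OF smooth_euler[OF sW]] continuous_on_family_euler[OF sWs cWs] d_euler cY]])
      show "(bs s has_real_derivative bs1 s y) (at y)" for s y
        unfolding bs_def[abs_def] bs1_def by (rule DERIV_mode_radial[OF sWs cY])
      show "b Y s y = 0" if "y < - 1 \<or> R < \<bar>s\<bar>" for s y
      proof -
        have "sphere_inner (U s y) Y = sphere_inner (\<lambda>_. 0) Y"
          by (rule sphere_inner_cong[OF cUs(1) continuous_on_const cY])
             (use that in \<open>auto intro!: supp simp: U_def\<close>)
        thus ?thesis unfolding b_def sphere_inner_def by simp
      qed
      have "(\<integral>\<^sup>+ (s, y). ennreal ((exp (psi \<beta> y))\<^sup>2 * ((b Y s y)\<^sup>2 + (b1 Y s y)\<^sup>2)) \<partial>lborel)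
        \<le> (\<integral>\<^sup>+ (s, y). ennreal ((exp (psi \<beta> y))\<^sup>2 * Q 1 s y) \<partial>lborel)"
      proof (rule nn_integral_mono, clarsimp simp only: prod.case)
        fix s y
        \<comment> \<open>Bessel for a single harmonic bounds each coefficient by the norm, and the
          angular energy is nonnegative, so finiteness passes from the slice to each mode.\<close>
        have one: "(sphere_inner u Y)\<^sup>2 \<le> sphere_inner u u" if "continuous_on UNIV u" for u
          using bessel[OF oE that, of N] member_le_sum[OF Y, of "\<lambda>Y. (sphere_inner u Y)\<^sup>2"] finE by simp
        have "0 \<le> - sphere_inner (sphere_laplacian (U s y)) (U s y)"
          unfolding sphere_inner_sphere_laplacian_sum[OF sU sU] by (simp add: sum_nonneg sphere_inner_self_nonneg)
        hence "(b Y s y)\<^sup>2 + (b1 Y s y)\<^sup>2 \<le> Q 1 s y"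
          using one[OF cUs(1)[of s y]] one[OF cUs(2)[of s y]] unfolding Qe b_def b1_def by simp
        thus "ennreal ((exp (psi \<beta> y))\<^sup>2 * ((b Y s y)\<^sup>2 + (b1 Y s y)\<^sup>2)) \<le> ennreal ((exp (psi \<beta> y))\<^sup>2 * Q 1 s y)"
          by (intro ennreal_leI mult_left_mono) auto
      qed
      thus "(\<integral>\<^sup>+ (s, y). ennreal ((exp (psi \<beta> y))\<^sup>2 * ((b Y s y)\<^sup>2 + (b1 Y s y)\<^sup>2)) \<partial>lborel) < \<infinity>"
        using fin by (rule order_le_less_trans)
    qed
    thus ?thesis unfolding eq unfolding w_def sphere_eig_def m_def[symmetric] by (simp add: case_prod_unfold)
  qed
  have cb: "continuous_on UNIV (\<lambda>z. b Y (fst z) (snd z))" "continuous_on UNIV (\<lambda>z. b1 Y (fst z) (snd z))"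
    "continuous_on UNIV (\<lambda>z. f Y (fst z) (snd z))" if "Y \<in> E N" for Y N
  proof -
    note cY = cE[OF that]
    show "continuous_on UNIV (\<lambda>z. b Y (fst z) (snd z))"
      using continuous_on_ray_mode[OF c1(1) cY] unfolding b_def U_def by (simp add: case_prod_unfold)
    show "continuous_on UNIV (\<lambda>z. b1 Y (fst z) (snd z))"
      using continuous_on_minus[OF continuous_on_ray_mode[OF continuous_on_family_euler[OF sW cW] cY]]
      unfolding b1_def eU by (simp add: case_prod_unfold)
    have 1: "continuous_on UNIV (\<lambda>(s, x). laplacian (W s) x - Ws s x)"
      using continuous_on_diff[OF continuous_on_family_laplacian[OF sW cW] c1(2)] by (simp add: case_prod_unfold)
    have "f Y s y = exp (- 2 * y) * sphere_inner (\<lambda>x. laplacian (W s) (exp (- y) *\<^sub>R x) - Ws s (exp (- y) *\<^sub>R x)) Y" for s y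
      unfolding f_def F_def by (rule sphere_inner_scale_left)
    thus "continuous_on UNIV (\<lambda>z. f Y (fst z) (snd z))"
      using continuous_on_ray_mode[OF 1 cY] by (simp add: case_prod_unfold) (intro continuous_intros)
  qed
  have step: "(\<integral>\<^sup>+ z. ennreal (w (snd z) * q N (fst z) (snd z)) \<partial>lborel)
      \<le> 420 * (\<integral>\<^sup>+ z. ennreal ((exp (psi \<beta> (snd z)))\<^sup>2 * (\<integral> x. (F (fst z) (snd z) x)\<^sup>2 \<partial>sphere_measure)) \<partial>lborel)" for N
  proof -
    have eig0: "0 \<le> sphere_eig TYPE('n) k" for k unfolding sphere_eig_def m_def[symmetric] using m by simp
    have "(\<integral>\<^sup>+ z. ennreal (w (snd z) * q N (fst z) (snd z)) \<partial>lborel)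
      = (\<integral>\<^sup>+ z. (\<Sum>Y\<in>E N. ennreal (w (snd z) * ((b1 Y (fst z) (snd z))\<^sup>2 + (sphere_eig TYPE('n) (k Y) + \<beta>\<^sup>2) * (b Y (fst z) (snd z))\<^sup>2))) \<partial>lborel)"
      unfolding q_def sum_distrib_left
      by (intro nn_integral_cong, subst sum_ennreal) (use w eig0 in auto)
    also have "\<dots> = (\<Sum>Y\<in>E N. \<integral>\<^sup>+ z. ennreal (w (snd z) * ((b1 Y (fst z) (snd z))\<^sup>2 + (sphere_eig TYPE('n) (k Y) + \<beta>\<^sup>2) * (b Y (fst z) (snd z))\<^sup>2)) \<partial>lborel)"
    proof (rule nn_integral_sum)
      fix Y assume "Y \<in> E N"
      note [continuous_intros] = cb(1,2)[OF this] cw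
      have "continuous_on UNIV (\<lambda>z. w (snd z) * ((b1 Y (fst z) (snd z))\<^sup>2 + (sphere_eig TYPE('n) (k Y) + \<beta>\<^sup>2) * (b Y (fst z) (snd z))\<^sup>2))"
        by (intro continuous_intros)
      from borel_measurable_continuous_onI[OF this]
      show "(\<lambda>z. ennreal (w (snd z) * ((b1 Y (fst z) (snd z))\<^sup>2 + (sphere_eig TYPE('n) (k Y) + \<beta>\<^sup>2) * (b Y (fst z) (snd z))\<^sup>2))) \<in> borel_measurable lborel"
        by simp
    qed
    also have "\<dots> \<le> (\<Sum>Y\<in>E N. 420 * (\<integral>\<^sup>+ z. ennreal ((exp (psi \<beta> (snd z)))\<^sup>2 * (f Y (fst z) (snd z))\<^sup>2) \<partial>lborel))"
      by (rule sum_mono) (rule mode)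
    also have "\<dots> = 420 * (\<integral>\<^sup>+ z. (\<Sum>Y\<in>E N. ennreal ((exp (psi \<beta> (snd z)))\<^sup>2 * (f Y (fst z) (snd z))\<^sup>2)) \<partial>lborel)"
      unfolding sum_distrib_left[symmetric]
    proof (subst nn_integral_sum)
      fix Y assume "Y \<in> E N"
      note [continuous_intros] = cb(3)[OF this] ce
      have "continuous_on UNIV (\<lambda>z. (exp (psi \<beta> (snd z)))\<^sup>2 * (f Y (fst z) (snd z))\<^sup>2)"
        by (intro continuous_intros)
      from borel_measurable_continuous_onI[OF this]
      show "(\<lambda>z. ennreal ((exp (psi \<beta> (snd z)))\<^sup>2 * (f Y (fst z) (snd z))\<^sup>2)) \<in> borel_measurable lborel" by simp
    qed simp
    also have "\<dots> \<le> 420 * (\<integral>\<^sup>+ z. ennreal ((exp (psi \<beta> (snd z)))\<^sup>2 * (\<integral> x. (F (fst z) (snd z) x)\<^sup>2 \<partial>sphere_measure)) \<partial>lborel)"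
    proof (intro mult_left_mono nn_integral_mono)
      fix z :: "real \<times> real"
      have "(\<Sum>Y\<in>E N. (f Y (fst z) (snd z))\<^sup>2) \<le> (\<integral> x. (F (fst z) (snd z) x)\<^sup>2 \<partial>sphere_measure)"
        using bessel[OF oE cF] unfolding f_def sphere_inner_def[of "F _ _" "F _ _"] power2_eq_square by simp
      thus "(\<Sum>Y\<in>E N. ennreal ((exp (psi \<beta> (snd z)))\<^sup>2 * (f Y (fst z) (snd z))\<^sup>2))
        \<le> ennreal ((exp (psi \<beta> (snd z)))\<^sup>2 * (\<integral> x. (F (fst z) (snd z) x)\<^sup>2 \<partial>sphere_measure))"
        by (subst sum_ennreal) (auto simp: sum_distrib_left[symmetric] intro!: ennreal_leI mult_left_mono)
    qed simp
    finally show ?thesis .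
  qed
  have "(\<integral>\<^sup>+ z. ennreal (w (snd z) * Q (\<beta>\<^sup>2) (fst z) (snd z)) \<partial>lborel)
    = (\<integral>\<^sup>+ z. liminf (\<lambda>N. ennreal (w (snd z) * q N (fst z) (snd z))) \<partial>lborel)"
  proof (intro nn_integral_cong)
    fix z :: "real \<times> real"
    have "(\<lambda>N. ennreal (w (snd z) * q N (fst z) (snd z))) \<longlonglongrightarrow> ennreal (w (snd z) * Q (\<beta>\<^sup>2) (fst z) (snd z))"
      by (intro tendsto_ennrealI tendsto_intros q_lim)
    thus "ennreal (w (snd z) * Q (\<beta>\<^sup>2) (fst z) (snd z)) = liminf (\<lambda>N. ennreal (w (snd z) * q N (fst z) (snd z)))"
      using lim_imp_Liminf[OF sequentially_bot] by metis
  qed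
  \<comment> \<open>Fatou's lemma: the partial sums converge pointwise but, without nesting, need
    not increase.\<close>
  also have "\<dots> \<le> liminf (\<lambda>N. \<integral>\<^sup>+ z. ennreal (w (snd z) * q N (fst z) (snd z)) \<partial>lborel)"
  proof (rule nn_integral_liminf)
    fix N
    have "continuous_on UNIV (\<lambda>z. w (snd z) * q N (fst z) (snd z))"
      unfolding q_def by (intro continuous_intros cw cb(1,2)[of _ N])
    from borel_measurable_continuous_onI[OF this]
    show "(\<lambda>z. ennreal (w (snd z) * q N (fst z) (snd z))) \<in> borel_measurable lborel" by simp
  qed
  also have "\<dots> \<le> 420 * (\<integral>\<^sup>+ z. ennreal ((exp (psi \<beta> (snd z)))\<^sup>2 * (\<integral> x. (F (fst z) (snd z) x)\<^sup>2 \<partial>sphere_measure)) \<partial>lborel)"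
    using Liminf_le[of sequentially "\<lambda>N. \<integral>\<^sup>+ z. ennreal (w (snd z) * q N (fst z) (snd z)) \<partial>lborel"] step
    by (meson Liminf_mono always_eventually Liminf_const order_trans eq_refl sequentially_bot)
  finally show ?thesis unfolding w_def by (simp add: case_prod_unfold)
qed

subsection \<open>The Carleman estimate\<close>

text \<open>For each \<tau> a translation of t by \<tau>, with the label \<open>c\<close> of the
  diagonal line as outer variable afterwards. Measurability in \<open>c\<close> is recorded because
  the estimate is later applied on almost every line.\<close>

lemma nn_integral_time_shear:
  fixes g :: "real \<Rightarrow> real \<Rightarrow> real \<Rightarrow> real"
  assumes g: "continuous_on UNIV (\<lambda>(t, \<tau>, y). g t \<tau> y)"
  shows "(\<integral>\<^sup>+ t. \<integral>\<^sup>+ \<tau>. \<integral>\<^sup>+ y. ennreal (g t \<tau> y) \<partial>lborel \<partial>lborel \<partial>lborel)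
      = (\<integral>\<^sup>+ c. (\<integral>\<^sup>+ (s, y). ennreal (g (c + s) s y) \<partial>lborel) \<partial>lborel)" (is ?eq)
    and "(\<lambda>c. \<integral>\<^sup>+ (s, y). ennreal (g (c + s) s y) \<partial>lborel) \<in> borel_measurable borel" (is ?meas)
proof -
  define G where "G p = ennreal (g (fst p) (fst (snd p)) (snd (snd p)))" for p
  have [measurable]: "G \<in> borel_measurable borel"
    using borel_measurable_continuous_onI[OF g] unfolding G_def by (simp add: case_prod_unfold)
  have gG: "ennreal (g t \<tau> y) = G (t, \<tau>, y)" for t \<tau> y unfolding G_def by simp
  have inner: "(\<integral>\<^sup>+ (s, y). ennreal (g (c + s) s y) \<partial>lborel) = (\<integral>\<^sup>+ s. \<integral>\<^sup>+ y. G (c + s, s, y) \<partial>lborel \<partial>lborel)" for c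
  proof -
    have "(\<integral>\<^sup>+ s. \<integral>\<^sup>+ y. (\<lambda>z. G (c + fst z, fst z, snd z)) (s, y) \<partial>lborel \<partial>lborel)
      = (\<integral>\<^sup>+ z. G (c + fst z, fst z, snd z) \<partial>(lborel \<Otimes>\<^sub>M lborel))"
      by (rule lborel.nn_integral_fst) measurable
    thus ?thesis unfolding lborel_prod gG by (simp add: case_prod_unfold)
  qed
  show ?meas unfolding inner by measurable
  have "(\<integral>\<^sup>+ t. \<integral>\<^sup>+ \<tau>. \<integral>\<^sup>+ y. G (t, \<tau>, y) \<partial>lborel \<partial>lborel \<partial>lborel)
    = (\<integral>\<^sup>+ \<tau>. \<integral>\<^sup>+ t. \<integral>\<^sup>+ y. G (t, \<tau>, y) \<partial>lborel \<partial>lborel \<partial>lborel)"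
    by (rule lborel_pair.Fubini') measurable
  also have "\<dots> = (\<integral>\<^sup>+ s. \<integral>\<^sup>+ c. \<integral>\<^sup>+ y. G (c + s, s, y) \<partial>lborel \<partial>lborel \<partial>lborel)"
  proof (rule nn_integral_cong)
    fix s
    show "(\<integral>\<^sup>+ t. \<integral>\<^sup>+ y. G (t, s, y) \<partial>lborel \<partial>lborel) = (\<integral>\<^sup>+ c. \<integral>\<^sup>+ y. G (c + s, s, y) \<partial>lborel \<partial>lborel)"
      using nn_integral_lborel_translate[of "\<lambda>t. \<integral>\<^sup>+ y. G (t, s, y) \<partial>lborel" s] by (simp add: add.commute)
  qed
  also have "\<dots> = (\<integral>\<^sup>+ c. \<integral>\<^sup>+ s. \<integral>\<^sup>+ y. G (c + s, s, y) \<partial>lborel \<partial>lborel \<partial>lborel)"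
    by (rule lborel_pair.Fubini') measurable
  finally show ?eq unfolding inner unfolding gG .
qed

text \<open>As one integral over the product space, \<open>iiint\<close> becomes additive and
  monotone after a single measurability check.\<close>

lemma iiint_eq_nn_integral:
  fixes F :: "real \<Rightarrow> real \<Rightarrow> real ^ 'n::finite \<Rightarrow> real"
  assumes "(\<lambda>p. F (fst p) (fst (snd p)) (snd (snd p))) \<in> borel_measurable borel"
  shows "iiint F = (\<integral>\<^sup>+ p. ennreal (F (fst p) (fst (snd p)) (snd (snd p))) \<partial>lborel)"
proof -
  define G where "G p = ennreal (F (fst p) (fst (snd p)) (snd (snd p)))" for p
  have [measurable]: "G \<in> borel_measurable borel" unfolding G_def using assms by measurable
  have inner: "(\<integral>\<^sup>+ \<tau>. \<integral>\<^sup>+ x. G (t, \<tau>, x) \<partial>lborel \<partial>lborel) = (\<integral>\<^sup>+ q. G (t, q) \<partial>lborel)" for t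
  proof -
    have "(\<integral>\<^sup>+ \<tau>. \<integral>\<^sup>+ x. (\<lambda>q. G (t, q)) (\<tau>, x) \<partial>lborel \<partial>lborel) = (\<integral>\<^sup>+ q. G (t, q) \<partial>(lborel \<Otimes>\<^sub>M lborel))"
      by (rule lborel.nn_integral_fst) (unfold lborel_prod, measurable)
    thus ?thesis unfolding lborel_prod .
  qed
  have "(\<integral>\<^sup>+ t. \<integral>\<^sup>+ q. G (t, q) \<partial>lborel \<partial>lborel) = (\<integral>\<^sup>+ p. G p \<partial>(lborel \<Otimes>\<^sub>M lborel))"
    by (rule lborel.nn_integral_fst) (simp add: lborel_prod)
  hence "(\<integral>\<^sup>+ t. \<integral>\<^sup>+ \<tau>. \<integral>\<^sup>+ x. G (t, \<tau>, x) \<partial>lborel \<partial>lborel \<partial>lborel) = (\<integral>\<^sup>+ p. G p \<partial>lborel)"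
    unfolding inner lborel_prod .
  thus ?thesis unfolding iiint_def G_def by simp
qed

lemma partials_add: "smooth f \<Longrightarrow> smooth g \<Longrightarrow> partials is (\<lambda>x. f x + g x) x = partials is f x + partials is g x"
  using partials_diff[of f "\<lambda>x. (-1) * g x" "is" x] partials_cmult[of g "is" "-1" x] smooth_cmult[of g "-1"] by simp

lemma laplacian_cmult: "smooth f \<Longrightarrow> laplacian (\<lambda>x. c * f x) x = c * laplacian f x"
  unfolding laplacian_def using partials_cmult[of f "[i, i]" c x for i] by (simp add: sum_distrib_left)

lemma gradient_cmult: "smooth f \<Longrightarrow> gradient (\<lambda>x. c * f x) x = c *\<^sub>R gradient f x"
  unfolding gradient_def by (simp add: vec_eq_iff partial_cmult)

lemma norm_powr_weight:
  fixes x :: "real ^ 'n::finite"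
  shows "norm x powr (- real CARD('n) + real k) = 1 / norm x ^ CARD('n) * norm x ^ k"
proof (cases "x = 0")
  case False
  thus ?thesis by (subst powr_add) (simp add: powr_minus powr_realpow divide_inverse)
\<comment> \<open>At \<open>x = 0\<close> both sides are 0 by the conventions
  \<open>0 powr a = 0\<close> and \<open>1 / 0 = 0\<close>.\<close>
qed (simp add: power_0_left)

lemma continuous_on_ray_integral:
  fixes H :: "'z::euclidean_space \<Rightarrow> real ^ 'n::finite \<Rightarrow> real"
  assumes "continuous_on UNIV (\<lambda>(z, x). H z x)"
  shows "continuous_on UNIV (\<lambda>p. \<integral> x. H (fst p) (exp (- snd p) *\<^sub>R x) \<partial>sphere_measure)"
proof (rule continuous_on_sphere_integral)
  have "continuous_on UNIV (\<lambda>q. (\<lambda>(z, x). H z x) (fst (fst q), exp (- snd (fst q)) *\<^sub>R snd q))"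
    by (rule continuous_on_compose2[OF assms]) (auto intro!: continuous_intros)
  thus "continuous_on UNIV (\<lambda>(p, x). H (fst p) (exp (- snd p) *\<^sub>R x))"
    by (simp add: case_prod_unfold)
qed

lemma iiint_polar_time_shear:
  fixes H :: "real \<Rightarrow> real \<Rightarrow> real ^ 'n::finite \<Rightarrow> real"
  assumes h: "continuous_on UNIV h" "\<And>y. 0 \<le> h y"
    and H: "continuous_on UNIV (\<lambda>(t, \<tau>, x). H t \<tau> x)" "\<And>t \<tau> x. 0 \<le> H t \<tau> x"
    and F: "\<And>t \<tau> x. F t \<tau> x = h (- ln (norm x)) * (1 / norm x ^ CARD('n)) * H t \<tau> x"
  shows "iiint F = (\<integral>\<^sup>+ c. (\<integral>\<^sup>+ (s, y). ennreal (h y * (\<integral> x. H (c + s) s (exp (- y) *\<^sub>R x) \<partial>sphere_measure)) \<partial>lborel) \<partial>lborel)" (is ?eq)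
    and "(\<lambda>c. \<integral>\<^sup>+ (s, y). ennreal (h y * (\<integral> x. H (c + s) s (exp (- y) *\<^sub>R x) \<partial>sphere_measure)) \<partial>lborel) \<in> borel_measurable borel" (is ?meas)
proof -
  define g where "g t \<tau> y = h y * (\<integral> x. H t \<tau> (exp (- y) *\<^sub>R x) \<partial>sphere_measure)" for t \<tau> y
  have Hc: "continuous_on UNIV (H t \<tau>)" for t \<tau>
  proof -
    have "continuous_on UNIV (\<lambda>x. (\<lambda>(t, \<tau>, x). H t \<tau> x) (t, \<tau>, x))"
      by (rule continuous_on_compose2[OF H(1)]) (auto intro!: continuous_intros)
    thus ?thesis by simp
  qed
  have cg: "continuous_on UNIV (\<lambda>(t, \<tau>, y). g t \<tau> y)"
  proof -
    have "continuous_on UNIV (\<lambda>q. (\<lambda>(t, \<tau>, x). H t \<tau> x) (fst (fst q), snd (fst q), snd q))"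
      by (rule continuous_on_compose2[OF H(1)]) (auto intro!: continuous_intros)
    hence "continuous_on UNIV (\<lambda>(z, x). H (fst z) (snd z) x)" by (simp add: case_prod_unfold)
    note 1 = continuous_on_ray_integral[OF this]
    have "continuous_on UNIV (\<lambda>p. \<integral> x. H (fst p) (fst (snd p)) (exp (- snd (snd p)) *\<^sub>R x) \<partial>sphere_measure)"
      using continuous_on_compose2[OF 1, of UNIV "\<lambda>p. ((fst p, fst (snd p)), snd (snd p))"]
      by (simp add: continuous_on_fst continuous_on_snd continuous_on_Pair)
    moreover have "continuous_on UNIV (\<lambda>p :: real \<times> real \<times> real. h (snd (snd p)))"
      by (rule continuous_on_compose2[OF h(1)]) (auto intro!: continuous_intros)
    ultimately show ?thesis unfolding g_def case_prod_unfold by (intro continuous_intros)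
  qed
  have "iiint F = (\<integral>\<^sup>+ t. \<integral>\<^sup>+ \<tau>. \<integral>\<^sup>+ y. ennreal (g t \<tau> y) \<partial>lborel \<partial>lborel \<partial>lborel)"
    unfolding iiint_def F g_def by (intro nn_integral_cong nn_integral_polar_weight[OF h Hc H(2)])
  thus ?eq ?meas using nn_integral_time_shear[OF cg] unfolding g_def by auto
qed


lemma sum_three_squares_le: "(a - b - c)\<^sup>2 \<le> 3 * (a\<^sup>2 + b\<^sup>2 + (c::real)\<^sup>2)"
proof -
  have "0 \<le> (a + b)\<^sup>2 + (a + c)\<^sup>2 + (b - c)\<^sup>2" by simp
  thus ?thesis by (simp add: power2_eq_square algebra_simps)
qed

text \<open>With \<open>W = chi zeta w\<close>, the error terms from differentiating the cutoffs are exactly the last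
  two integrals on the right-hand side, so nothing needs to be integrated by parts in time.\<close>

lemma carleman_estimate:
  fixes w :: "real \<Rightarrow> real \<Rightarrow> real ^ 'n::finite \<Rightarrow> real"
  assumes n: "2 \<le> CARD('n)" and chi: "C2_compact_support chi" and zeta: "C2_compact_support zeta"
    and w: "C1_smooth w"
    and supp: "tsupport (\<lambda>(t, \<tau>, x). w t \<tau> x) \<subseteq> UNIV \<times> {0<..} \<times> {x. norm x < exp 1}"
    and \<beta>: "2 \<le> \<beta>" "\<beta> = real j + 1/4"
    and fin: "carleman_lhs \<beta> chi zeta w < \<infinity>"
  shows "carleman_lhs \<beta> chi zeta w \<le> ennreal 1260 * carleman_rhs \<beta> chi zeta w"
proof -
  obtain u v where sw: "\<And>t \<tau>. smooth (w t \<tau>)" and su: "\<And>t \<tau>. smooth (u t \<tau>)" and sv: "\<And>t \<tau>. smooth (v t \<tau>)"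
    and du: "\<And>t \<tau> is x. ((\<lambda>t. partials is (w t \<tau>) x) has_real_derivative partials is (u t \<tau>) x) (at t)"
    and dv: "\<And>t \<tau> is x. ((\<lambda>\<tau>. partials is (w t \<tau>) x) has_real_derivative partials is (v t \<tau>) x) (at \<tau>)"
    and cw: "\<And>is. continuous_on UNIV (\<lambda>(t, \<tau>, x). partials is (w t \<tau>) x)"
    and cu: "\<And>is. continuous_on UNIV (\<lambda>(t, \<tau>, x). partials is (u t \<tau>) x)"
    and cv: "\<And>is. continuous_on UNIV (\<lambda>(t, \<tau>, x). partials is (v t \<tau>) x)"
    by (rule C1_smoothE[OF w]) (rule that)
  have der: "(f has_real_derivative deriv f t) (at t)" and contd: "continuous_on UNIV (deriv f)" and contf: "continuous_on UNIV f"
    if "C2_compact_support f" for f t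
  proof -
    have "f differentiable (at t)" for t using that unfolding C2_compact_support_def differentiable_on_def by simp
    thus "(f has_real_derivative deriv f t) (at t)"
      by (simp add: DERIV_deriv_iff_real_differentiable)
    show "continuous_on UNIV (deriv f)" "continuous_on UNIV f"
      using that unfolding C2_compact_support_def by (auto intro: differentiable_imp_continuous_on)
  qed
  \<comment> \<open>On the line \<open>t = c + s\<close>, \<open>\<tau> = s\<close> the support of
    \<open>zeta\<close> confines \<open>s\<close>, by a bound that does not depend on
    \<open>c\<close>.\<close>
  obtain R where R: "\<And>s. R < \<bar>s\<bar> \<Longrightarrow> zeta s = 0"
  proof -
    have "bounded (tsupport zeta)" using zeta unfolding C2_compact_support_def by (auto intro: compact_imp_bounded)
    then obtain R where "\<And>s. s \<in> tsupport zeta \<Longrightarrow> norm s \<le> R" unfolding bounded_iff by auto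
    moreover have "s \<in> tsupport zeta" if "zeta s \<noteq> 0" for s
      unfolding tsupport_def using that closure_subset[of "{x. zeta x \<noteq> 0}"] by auto
    ultimately have "R < \<bar>s\<bar> \<Longrightarrow> zeta s = 0" for s by (metis not_le real_norm_def)
    thus thesis by (rule that)
  qed
  have w0: "w t \<tau> x = 0" if "exp 1 \<le> norm x" for t \<tau> x
  proof (rule ccontr)
    assume "w t \<tau> x \<noteq> 0"
    hence "(t, \<tau>, x) \<in> tsupport (\<lambda>(t, \<tau>, x). w t \<tau> x)"
      unfolding tsupport_def using closure_subset[of "{z. (\<lambda>(t, \<tau>, x). w t \<tau> x) z \<noteq> 0}"] by auto
    thus False using supp that by auto
  qed
  define W where "W t \<tau> x = chi t * zeta \<tau> * w t \<tau> x" for t \<tau> x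
  define D where "D t \<tau> = deriv chi t * zeta \<tau> + chi t * deriv zeta \<tau>" for t \<tau>
  \<comment> \<open>The derivative of \<open>W\<close> in the direction \<open>(1, 1)\<close> of the
    two times.\<close>
  define Ws where "Ws t \<tau> x = D t \<tau> * w t \<tau> x + chi t * zeta \<tau> * (u t \<tau> x + v t \<tau> x)" for t \<tau> x
  have sW: "smooth (W t \<tau>)" for t \<tau> unfolding W_def by (rule smooth_cmult[OF sw])
  have sWs: "smooth (Ws t \<tau>)" for t \<tau> unfolding Ws_def by (intro smooth_add smooth_cmult sw su sv)
  have pW: "partials is (W t \<tau>) x = chi t * zeta \<tau> * partials is (w t \<tau>) x" for "is" t \<tau> x
    unfolding W_def by (rule partials_cmult[OF sw])
  have pWs: "partials is (Ws t \<tau>) x = D t \<tau> * partials is (w t \<tau>) x + chi t * zeta \<tau> * (partials is (u t \<tau>) x + partials is (v t \<tau>) x)" for "is" t \<tau> x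
    unfolding Ws_def
    by (subst partials_add) (auto simp: partials_cmult partials_add smooth_cmult smooth_add sw su sv)
  have cchi: "continuous_on UNIV (\<lambda>p. chi (f p))" "continuous_on UNIV (\<lambda>p. deriv chi (f p))"
    "continuous_on UNIV (\<lambda>p. zeta (f p))" "continuous_on UNIV (\<lambda>p. deriv zeta (f p))"
    if "continuous_on UNIV f" for f :: "'z::topological_space \<Rightarrow> real"
    using that contf[OF chi] contd[OF chi] contf[OF zeta] contd[OF zeta] by (auto intro: continuous_on_compose2)
  note [continuous_intros] = cw[unfolded case_prod_unfold] cu[unfolded case_prod_unfold] cv[unfolded case_prod_unfold] cchi
  have cW: "continuous_on UNIV (\<lambda>(t, \<tau>, x). partials is (W t \<tau>) x)" for "is"
    unfolding pW case_prod_unfold by (intro continuous_intros)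
  have cWs: "continuous_on UNIV (\<lambda>(t, \<tau>, x). partials is (Ws t \<tau>) x)" for "is"
    unfolding pWs D_def case_prod_unfold by (intro continuous_intros)
  have diag: "continuous_on UNIV (\<lambda>(s, x). f (c + s) s x)" if "continuous_on UNIV (\<lambda>(t, \<tau>, x). f t \<tau> x)"
    for f :: "real \<Rightarrow> real \<Rightarrow> real ^ 'n \<Rightarrow> real" and c
  proof -
    have "continuous_on UNIV (\<lambda>q. (\<lambda>(t, \<tau>, x). f t \<tau> x) (c + fst q, fst q, snd q))"
      by (rule continuous_on_compose2[OF that]) (auto intro!: continuous_intros)
    thus ?thesis by (simp add: case_prod_unfold)
  qed
  have dW: "((\<lambda>s. partials is (W (c + s) s) x) has_real_derivative partials is (Ws (c + s) s) x) (at s)" for c "is" s x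
  proof -
    have "continuous_on UNIV (\<lambda>q. (\<lambda>(t, \<tau>, x). partials is (v t \<tau>) x) (fst q, snd q, x))"
      by (rule continuous_on_compose2[OF cv]) (auto intro!: continuous_intros)
    hence "continuous_on UNIV (\<lambda>(t, \<tau>). partials is (v t \<tau>) x)" by (simp add: case_prod_unfold)
    note 1 = DERIV_diagonal[OF du dv this, of c s]
    have 2: "((\<lambda>s. chi (c + s)) has_real_derivative deriv chi (c + s)) (at s)"
  proof -
    have "((\<lambda>s. c + s) has_real_derivative 1) (at s)" by (auto intro!: derivative_eq_intros)
    from DERIV_chain2[where f = chi and g = "\<lambda>s. c + s", OF der[OF chi] this] show ?thesis by simp
  qed
    show ?thesis unfolding pW pWs D_def
      by (rule DERIV_cong[OF DERIV_mult[OF DERIV_mult[OF 2 der[OF zeta]] 1]]) (simp add: algebra_simps)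
  qed
  have suppW: "W (c + s) s x = 0" if "exp 1 \<le> norm x \<or> R < \<bar>s\<bar>" for c s x
    using that w0 R unfolding W_def by auto
  \<comment> \<open>With \<open>1 / |x|^n\<close> split off as the polar density, the gradient keeps
    the factor \<open>|x|^2\<close>, and the source keeps \<open>|x|^4\<close>, the square of the
    factor in \<open>|x|^2\<close> times the equation.\<close>
  define HL where "HL c t \<tau> x = (norm x)\<^sup>2 * (norm (gradient (W t \<tau>) x))\<^sup>2 + c * (W t \<tau> x)\<^sup>2" for c t \<tau> x
  define HR where "HR t \<tau> x = norm x ^ 4 * (laplacian (W t \<tau>) x - Ws t \<tau> x)\<^sup>2" for t \<tau> x
  define e where "e y = (exp (psi \<beta> y))\<^sup>2" for y
  define h where "h y = e y * (1 + conj_convexity \<beta> y)" for y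
  have cc: "0 \<le> conj_convexity \<beta> y" for y unfolding conj_convexity_def using \<beta> by simp
  have ce: "continuous_on UNIV e" "continuous_on UNIV h" "0 \<le> e y" "0 \<le> h y" for y
    unfolding h_def e_def psi_def conj_convexity_def using \<beta>(1) by (auto intro!: continuous_intros)
  have joint: "continuous_on UNIV (\<lambda>(z, x). partials is (f (fst z) (snd z)) x)"
    if "continuous_on UNIV (\<lambda>(t, \<tau>, x). partials is (f t \<tau>) x)" for f :: "real \<Rightarrow> real \<Rightarrow> real ^ 'n \<Rightarrow> real" and "is"
  proof -
    have "continuous_on UNIV (\<lambda>q. (\<lambda>(t, \<tau>, x). partials is (f t \<tau>) x) (fst (fst q), snd (fst q), snd q))"
      by (rule continuous_on_compose2[OF that]) (auto intro!: continuous_intros)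
    thus ?thesis by (simp add: case_prod_unfold)
  qed
  have assoc: "continuous_on UNIV (\<lambda>p. f (fst p) (fst (snd p)) (snd (snd p)))" if "continuous_on UNIV (\<lambda>(z, x). f (fst z) (snd z) x)"
    for f :: "real \<Rightarrow> real \<Rightarrow> real ^ 'n \<Rightarrow> real"
    using continuous_on_compose2[OF that, of UNIV "\<lambda>p. ((fst p, fst (snd p)), snd (snd p))"]
    by (simp add: continuous_on_fst continuous_on_snd continuous_on_Pair)
  have cgrad: "continuous_on UNIV (\<lambda>p. (norm (gradient (W (fst p) (fst (snd p))) (snd (snd p))))\<^sup>2)"
    by (rule assoc[OF continuous_on_family_gradient[of "\<lambda>z. W (fst z) (snd z)", OF sW joint[OF cW]]])
  have clap: "continuous_on UNIV (\<lambda>p. laplacian (W (fst p) (fst (snd p))) (snd (snd p)))"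
    by (rule assoc[OF continuous_on_family_laplacian[of "\<lambda>z. W (fst z) (snd z)", OF sW joint[OF cW]]])
  have cHL: "continuous_on UNIV (\<lambda>(t, \<tau>, x). HL c t \<tau> x)" for c
    unfolding HL_def case_prod_unfold
    using cW[of "[]"] by (intro continuous_intros cgrad) (simp add: case_prod_unfold)
  have cHR: "continuous_on UNIV (\<lambda>(t, \<tau>, x). HR t \<tau> x)"
    unfolding HR_def case_prod_unfold
    using cWs[of "[]"] by (intro continuous_intros clap) (simp add: case_prod_unfold)
  define A where "A c = (\<integral>\<^sup>+ (s, y). ennreal (h y * (\<integral> x. HL (\<beta>\<^sup>2) (c + s) s (exp (- y) *\<^sub>R x) \<partial>sphere_measure)) \<partial>lborel)" for c
  define B where "B c = (\<integral>\<^sup>+ (s, y). ennreal (e y * (\<integral> x. HR (c + s) s (exp (- y) *\<^sub>R x) \<partial>sphere_measure)) \<partial>lborel)" for c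
  have phi: "(phi \<beta> x)\<^sup>2 = e (- ln (norm x))" for x :: "real ^ 'n" unfolding phi_def e_def ..
  have pw2: "norm x powr (- real CARD('n) + 2) = 1 / norm x ^ CARD('n) * (norm x)\<^sup>2"
    and pw0: "norm x powr (- real CARD('n)) = 1 / norm x ^ CARD('n)"
    and pw4: "norm x powr (- real CARD('n) + 4) = 1 / norm x ^ CARD('n) * norm x ^ 4" for x :: "real ^ 'n"
    using norm_powr_weight[of x 2] norm_powr_weight[of x 0] norm_powr_weight[of x 4] by simp_all
  have grad: "(norm (gradient (W t \<tau>) x))\<^sup>2 = (chi t)\<^sup>2 * (zeta \<tau>)\<^sup>2 * (norm (gradient (w t \<tau>) x))\<^sup>2" for t \<tau> x
    unfolding W_def by (simp add: gradient_cmult[OF sw] power_mult_distrib)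
  have A: "carleman_lhs \<beta> chi zeta w = (\<integral>\<^sup>+ c. A c \<partial>lborel)" and [measurable]: "A \<in> borel_measurable borel"
  proof -
    have F: "(phi \<beta> x)\<^sup>2 * (1 + psi'' \<beta> x) * (chi t)\<^sup>2 * (zeta \<tau>)\<^sup>2 *
       (norm x powr (- real CARD('n) + 2) * (norm (gradient (w t \<tau>) x))\<^sup>2 + \<beta>\<^sup>2 * norm x powr (- real CARD('n)) * \<bar>w t \<tau> x\<bar>\<^sup>2)
      = h (- ln (norm x)) * (1 / norm x ^ CARD('n)) * HL (\<beta>\<^sup>2) t \<tau> x" for t \<tau> x
      unfolding phi psi''_eq h_def HL_def grad pw2 pw0 by (simp add: W_def power_mult_distrib algebra_simps)
    have nn: "0 \<le> HL (\<beta>\<^sup>2) t \<tau> x" for t \<tau> x unfolding HL_def by simp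
    show "carleman_lhs \<beta> chi zeta w = (\<integral>\<^sup>+ c. A c \<partial>lborel)" "A \<in> borel_measurable borel"
      using iiint_polar_time_shear[OF ce(2,4) cHL nn F] unfolding carleman_lhs_def A_def[abs_def] by simp_all
  qed
  define I where "I = iiint (\<lambda>t \<tau> x. e (- ln (norm x)) * (1 / norm x ^ CARD('n)) * HR t \<tau> x)"
  have nnR: "0 \<le> HR t \<tau> x" for t \<tau> x unfolding HR_def by simp
  have B: "I = (\<integral>\<^sup>+ c. B c \<partial>lborel)" and [measurable]: "B \<in> borel_measurable borel"
    using iiint_polar_time_shear[OF ce(1,3) cHR nnR refl] unfolding I_def B_def[abs_def] by simp_all
  have AB: "A c \<le> 420 * B c" if Ac: "A c \<noteq> \<infinity>" for c
  proof -
    define g where "g s y x = exp (- 2 * y) * (laplacian (W (c + s) s) (exp (- y) *\<^sub>R x) - Ws (c + s) s (exp (- y) *\<^sub>R x))" for s y x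
    have e2: "(\<integral> x. HR (c + s) s (exp (- y) *\<^sub>R x) \<partial>sphere_measure)
      = (\<integral> x. (g s y x)\<^sup>2 \<partial>sphere_measure)" for s y
    proof (rule sphere_integral_cong)
      show "continuous_on UNIV (\<lambda>x. HR (c + s) s (exp (- y) *\<^sub>R x))"
        unfolding HR_def
        by (intro continuous_intros continuous_on_compose2[OF smooth_continuous[OF smooth_laplacian[OF sW]]]
            continuous_on_compose2[OF smooth_continuous[OF sWs]]) auto
      show "continuous_on UNIV (\<lambda>x. (g s y x)\<^sup>2)"
        unfolding g_def by (intro continuous_intros continuous_on_compose2[OF smooth_continuous[OF smooth_laplacian[OF sW]]]
            continuous_on_compose2[OF smooth_continuous[OF sWs]]) auto
      fix x :: "real ^ 'n" assume "norm x = 1"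
      hence "norm (exp (- y) *\<^sub>R x) ^ 4 = (exp (- 2 * y))\<^sup>2" by (simp flip: exp_of_nat_mult)
      thus "HR (c + s) s (exp (- y) *\<^sub>R x) = (g s y x)\<^sup>2"
        unfolding HR_def g_def power_mult_distrib by simp
    qed
    have "(\<integral>\<^sup>+ (s, y). ennreal (e y * (\<integral> x. HL 1 (c + s) s (exp (- y) *\<^sub>R x) \<partial>sphere_measure)) \<partial>lborel) \<le> A c"
      unfolding A_def
    proof (rule nn_integral_mono, clarsimp simp only: prod.case)
      fix s y
      have c: "continuous_on UNIV (\<lambda>x. HL d (c + s) s (exp (- y) *\<^sub>R x))" for d
      proof -
        have "continuous_on UNIV (\<lambda>x. (\<lambda>(t, \<tau>, x). HL d t \<tau> x) (c + s, s, exp (- y) *\<^sub>R x))"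
          by (rule continuous_on_compose2[OF cHL]) (auto intro!: continuous_intros)
        thus ?thesis by simp
      qed
      have "1 \<le> \<beta>\<^sup>2" using \<beta>(1) by (simp add: one_le_power)
      hence "HL 1 (c + s) s x \<le> HL (\<beta>\<^sup>2) (c + s) s x" for x
        unfolding HL_def using mult_right_mono[of 1 "\<beta>\<^sup>2" "(W (c + s) s x)\<^sup>2"] by simp
      hence "(\<integral> x. HL 1 (c + s) s (exp (- y) *\<^sub>R x) \<partial>sphere_measure) \<le> (\<integral> x. HL (\<beta>\<^sup>2) (c + s) s (exp (- y) *\<^sub>R x) \<partial>sphere_measure)"
        by (intro sphere_integral_mono c)
      moreover have "0 \<le> (\<integral> x. HL 1 (c + s) s (exp (- y) *\<^sub>R x) \<partial>sphere_measure)"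
        by (simp add: HL_def)
      moreover have "e y \<le> h y" unfolding h_def using ce(3)[of y] cc[of y] by (simp add: algebra_simps)
      ultimately show "ennreal (e y * (\<integral> x. HL 1 (c + s) s (exp (- y) *\<^sub>R x) \<partial>sphere_measure))
        \<le> ennreal (h y * (\<integral> x. HL (\<beta>\<^sup>2) (c + s) s (exp (- y) *\<^sub>R x) \<partial>sphere_measure))"
        by (intro ennreal_leI mult_mono ce) auto
    qed
    hence "(\<integral>\<^sup>+ (s, y). ennreal (e y * (\<integral> x. HL 1 (c + s) s (exp (- y) *\<^sub>R x) \<partial>sphere_measure)) \<partial>lborel) < \<infinity>"
      using Ac by (simp add: less_top order_le_less_trans)
    from slice_estimate[of "\<lambda>s. W (c + s) s" "\<lambda>s. Ws (c + s) s" R \<beta> j, OF n sW sWs dW diag[OF cW] diag[OF cWs] suppW \<beta>(2,1)] this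
    have "(\<integral>\<^sup>+ (s, y). ennreal (h y * (\<integral> x. HL (\<beta>\<^sup>2) (c + s) s (exp (- y) *\<^sub>R x) \<partial>sphere_measure)) \<partial>lborel)
       \<le> 420 * (\<integral>\<^sup>+ (s, y). ennreal (e y * (\<integral> x. (g s y x)\<^sup>2 \<partial>sphere_measure)) \<partial>lborel)"
      unfolding HL_def h_def e_def g_def by blast
    thus ?thesis unfolding A_def B_def e2 .
  qed
  \<comment> \<open>A finite total integral is finite on almost every line, which is the finiteness
    that \<open>slice_estimate\<close> asks for.\<close>
  have "AE c in lborel. A c \<noteq> \<infinity>"
    by (rule nn_integral_noteq_infinite) (use fin A in auto)
  hence "AE c in lborel. A c \<le> 420 * B c" by eventually_elim (rule AB)
  hence "(\<integral>\<^sup>+ c. A c \<partial>lborel) \<le> (\<integral>\<^sup>+ c. 420 * B c \<partial>lborel)" by (rule nn_integral_mono_AE)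
  also have "\<dots> = 420 * (\<integral>\<^sup>+ c. B c \<partial>lborel)" by (rule nn_integral_cmult) measurable
  finally have main: "carleman_lhs \<beta> chi zeta w \<le> 420 * I" unfolding A B .
  define a1 where "a1 t \<tau> x = chi t * zeta \<tau> * (laplacian (w t \<tau>) x - u t \<tau> x - v t \<tau> x)" for t \<tau> x
  define a2 where "a2 t \<tau> x = deriv chi t * zeta \<tau> * w t \<tau> x" for t \<tau> x
  define a3 where "a3 t \<tau> x = chi t * deriv zeta \<tau> * w t \<tau> x" for t \<tau> x
  define \<omega> where "\<omega> x = e (- ln (norm x)) * norm x powr (- real CARD('n) + 4)" for x :: "real ^ 'n"
  have \<omega>0: "0 \<le> \<omega> x" for x unfolding \<omega>_def using ce(3) by simp
  have [measurable]: "e \<in> borel_measurable borel" by (rule borel_measurable_continuous_onI[OF ce(1)])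
  have [measurable]: "\<omega> \<in> borel_measurable borel" unfolding \<omega>_def[abs_def] by measurable
  have clapw: "continuous_on UNIV (\<lambda>p. laplacian (w (fst p) (fst (snd p))) (snd (snd p)))"
    by (rule assoc[OF continuous_on_family_laplacian[of "\<lambda>z. w (fst z) (snd z)", OF sw joint[OF cw]]])
  have c0: "continuous_on UNIV (\<lambda>p. w (fst p) (fst (snd p)) (snd (snd p)))"
      "continuous_on UNIV (\<lambda>p. u (fst p) (fst (snd p)) (snd (snd p)))"
      "continuous_on UNIV (\<lambda>p. v (fst p) (fst (snd p)) (snd (snd p)))"
    using cw[of "[]"] cu[of "[]"] cv[of "[]"] by (simp_all add: case_prod_unfold)
  have ca: "continuous_on UNIV (\<lambda>p. a1 (fst p) (fst (snd p)) (snd (snd p)))"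
      "continuous_on UNIV (\<lambda>p. a2 (fst p) (fst (snd p)) (snd (snd p)))"
      "continuous_on UNIV (\<lambda>p. a3 (fst p) (fst (snd p)) (snd (snd p)))"
    unfolding a1_def a2_def a3_def by (intro continuous_intros clapw c0)+
  define K where "K a p = \<omega> (snd (snd p)) * (a (fst p) (fst (snd p)) (snd (snd p)))\<^sup>2"
    for a :: "real \<Rightarrow> real \<Rightarrow> real ^ 'n \<Rightarrow> real" and p
  have m: "K a \<in> borel_measurable borel"
    if "continuous_on UNIV (\<lambda>p. a (fst p) (fst (snd p)) (snd (snd p)))" for a :: "real \<Rightarrow> real \<Rightarrow> real ^ 'n \<Rightarrow> real"
  proof -
    have [measurable]: "(\<lambda>p. a (fst p) (fst (snd p)) (snd (snd p))) \<in> borel_measurable borel"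
      by (rule borel_measurable_continuous_onI[OF that])
    have [measurable]: "(\<lambda>p :: real \<times> real \<times> (real ^ 'n). snd (snd p)) \<in> borel_measurable borel"
      by (intro borel_measurable_continuous_onI continuous_intros)
    show ?thesis unfolding K_def[abs_def] by measurable
  qed
  define J where "J a = iiint (\<lambda>t \<tau> x. \<omega> x * (a t \<tau> x)\<^sup>2)" for a
  have J: "J a = (\<integral>\<^sup>+ p. ennreal (K a p) \<partial>lborel)"
    if "continuous_on UNIV (\<lambda>p. a (fst p) (fst (snd p)) (snd (snd p)))" for a :: "real \<Rightarrow> real \<Rightarrow> real ^ 'n \<Rightarrow> real"
    using iiint_eq_nn_integral[of "\<lambda>t \<tau> x. \<omega> x * (a t \<tau> x)\<^sup>2"] m[OF that] unfolding J_def K_def[abs_def] .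
  have lapW: "laplacian (W t \<tau>) x - Ws t \<tau> x = a1 t \<tau> x - a2 t \<tau> x - a3 t \<tau> x" for t \<tau> x
    unfolding W_def Ws_def a1_def a2_def a3_def D_def laplacian_cmult[OF sw] by (simp add: algebra_simps)
  have "I = J (\<lambda>t \<tau> x. a1 t \<tau> x - a2 t \<tau> x - a3 t \<tau> x)"
    unfolding I_def J_def HR_def lapW \<omega>_def pw4 by (simp add: mult.assoc)
  \<comment> \<open>The square of a three-term sum contributes the last factor of 1260 = 3 *
    420.\<close>
  also have "\<dots> \<le> 3 * (J a1 + J a2 + J a3)"
  proof -
    have "J (\<lambda>t \<tau> x. a1 t \<tau> x - a2 t \<tau> x - a3 t \<tau> x)
      = (\<integral>\<^sup>+ p. ennreal (K (\<lambda>t \<tau> x. a1 t \<tau> x - a2 t \<tau> x - a3 t \<tau> x) p) \<partial>lborel)"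
      by (rule J) (intro continuous_intros ca)
    also have "\<dots> \<le> (\<integral>\<^sup>+ p. 3 * (ennreal (K a1 p) + ennreal (K a2 p) + ennreal (K a3 p)) \<partial>lborel)"
    proof (rule nn_integral_mono)
      fix p :: "real \<times> real \<times> (real ^ 'n)"
      have "K (\<lambda>t \<tau> x. a1 t \<tau> x - a2 t \<tau> x - a3 t \<tau> x) p \<le> 3 * (K a1 p + K a2 p + K a3 p)"
        unfolding K_def distrib_left[symmetric] mult.left_commute[of 3]
        by (rule mult_left_mono[OF sum_three_squares_le \<omega>0])
      hence "ennreal (K (\<lambda>t \<tau> x. a1 t \<tau> x - a2 t \<tau> x - a3 t \<tau> x) p) \<le> ennreal (3 * (K a1 p + K a2 p + K a3 p))"
        by (rule ennreal_leI)
      also have "\<dots> = 3 * (ennreal (K a1 p) + ennreal (K a2 p) + ennreal (K a3 p))"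
        using \<omega>0 by (simp add: K_def ennreal_mult' ennreal_plus)
      finally show "ennreal (K (\<lambda>t \<tau> x. a1 t \<tau> x - a2 t \<tau> x - a3 t \<tau> x) p)
        \<le> 3 * (ennreal (K a1 p) + ennreal (K a2 p) + ennreal (K a3 p))" .
    qed
    also have "\<dots> = 3 * (J a1 + J a2 + J a3)"
    proof -
      note [measurable] = m[OF ca(1)] m[OF ca(2)] m[OF ca(3)]
      show ?thesis unfolding J[OF ca(1)] J[OF ca(2)] J[OF ca(3)]
        by (subst nn_integral_cmult, measurable, subst nn_integral_add, measurable, subst nn_integral_add, measurable)
    qed
    finally show ?thesis .
  qed
  also have "J a1 + J a2 + J a3 = carleman_rhs \<beta> chi zeta w"
  proof -
    have "deriv (\<lambda>s. w s \<tau> x) t = u t \<tau> x" "deriv (\<lambda>\<sigma>. w t \<sigma> x) \<tau> = v t \<tau> x" for t \<tau> x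
      using DERIV_imp_deriv[OF du[of "[]"]] DERIV_imp_deriv[OF dv[of "[]"]] by simp_all
    thus ?thesis unfolding carleman_rhs_def J_def a1_def a2_def a3_def \<omega>_def phi
      by (simp add: power_mult_distrib mult.assoc)
  qed
  finally have "420 * I \<le> 420 * (3 * carleman_rhs \<beta> chi zeta w)" by (rule mult_left_mono) simp
  hence "carleman_lhs \<beta> chi zeta w \<le> 420 * (3 * carleman_rhs \<beta> chi zeta w)" by (rule order_trans[OF main])
  thus ?thesis by (simp add: mult.assoc[symmetric])
qed

theorem lemma3p5:
  assumes "CARD('n::finite) \<ge> 2"
  shows "\<exists>\<beta>\<^sub>2::real. \<forall>chi zeta. C2_compact_support chi \<and> C2_compact_support zeta \<longrightarrow>
    (\<exists>C>0. \<forall>(w :: real \<Rightarrow> real \<Rightarrow> real ^ 'n \<Rightarrow> real) \<beta>.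
       C1_smooth w \<and>
       tsupport (\<lambda>(t, \<tau>, x). w t \<tau> x) \<subseteq> UNIV \<times> {0<..} \<times> {x. norm x < exp 1} \<and>
       \<beta> \<ge> \<beta>\<^sub>2 \<and> (\<exists>k::nat. \<beta> = real k + 1 / 4) \<and>
       carleman_lhs \<beta> chi zeta w < \<infinity> \<longrightarrow>
       carleman_lhs \<beta> chi zeta w \<le> ennreal C * carleman_rhs \<beta> chi zeta w)"
\<comment> \<open>2 serves in every dimension: the weight bounds ask for \<open>2 \<le> B\<close>,
  and \<open>B = \<beta> + (n - 2) / 2\<close> is at least \<beta>. The constant 1260 is
  absolute.\<close>
proof (rule exI[of _ 2], intro allI impI, elim conjE)
  fix chi zeta assume cz: "C2_compact_support chi" "C2_compact_support zeta"
  show "\<exists>C>0. \<forall>(w :: real \<Rightarrow> real \<Rightarrow> real ^ 'n \<Rightarrow> real) \<beta>.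
       C1_smooth w \<and>
       tsupport (\<lambda>(t, \<tau>, x). w t \<tau> x) \<subseteq> UNIV \<times> {0<..} \<times> {x. norm x < exp 1} \<and>
       \<beta> \<ge> 2 \<and> (\<exists>k::nat. \<beta> = real k + 1 / 4) \<and>
       carleman_lhs \<beta> chi zeta w < \<infinity> \<longrightarrow>
       carleman_lhs \<beta> chi zeta w \<le> ennreal C * carleman_rhs \<beta> chi zeta w"
    by (rule exI[of _ 1260]) (use carleman_estimate[OF assms cz] in auto)
qed

end
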